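(* Let $D<-4$ be the discriminant of an imaginary quadratic field with $D\equiv1\pmod4$ and $3\nmid D$, and let $N=|D|$, $\chi=\chi_D$. Then $$h(D)=\left|\sum_{1\le x<\frac N6}\chi(x)\right|.$$
   Context: Here $D\equiv 1\pmod 4$ is a negative square-free integer, the discriminant of $K=\mathbb{Q}(\sqrt D)$; $h(D)$ is the order of the ideal class group of $K$; and $\chi_D(x)=\left(\frac{x}{N}\right)$ is the Jacobi symbol (equal to $0$ when $\gcd(x,N)>1$). The sum is over integers $x$. *)

theory Defs
  imports
    Complex_Main
    "HOL-Computational_Algebra.Polynomial"
    "HOL-Computational_Algebra.Squarefree"
    "HOL-Algebra.Ideal_Product"
    "HOL-Number_Theory.Residues"
begin

definition quadratic_field :: "int \<Rightarrow> complex ring" where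
  "quadratic_field D =
     \<lparr>carrier = {of_rat a + of_rat b * csqrt (of_int D) | a b. True},
      monoid.mult = (*), one = 1, zero = 0, add = (+)\<rparr>"

definition integer_ring :: "int \<Rightarrow> complex set" where
  "integer_ring D = {x \<in> carrier (quadratic_field D). algebraic_int x}"

definition fractional_ideal :: "int \<Rightarrow> complex set \<Rightarrow> bool" where
  "fractional_ideal D I \<longleftrightarrow>
     additive_subgroup I (quadratic_field D) \<and>
     (\<forall>a\<in>integer_ring D. \<forall>x\<in>I. a * x \<in> I) \<and>
     I \<noteq> {0} \<and>
     (\<exists>d\<in>integer_ring D. d \<noteq> 0 \<and> (\<forall>x\<in>I. d * x \<in> integer_ring D))"

text \<open>
  Although \<^const>\<open>ideal_prod\<close> is intended for ideals of its ring argument, it only forms the finite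
  nonempty sums of products of elements of the two given sets. Taken in the field, this is the
  product of fractional ideals.
\<close>

definition fractional_ideal_group :: "int \<Rightarrow> complex set monoid" where
  "fractional_ideal_group D =
     \<lparr>carrier = {I. fractional_ideal D I},
      monoid.mult = ideal_prod (quadratic_field D),
      one = integer_ring D\<rparr>"

definition principal_fractional_ideals :: "int \<Rightarrow> complex set set" where
  "principal_fractional_ideals D =
     {(\<lambda>a. c * a) ` integer_ring D | c. c \<in> carrier (quadratic_field D) \<and> c \<noteq> 0}"

definition ideal_class_group :: "int \<Rightarrow> complex set set monoid" where
  "ideal_class_group D = fractional_ideal_group D Mod principal_fractional_ideals D"

definition class_number :: "int \<Rightarrow> nat" where
  "class_number D = Coset.order (ideal_class_group D)"

definition Jacobi :: "int \<Rightarrow> int \<Rightarrow> int" where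
  "Jacobi a n = (\<Prod>p\<in>#prime_factorization n. Legendre a p)"

definition chi :: "int \<Rightarrow> int \<Rightarrow> int" where
  "chi D x = Jacobi x \<bar>D\<bar>"

end

theory Submission
  imports
    Defs
    "HOL-Number_Theory.Quadratic_Reciprocity"
    "HOL-Analysis.Analysis"
    "HOL-Real_Asymp.Real_Asymp"
begin

text \<open>
  Write $D = 1 - 4m = -N$, let $\omega = (1 + \sqrt D)/2$, let $\chi$ be the Jacobi symbol modulo $N$
  and $L = \sum_n \chi(n)/n$. Dirichlet's formula $h(D)\,\pi = \sqrt N\, L$ comes from counting the
  nonzero ideals of norm at most $X$ in two ways, and the sum over $x < N/6$ is then another
  evaluation of $L$.

  \<^emph>\<open>Counting by classes.\<close> The cosets that make up the class group are the classes of fractional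
  ideals under multiplication by a nonzero element of the field, and each of them contains an ideal
  $A = \mathbb{Z} a + \mathbb{Z}(t + \omega)$ with $a \mid t^2 + t + m$. As $A \bar A \subseteq (a)$,
  the ideals in the class of $A$ are the sets $(\gamma/a) A$ with $0 \ne \gamma \in \bar A$, and
  $\gamma$ is determined up to sign because the only units are $\pm 1$. In coordinates the norm
  of $(\gamma/a)A$ is the value of a binary quadratic form of discriminant $D$, so the ideals of a
  class with norm at most $X$ are half as many as the nonzero lattice points in an ellipse, which is
  asymptotically $\pi X/\sqrt N$ (class_ideal_density). That this density is the same positive number
  for every class also shows that there are only finitely many classes.

  \<^emph>\<open>Counting by norms.\<close> Every nonzero ideal is $k(\mathbb{Z} a + \mathbb{Z}(t + \omega))$ for unique
  $k$, $a$ and $t$ modulo $a$, and has norm $k^2 a$. The number of ideals of norm $n$ is therefore a sum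
  over $k^2 \mid n$ of numbers of roots of $t^2 + t + m$ modulo $n/k^2$. These numbers are multiplicative.
  At a prime $p$ there are $1 + \left(\frac{D}{p}\right)$ roots for odd $p$, and quadratic reciprocity
  with its supplements turns this into $1 + \chi(p)$, also for $p = 2$. Lifting the roots to prime
  powers gives $\sum_{d \mid n} \chi(d)$ ideals of norm $n$ (ideal_count_eq_divisor_sum). The mean value
  of this divisor sum is $L$ by summation by parts, since the partial sums of $\chi$ are bounded
  (mean_of_divisor_sums).

  \<^emph>\<open>The sum up to $N/6$.\<close> The odd function that is $1$ on $(0, \pi/3)$ and $0$ on $(\pi/3, \pi)$ is a
  combination of three translates of the sawtooth $\sum_n \sin(n\theta)/n$. Evaluating its sine series at
  the angles $2\pi x/N$ and weighting by $\chi(x)$ brings in the Gauss sums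
  $\sum_x \chi(x) \sin(2\pi n x/N) = \chi(n)\tau$ with $\tau^2 = N$. The result is
  $\pi S = \tau \sum_n \chi(n)(1 - \cos(n\pi/3))/n$ for the sum $S$ in question. The factor
  $1 - \cos(n\pi/3)$ depends only on $\gcd(n, 6)$, so that the last series is
  $\frac12 (1 + \chi(2) + \chi(3) - \chi(6)) L$, which is $\pm L$ because neither $2$ nor $3$ divides $N$
  (sum_sixth_L_value). Hence $\pi |S| = \sqrt N\, L = \pi\, h(D)$.
\<close>

section \<open>Legendre and Jacobi symbols\<close>

lemma cong_iff_mod: "[a = b] (mod n) \<longleftrightarrow> a mod n = b mod n" for a b n :: int
  by (simp add: cong_iff_dvd_diff mod_eq_dvd_iff)

lemma Legendre_range: "Legendre a p \<in> {-1, 0, 1}"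
  by (simp add: Legendre_def)

lemma Legendre_eq_0_iff: "Legendre a p = 0 \<longleftrightarrow> p dvd a"
  by (simp add: Legendre_def cong_0_iff)

lemma Legendre_cong:
  assumes "[a = b] (mod p)" shows "Legendre a p = Legendre b p"
proof -
  have "[a = 0] (mod p) \<longleftrightarrow> [b = 0] (mod p)"
    using assms cong_sym cong_trans by blast
  moreover have "QuadRes p a \<longleftrightarrow> QuadRes p b"
    unfolding QuadRes_def using assms cong_sym cong_trans by blast
  ultimately show ?thesis by (simp add: Legendre_def)
qed

text \<open>
  The values $-1$, $0$, $1$ are distinct modulo an odd prime, so that Euler's criterion determines
  the symbol.
\<close>
lemma Legendre_eqI:
  fixes p :: nat
  assumes "prime p" "2 < p" "x \<in> {-1, 0, 1 :: int}" "[x = a ^ ((p - 1) div 2)] (mod int p)"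
  shows "Legendre a p = x"
proof -
  have "[Legendre a p = x] (mod int p)"
    using euler_criterion[OF assms(1,2), of a] assms(4) cong_sym cong_trans by blast
  then have "int p dvd Legendre a p - x" by (simp add: cong_iff_dvd_diff)
  moreover have "\<bar>Legendre a p - x\<bar> < int p"
    using Legendre_range[of a p] assms(2,3) by auto
  ultimately show ?thesis using zdvd_not_zless[of "\<bar>Legendre a p - x\<bar>" "int p"] by auto
qed

lemma Legendre_mult:
  fixes p :: nat
  assumes "prime p" "2 < p"
  shows "Legendre (a * b) p = Legendre a p * Legendre b p"
proof (rule Legendre_eqI[OF assms])
  show "Legendre a p * Legendre b p \<in> {-1, 0, 1}"
    using Legendre_range[of a p] Legendre_range[of b p] by auto
  show "[Legendre a p * Legendre b p = (a * b) ^ ((p - 1) div 2)] (mod int p)"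
    unfolding power_mult_distrib using euler_criterion[OF assms] by (intro cong_mult) auto
qed

definition chi4 :: "int \<Rightarrow> int" where
  "chi4 x = (if x mod 4 = 1 then 1 else -1)"

definition chi8 :: "int \<Rightarrow> int" where
  "chi8 x = (if x mod 8 = 1 \<or> x mod 8 = 7 then 1 else -1)"

lemma chi4_int: "chi4 (int p) = (if p mod 4 = 1 then 1 else -1)"
proof -
  have "int p mod 4 = int (p mod 4)" by (simp add: zmod_int)
  then show ?thesis by (simp add: chi4_def)
qed

lemma chi4_mult:
  assumes "odd x" "odd y" shows "chi4 (x * y) = chi4 x * chi4 y"
proof -
  have "x mod 4 = 1 \<or> x mod 4 = 3" "y mod 4 = 1 \<or> y mod 4 = 3" using assms by presburger+
  then show ?thesis unfolding chi4_def mod_mult_eq[of x 4 y, symmetric] by auto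
qed

lemma chi8_mult:
  assumes "odd x" "odd y" shows "chi8 (x * y) = chi8 x * chi8 y"
proof -
  have "x mod 8 \<in> {1, 3, 5, 7}" "y mod 8 \<in> {1, 3, 5, 7}"
    using assms unfolding insert_iff empty_iff by presburger+
  then show ?thesis unfolding chi8_def mod_mult_eq[of x 8 y, symmetric] by auto
qed

lemma Legendre_minus_1:
  fixes p :: nat
  assumes "prime p" "2 < p"
  shows "Legendre (-1) p = chi4 p"
proof (rule Legendre_eqI[OF assms])
  have "odd p" using assms prime_odd_nat by blast
  then have "p mod 4 = 1 \<and> even ((p - 1) div 2) \<or> p mod 4 = 3 \<and> odd ((p - 1) div 2)"
    by presburger
  then have "chi4 p = (-1) ^ ((p - 1) div 2)"
    unfolding chi4_int by auto
  then show "[chi4 p = (-1) ^ ((p - 1) div 2)] (mod int p)" by simp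
qed (simp add: chi4_def)

text \<open>
  Gauss's lemma for $a = 2$: with $p = 2h + 1$, the products $2x$ with $1 \le x \le h$ are already
  reduced modulo $p$, and exactly those with $x > \lfloor h/2 \rfloor$ exceed $h$.
\<close>
lemma Legendre_2:
  fixes p :: nat
  assumes "prime p" "2 < p"
  shows "Legendre 2 p = chi8 p"
proof -
  have "odd p" using assms prime_odd_nat by blast
  have "\<not> p dvd 2" using assms(2) by (auto dest: dvd_imp_le)
  then have "\<not> int p dvd 2" using int_dvd_int_iff[of p 2] by simp
  then interpret GAUSS p 2
    using assms by unfold_locales (auto simp: cong_0_iff)
  define h where "h = (int p - 1) div 2"
  have p: "int p = 2 * h + 1" unfolding h_def by (rule p_eq2)
  have h0: "h > 0" using p assms by linarith
  have "E = (\<lambda>x. 2 * x) ` {h div 2<..h}"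
  proof -
    have "C = (\<lambda>x. 2 * x) ` {0<..h}"
      unfolding C_def B_def A_def h_def[symmetric] image_image
      by (rule image_cong) (auto simp: p)
    then show ?thesis unfolding E_def h_def[symmetric] using h0 by (auto simp: image_iff)
  qed
  then have "card E = nat (h - h div 2)" by (simp add: card_image inj_on_def)
  then have "Legendre 2 p = (-1) ^ nat (h - h div 2)" using gauss_lemma by simp
  moreover have "even (nat (h - h div 2)) \<longleftrightarrow> int p mod 8 = 1 \<or> int p mod 8 = 7"
  proof -
    have "h - h div 2 \<ge> 0" using h0 by linarith
    then have "even (nat (h - h div 2)) \<longleftrightarrow> even (h - h div 2)" by (rule even_nat_iff)
    also have "\<dots> \<longleftrightarrow> (2 * h + 1) mod 8 = 1 \<or> (2 * h + 1) mod 8 = 7"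
      by presburger
    finally show ?thesis by (simp only: p)
  qed
  ultimately show ?thesis by (simp add: chi8_def)
qed

lemma Legendre_reciprocity:
  fixes p q :: nat
  assumes "prime p" "2 < p" "prime q" "2 < q" "p \<noteq> q"
  shows "Legendre p q = Legendre q p * (if p mod 4 = 1 then 1 else chi4 q)"
proof -
  have "odd p" "odd q" using assms prime_odd_nat by blast+
  then have p: "p mod 4 = 1 \<and> even ((p - 1) div 2) \<or> p mod 4 = 3 \<and> odd ((p - 1) div 2)"
    and q: "q mod 4 = 1 \<and> even ((q - 1) div 2) \<or> q mod 4 = 3 \<and> odd ((q - 1) div 2)"
    by presburger+
  have "(-1::int) ^ ((p - 1) div 2 * ((q - 1) div 2)) = (if p mod 4 = 1 then 1 else chi4 q)"
    using p q by (auto simp: chi4_int power_mult)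
  then have rec: "Legendre p q * Legendre q p = (if p mod 4 = 1 then 1 else chi4 q)"
    using Quadratic_Reciprocity[OF assms] by simp
  have "\<not> p dvd q" using assms primes_dvd_imp_eq by blast
  then have "Legendre q p \<noteq> 0" by (simp add: Legendre_eq_0_iff)
  then have "Legendre q p * Legendre q p = 1" using Legendre_range[of q p] by auto
  then have "Legendre p q = Legendre p q * Legendre q p * Legendre q p" by (simp add: mult.assoc)
  then show ?thesis unfolding rec by (simp add: mult.commute)
qed

text \<open>
  The tool that carries a law for the Legendre symbol over to the Jacobi symbol: the sign functions
  that occur in the supplements and in the reciprocity law are multiplicative on odd numbers.
\<close>
lemma prod_mset_odd_multiplicative:
  fixes f :: "int \<Rightarrow> int"
  assumes "f 1 = 1" "\<And>x y. odd x \<Longrightarrow> odd y \<Longrightarrow> f (x * y) = f x * f y"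
    and "\<And>q. q \<in># M \<Longrightarrow> odd q"
  shows "f (\<Prod>\<^sub># M) = (\<Prod>q\<in>#M. f q)"
proof -
  have "odd (\<Prod>\<^sub># M) \<and> f (\<Prod>\<^sub># M) = (\<Prod>q\<in>#M. f q)"
    using assms(3) by (induction M) (auto simp: assms(1,2))
  then show ?thesis ..
qed

context
  fixes n :: int
  assumes n: "0 < n" "odd n"
begin

lemma prime_factor_odd:
  assumes "q \<in># prime_factorization n"
  obtains p where "q = int p" "prime p" "2 < p" "int p dvd n"
proof -
  have q: "prime q" "q dvd n" using assms by (auto simp: in_prime_factors_iff)
  then have "q \<noteq> 2" using n by auto
  moreover have "q \<ge> 2" using q(1) prime_ge_2_int by blast
  moreover obtain p where p: "q = int p" using \<open>q \<ge> 2\<close> nonneg_int_cases[of q] by auto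
  moreover have "prime p" using q(1) p by simp
  ultimately show ?thesis using q that[of p] by simp
qed

lemma Jacobi_eq_multiplicative:
  assumes "f 1 = 1" "\<And>x y. odd x \<Longrightarrow> odd y \<Longrightarrow> f (x * y) = f x * f y"
    and "\<And>p :: nat. prime p \<Longrightarrow> 2 < p \<Longrightarrow> int p dvd n \<Longrightarrow> Legendre a p = f (int p)"
  shows "Jacobi a n = f n"
proof -
  have "f (\<Prod>\<^sub># (prime_factorization n)) = (\<Prod>q\<in>#prime_factorization n. f q)"
    by (rule prod_mset_odd_multiplicative[where f = f, OF assms(1,2)]) (use n in \<open>auto elim!: prime_factor_odd dest: prime_odd_nat\<close>)
  moreover have "(\<Prod>q\<in>#prime_factorization n. f q) = Jacobi a n"
    unfolding Jacobi_def
    by (intro arg_cong[where f = prod_mset] image_mset_cong) (auto elim!: prime_factor_odd simp: assms(3))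
  ultimately show ?thesis using n by (simp add: prod_mset_prime_factorization_int)
qed

lemma Jacobi_minus_1: "Jacobi (-1) n = chi4 n"
  by (rule Jacobi_eq_multiplicative) (auto simp: chi4_mult Legendre_minus_1, simp add: chi4_def)

lemma Jacobi_2: "Jacobi 2 n = chi8 n"
  by (rule Jacobi_eq_multiplicative) (auto simp: chi8_mult Legendre_2, simp add: chi8_def)

lemma Jacobi_reciprocity:
  fixes p :: nat
  assumes "prime p" "2 < p" "\<not> int p dvd n"
  shows "Jacobi p n = Legendre n p * (if p mod 4 = 1 then 1 else chi4 n)"
proof (rule Jacobi_eq_multiplicative)
  have "\<not> QuadRes p 1 \<Longrightarrow> False" unfolding QuadRes_def by (metis cong_refl one_power2)
  then show "Legendre 1 p * (if p mod 4 = 1 then 1 else chi4 1) = 1"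
    using assms by (auto simp: Legendre_def chi4_def cong_0_iff)
  show "Legendre (x * y) p * (if p mod 4 = 1 then 1 else chi4 (x * y)) =
      Legendre x p * (if p mod 4 = 1 then 1 else chi4 x) *
      (Legendre y p * (if p mod 4 = 1 then 1 else chi4 y))" if "odd x" "odd y" for x y
    using that assms by (simp add: Legendre_mult chi4_mult)
  show "Legendre p q = Legendre q p * (if p mod 4 = 1 then 1 else chi4 q)"
    if "prime q" "2 < q" "int q dvd n" for q
    using that assms by (intro Legendre_reciprocity) auto
qed

lemma Jacobi_mult: "Jacobi (a * b) n = Jacobi a n * Jacobi b n"
proof -
  have "Jacobi (a * b) n = (\<Prod>q\<in>#prime_factorization n. Legendre a q * Legendre b q)"
    unfolding Jacobi_def
    by (intro arg_cong[where f = prod_mset] image_mset_cong) (auto elim!: prime_factor_odd simp: Legendre_mult)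
  then show ?thesis by (simp add: Jacobi_def prod_mset.distrib)
qed

lemma Jacobi_cong:
  assumes "[a = b] (mod n)" shows "Jacobi a n = Jacobi b n"
  unfolding Jacobi_def
  by (intro arg_cong[where f = prod_mset] image_mset_cong Legendre_cong)
    (auto simp: in_prime_factors_iff intro: cong_dvd_modulus[OF assms])

lemma Jacobi_eq_0_iff: "Jacobi a n = 0 \<longleftrightarrow> \<not> coprime a n"
proof -
  have "Jacobi a n = 0 \<longleftrightarrow> (\<exists>q. prime q \<and> q dvd n \<and> q dvd a)"
    using n by (auto simp: Jacobi_def prod_mset_zero_iff Legendre_eq_0_iff in_prime_factors_iff)
  also have "\<dots> \<longleftrightarrow> \<not> coprime a n"
  proof
    assume "\<not> coprime a n"
    then have "gcd a n \<noteq> 0" "\<not> is_unit (gcd a n)"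
      using n by (auto simp: coprime_iff_gcd_eq_1)
    then obtain q where "prime q" "q dvd gcd a n" using prime_divisor_exists by blast
    then show "\<exists>q. prime q \<and> q dvd n \<and> q dvd a" by auto
  qed (meson coprime_common_divisor not_prime_unit)
  finally show ?thesis .
qed

lemma Jacobi_range: "Jacobi a n \<in> {-1, 0, 1}"
proof -
  have "(\<Prod>q\<in>#M. Legendre a q) \<in> {-1, 0, 1}" for M
  proof (induction M)
    case (add q M)
    then show ?case using Legendre_range[of a q] by auto
  qed simp
  then show ?thesis by (simp add: Jacobi_def)
qed

end

text \<open>
  For $n \equiv 3 \pmod 4$ the sign $(-1)^{(p-1)/2}$ in the reciprocity law is $\left(\frac{-1}{p}\right)$,
  so it is absorbed by replacing $n$ with the discriminant $-n$.
\<close>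
lemma Jacobi_eq_Legendre_discriminant:
  fixes n :: int and p :: nat
  assumes "0 < n" "n mod 4 = 3" "prime p" "2 < p"
  shows "Jacobi p n = Legendre (- n) p"
proof (cases "int p dvd n")
  case True
  then have "\<not> coprime (int p) n" using assms(3)
    by (metis coprime_absorb_left not_prime_unit prime_nat_int_transfer)
  moreover have "odd n" using assms(2) by presburger
  ultimately have "Jacobi p n = 0" using assms(1) Jacobi_eq_0_iff by blast
  then show ?thesis using True by (simp add: Legendre_eq_0_iff)
next
  case False
  have "odd n" using assms(2) by presburger
  moreover have "p mod 4 = 1 \<or> p mod 4 = 3" using assms prime_odd_nat[of p] by presburger
  ultimately have "Jacobi p n = Legendre n p * chi4 p"
    using assms False by (auto simp: Jacobi_reciprocity chi4_int chi4_def[of n])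
  also have "\<dots> = Legendre (n * - 1) p"
    unfolding Legendre_mult[OF assms(3,4)] using assms by (simp add: Legendre_minus_1)
  finally show ?thesis by simp
qed

section \<open>Roots of the minimal polynomial modulo an integer\<close>

text \<open>
  The polynomial is the norm of $t + \omega$ for $\omega = (1 + \sqrt{1 - 4m})/2$.
\<close>
definition minpoly_at :: "int \<Rightarrow> int \<Rightarrow> int" where
  "minpoly_at m t = t\<^sup>2 + t + m"

definition minpoly_roots :: "int \<Rightarrow> nat \<Rightarrow> int set" where
  "minpoly_roots m a = {t. 0 \<le> t \<and> t < int a \<and> int a dvd minpoly_at m t}"

definition root_count :: "int \<Rightarrow> nat \<Rightarrow> nat" where
  "root_count m a = card (minpoly_roots m a)"

lemma finite_minpoly_roots: "finite (minpoly_roots m a)"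
  by (rule finite_subset[of _ "{0..int a}"]) (auto simp: minpoly_roots_def)

lemma minpoly_at_diff: "minpoly_at m t - minpoly_at m s = (t - s) * (t + s + 1)"
  by (simp add: minpoly_at_def power2_eq_square algebra_simps)

lemma minpoly_at_discriminant: "4 * minpoly_at m t = (2 * t + 1)\<^sup>2 - (1 - 4 * m)"
  by (simp add: minpoly_at_def power2_eq_square algebra_simps)

lemma dvd_minpoly_at_cong:
  assumes "[t = s] (mod d)"
  shows "d dvd minpoly_at m t \<longleftrightarrow> d dvd minpoly_at m s"
proof -
  have "d dvd minpoly_at m t - minpoly_at m s"
    using assms unfolding minpoly_at_diff by (simp add: cong_iff_dvd_diff)
  then show ?thesis using dvd_diffD by (metis dvd_diff_commute dvd_diff_right_iff)
qed

lemma mod_in_roots: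
  assumes "0 < a" "int a dvd minpoly_at m t"
  shows "t mod int a \<in> minpoly_roots m a"
proof -
  have "[t mod int a = t] (mod int a)" by simp
  from dvd_minpoly_at_cong[OF this, of m] show ?thesis using assms by (simp add: minpoly_roots_def)
qed

lemma minpoly_roots_eqI:
  assumes "t \<in> minpoly_roots m a" "s \<in> minpoly_roots m a" "int a dvd t - s"
  shows "t = s"
proof -
  have "[t = s] (mod int a)" using assms(3) by (simp add: cong_iff_dvd_diff)
  then show ?thesis using assms(1,2) cong_less_imp_eq_int by (auto simp: minpoly_roots_def)
qed

lemma root_count_1: "root_count m 1 = 1"
proof -
  have "minpoly_roots m 1 = {0}" by (auto simp: minpoly_roots_def)
  then show ?thesis by (simp add: root_count_def)
qed

text \<open>
  The Chinese remainder theorem for the roots.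
\<close>
lemma root_count_mult:
  assumes "coprime u v" "0 < u" "0 < v"
  shows "root_count m (u * v) = root_count m u * root_count m v"
proof -
  have cop: "coprime (int u) (int v)" using assms(1) by simp
  let ?f = "\<lambda>t. (t mod int u, t mod int v)"
  have "bij_betw ?f (minpoly_roots m (u * v)) (minpoly_roots m u \<times> minpoly_roots m v)"
    unfolding bij_betw_def
  proof
    show "inj_on ?f (minpoly_roots m (u * v))"
    proof (rule inj_onI)
      fix t s assume ts: "t \<in> minpoly_roots m (u * v)" "s \<in> minpoly_roots m (u * v)" "?f t = ?f s"
      then have "int u dvd t - s" "int v dvd t - s" by (auto simp: mod_eq_dvd_iff)
      then have "int (u * v) dvd t - s" using divides_mult[OF _ _ cop] by simp
      then show "t = s" using minpoly_roots_eqI ts by blast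
    qed
    show "?f ` minpoly_roots m (u * v) = minpoly_roots m u \<times> minpoly_roots m v"
    proof
      show "?f ` minpoly_roots m (u * v) \<subseteq> minpoly_roots m u \<times> minpoly_roots m v"
        using assms by (auto simp: minpoly_roots_def[of m "u * v"] intro!: mod_in_roots dest: dvd_mult_left dvd_mult_right)
      show "minpoly_roots m u \<times> minpoly_roots m v \<subseteq> ?f ` minpoly_roots m (u * v)"
      proof clarify
        fix t s assume ts: "t \<in> minpoly_roots m u" "s \<in> minpoly_roots m v"
        obtain x where x: "[x = t] (mod int u)" "[x = s] (mod int v)"
          using binary_chinese_remainder_int[OF cop] by blast
        have "int u dvd minpoly_at m x" "int v dvd minpoly_at m x"
          using dvd_minpoly_at_cong[OF x(1)] dvd_minpoly_at_cong[OF x(2)] ts by (auto simp: minpoly_roots_def)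
        then have "int (u * v) dvd minpoly_at m x" using divides_mult[OF _ _ cop] by simp
        then have "x mod int (u * v) \<in> minpoly_roots m (u * v)"
          using assms by (intro mod_in_roots) auto
        moreover have "t = x mod int (u * v) mod int u" "s = x mod int (u * v) mod int v"
          using x ts by (auto simp: mod_mod_cancel cong_iff_mod minpoly_roots_def)
        ultimately show "(t, s) \<in> ?f ` minpoly_roots m (u * v)" by blast
      qed
    qed
  qed
  then have "card (minpoly_roots m (u * v)) = card (minpoly_roots m u \<times> minpoly_roots m v)"
    by (rule bij_betw_same_card)
  then show ?thesis by (simp add: root_count_def card_cartesian_product)
qed

text \<open>
  If $t_0$ is a root then $f(t) - f(t_0) = (t - t_0)(t + t_0 + 1)$, so the roots modulo $p$ are $t_0$
  and $-1 - t_0$. They coincide exactly if $p$ divides $(2 t_0 + 1)^2 \equiv 1 - 4m$.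
\<close>
lemma root_count_prime_root:
  assumes p: "prime p" and t0: "int p dvd minpoly_at m t0"
  shows "root_count m p = (if int p dvd 1 - 4 * m then 1 else 2)"
proof -
  have p0: "0 < p" using p by (simp add: prime_gt_0_nat)
  have eq: "minpoly_roots m p = {t0 mod int p, (- 1 - t0) mod int p}"
  proof
    show "minpoly_roots m p \<subseteq> {t0 mod int p, (- 1 - t0) mod int p}"
    proof
      fix t assume t: "t \<in> minpoly_roots m p"
      then have "int p dvd minpoly_at m t - minpoly_at m t0" using t0 by (auto simp: minpoly_roots_def)
      then have "int p dvd t - t0 \<or> int p dvd t + t0 + 1"
        unfolding minpoly_at_diff using p prime_dvd_mult_iff[of "int p"] by simp
      moreover have "t + t0 + 1 = t - (- 1 - t0)" by simp
      ultimately have "int p dvd t - t0 \<or> int p dvd t - (- 1 - t0)" by simp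
      then have "t mod int p = t0 mod int p \<or> t mod int p = (- 1 - t0) mod int p"
        by (auto simp: mod_eq_dvd_iff)
      then show "t \<in> {t0 mod int p, (- 1 - t0) mod int p}" using t by (auto simp: minpoly_roots_def)
    qed
    have "minpoly_at m (- 1 - t0) = minpoly_at m t0"
      by (simp add: minpoly_at_def power2_eq_square algebra_simps)
    then show "{t0 mod int p, (- 1 - t0) mod int p} \<subseteq> minpoly_roots m p"
      using t0 p0 mod_in_roots[of p m t0] mod_in_roots[of p m "- 1 - t0"] by auto
  qed
  have "int p dvd 1 - 4 * m \<longleftrightarrow> int p dvd (2 * t0 + 1)\<^sup>2"
  proof -
    have "int p dvd (2 * t0 + 1)\<^sup>2 - (1 - 4 * m)"
      unfolding minpoly_at_discriminant[symmetric] using t0 by simp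
    then show ?thesis by (metis dvd_diff_left_iff dvd_diff_right_iff)
  qed
  also have "\<dots> \<longleftrightarrow> int p dvd 2 * t0 + 1"
    using p by (simp add: prime_dvd_power_iff)
  also have "\<dots> \<longleftrightarrow> t0 mod int p = (- 1 - t0) mod int p"
    by (simp add: mod_eq_dvd_iff algebra_simps)
  finally show ?thesis unfolding root_count_def eq by auto
qed

lemma root_count_eq_0:
  assumes "\<And>t. \<not> int a dvd minpoly_at m t"
  shows "root_count m a = 0"
  using assms by (auto simp: root_count_def minpoly_roots_def)

text \<open>
  Hensel's lemma: the derivative $2t + 1$ has square $1 - 4m$ at a root and so is invertible
  modulo $p$, also for $p = 2$. Each root modulo $p^e$ therefore lifts to exactly one root modulo
  $p^{e+1}$.
\<close>
lemma root_count_prime_Suc: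
  assumes p: "prime p" and nd: "\<not> int p dvd 1 - 4 * m" and e: "1 \<le> e"
  shows "root_count m (p ^ Suc e) = root_count m (p ^ e)"
proof -
  have p0: "0 < p" using p by (simp add: prime_gt_0_nat)
  have prime_int: "prime (int p)" using p by simp
  have simple: "\<not> int p dvd 2 * t + 1" if "int p dvd minpoly_at m t" for t
  proof
    assume "int p dvd 2 * t + 1"
    then have "int p dvd (2 * t + 1)\<^sup>2" by (simp add: power2_eq_square)
    moreover have "int p dvd (2 * t + 1)\<^sup>2 - (1 - 4 * m)"
      unfolding minpoly_at_discriminant[symmetric] using that by simp
    ultimately show False using nd by (metis dvd_diff_right_iff)
  qed
  have pe: "int p dvd int (p ^ e)" "int p dvd int (p ^ Suc e)" using e by simp_all
  let ?f = "\<lambda>t. t mod int (p ^ e)"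
  have "bij_betw ?f (minpoly_roots m (p ^ Suc e)) (minpoly_roots m (p ^ e))"
    unfolding bij_betw_def
  proof
    show "inj_on ?f (minpoly_roots m (p ^ Suc e))"
    proof (rule inj_onI)
      fix t s assume ts: "t \<in> minpoly_roots m (p ^ Suc e)" "s \<in> minpoly_roots m (p ^ Suc e)" "?f t = ?f s"
      then have d: "int (p ^ e) dvd t - s" by (simp only: mod_eq_dvd_iff)
      have "int p dvd minpoly_at m t" using ts(1) pe by (auto simp: minpoly_roots_def intro: dvd_trans)
      then have "\<not> int p dvd 2 * t + 1" by (rule simple)
      moreover have "int p dvd t - s" using d pe dvd_trans by blast
      then have "int p dvd 2 * t + 1 - (t + s + 1)" by simp
      ultimately have "\<not> int p dvd t + s + 1" by (metis dvd_diff_left_iff)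
      then have "coprime (int (p ^ Suc e)) (t + s + 1)"
        using prime_imp_coprime[OF prime_int] by simp
      moreover have "int (p ^ Suc e) dvd minpoly_at m t - minpoly_at m s"
        using ts by (auto simp: minpoly_roots_def intro: dvd_diff)
      ultimately have "int (p ^ Suc e) dvd t - s"
        unfolding minpoly_at_diff by (simp only: coprime_dvd_mult_left_iff)
      then show "t = s" using minpoly_roots_eqI ts by blast
    qed
    show "?f ` minpoly_roots m (p ^ Suc e) = minpoly_roots m (p ^ e)"
    proof
      show "?f ` minpoly_roots m (p ^ Suc e) \<subseteq> minpoly_roots m (p ^ e)"
      proof
        fix y assume "y \<in> ?f ` minpoly_roots m (p ^ Suc e)"
        then obtain t where t: "t \<in> minpoly_roots m (p ^ Suc e)" "y = ?f t" by blast
        have "int (p ^ e) dvd int (p ^ Suc e)" by simp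
        then have "int (p ^ e) dvd minpoly_at m t" using t(1) dvd_trans by (auto simp: minpoly_roots_def)
        then show "y \<in> minpoly_roots m (p ^ e)" unfolding t(2) using p0 by (intro mod_in_roots) auto
      qed
      show "minpoly_roots m (p ^ e) \<subseteq> ?f ` minpoly_roots m (p ^ Suc e)"
      proof
        fix t assume t: "t \<in> minpoly_roots m (p ^ e)"
        then obtain c where c: "minpoly_at m t = int (p ^ e) * c" by (auto simp: minpoly_roots_def)
        have "int p dvd minpoly_at m t" using pe c by simp
        then have "coprime (int p) (2 * t + 1)"
          using simple prime_imp_coprime[OF prime_int] by blast
        then have "coprime (2 * t + 1) (int p)" by (simp only: coprime_commute)
        then obtain j where "[(2 * t + 1) * j = 1] (mod int p)" using cong_solve_coprime_int by blast
        then have j: "int p dvd (2 * t + 1) * j - 1" by (simp add: cong_iff_dvd_diff)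
        (* Newton's step: j is an inverse of the derivative 2 t + 1 modulo p. *)
        define x where "x = t + (- c * j) * int (p ^ e)"
        have "minpoly_at m x = int (p ^ e) * (- c * ((2 * t + 1) * j - 1)) + (c * j)\<^sup>2 * (int (p ^ e) * int (p ^ e))"
          using c unfolding x_def minpoly_at_def by (simp add: power2_eq_square algebra_simps)
        moreover have "int (p ^ Suc e) dvd int (p ^ e) * (- c * ((2 * t + 1) * j - 1))"
          using j by (simp add: mult.commute)
        moreover have "int (p ^ Suc e) dvd int (p ^ e) * int (p ^ e)"
        proof -
          have "p ^ Suc e dvd p ^ (e + e)" using e by (intro le_imp_power_dvd) simp
          then have "int (p ^ Suc e) dvd int (p ^ (e + e))" by (simp only: int_dvd_int_iff)
          then show ?thesis by (simp add: power_add)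
        qed
        ultimately have "int (p ^ Suc e) dvd minpoly_at m x" by (simp add: dvd_add)
        then have "x mod int (p ^ Suc e) \<in> minpoly_roots m (p ^ Suc e)"
          using p0 by (intro mod_in_roots) auto
        moreover have "x mod int (p ^ Suc e) mod int (p ^ e) = t"
        proof -
          have "x mod int (p ^ Suc e) mod int (p ^ e) = x mod int (p ^ e)"
            by (rule mod_mod_cancel) simp
          also have "\<dots> = t mod int (p ^ e)" unfolding x_def by (rule mod_mult_self1)
          also have "\<dots> = t" using t unfolding minpoly_roots_def by (intro mod_pos_pos_trivial) auto
          finally show ?thesis .
        qed
        ultimately show "t \<in> ?f ` minpoly_roots m (p ^ Suc e)" by force
      qed
    qed
  qed
  then show ?thesis unfolding root_count_def by (rule bij_betw_same_card)
qed

text \<open>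
  From $4 f(t) = (2t+1)^2 - (1 - 4m)$ and $p \mid 1 - 4m$, a root modulo $p^2$ would give
  $p^2 \mid 1 - 4m$.
\<close>
lemma root_count_ramified:
  assumes "prime p" "int p dvd 1 - 4 * m" "squarefree (1 - 4 * m)" "2 \<le> e"
  shows "root_count m (p ^ e) = 0"
proof (rule root_count_eq_0)
  fix t
  show "\<not> int (p ^ e) dvd minpoly_at m t"
  proof
    assume "int (p ^ e) dvd minpoly_at m t"
    moreover have "(int p)\<^sup>2 dvd int (p ^ e)" using assms(4) by (simp add: le_imp_power_dvd)
    ultimately have d: "(int p)\<^sup>2 dvd (2 * t + 1)\<^sup>2 - (1 - 4 * m)"
      unfolding minpoly_at_discriminant[symmetric] by (meson dvd_mult dvd_trans)
    then have "int p dvd (2 * t + 1)\<^sup>2 - (1 - 4 * m)"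
      by (auto simp: power2_eq_square dest: dvd_mult_left)
    then have "int p dvd (2 * t + 1)\<^sup>2" using assms(2) by (metis dvd_diff_left_iff)
    then have "int p dvd 2 * t + 1" using assms(1) by (simp add: prime_dvd_power_iff)
    then have "(int p)\<^sup>2 dvd (2 * t + 1)\<^sup>2" by (rule dvd_power_same)
    then have "(int p)\<^sup>2 dvd 1 - 4 * m" using d by (metis dvd_diff_right_iff)
    then have "is_unit (int p)" using assms(3) unfolding squarefree_def by blast
    then show False using assms(1) not_prime_unit[of "int p"] by simp
  qed
qed

section \<open>The number of ideals of given norm as a divisor sum\<close>

text \<open>
  Ideals of norm $n$ are $k(\mathbb{Z} a + \mathbb{Z}(t + \omega))$ with $k^2 a = n$ and $t$ a root
  modulo $a$; see card_ideals_of_norm.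
\<close>
definition ideal_count :: "int \<Rightarrow> nat \<Rightarrow> nat" where
  "ideal_count m n = (\<Sum>k | k\<^sup>2 dvd n. root_count m (n div k\<^sup>2))"

definition divisor_sum :: "(nat \<Rightarrow> int) \<Rightarrow> nat \<Rightarrow> int" where
  "divisor_sum f n = (\<Sum>d | d dvd n. f d)"

lemma finite_square_divisors: "0 < n \<Longrightarrow> finite {k :: nat. k\<^sup>2 dvd n}"
  by (rule finite_subset[of _ "{..n}"]) (auto dest!: dvd_imp_le intro: order_trans[OF power2_nat_le_imp_le[OF order_refl]] simp: power2_nat_le_imp_le)

text \<open>
  The divisors $k$ with $k^2 \mid p^e v$ are split into those prime to $p$, which satisfy $k^2 \mid v$,
  and the multiples of $p$, which come from $p^{e-2} v$. The resulting recursion in $e$ is the one that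
  is compared with the geometric sum in divisor_sum_prime_power_mult.
\<close>
lemma ideal_count_prime_power_mult:
  assumes p: "prime p" "\<not> p dvd v" and v: "0 < v"
  shows "ideal_count m (p ^ e * v) =
    root_count m (p ^ e) * ideal_count m v + (if 2 \<le> e then ideal_count m (p ^ (e - 2) * v) else 0)"
proof -
  have p0: "0 < p" using p by (simp add: prime_gt_0_nat)
  let ?n = "p ^ e * v"
  let ?A = "{k. k\<^sup>2 dvd v}" and ?B = "{k. k\<^sup>2 dvd ?n \<and> p dvd k}"
  have cop: "coprime (p ^ e) v" using p by (simp add: prime_imp_coprime)
  have split: "{k. k\<^sup>2 dvd ?n} = ?A \<union> ?B"
  proof
    show "{k. k\<^sup>2 dvd ?n} \<subseteq> ?A \<union> ?B"
    proof
      fix k assume k: "k \<in> {k. k\<^sup>2 dvd ?n}"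
      show "k \<in> ?A \<union> ?B"
      proof (cases "p dvd k")
        case False
        then have "coprime p k" using p by (simp add: prime_imp_coprime)
        then have "coprime (k\<^sup>2) (p ^ e)" by (simp add: coprime_commute)
        then show ?thesis using k by (simp add: coprime_dvd_mult_right_iff)
      qed (use k in auto)
    qed
  qed auto
  have disj: "?A \<inter> ?B = {}"
    using p(2) by (auto simp: power2_eq_square dest: dvd_mult_left dvd_trans)
  have fin: "finite ?A" "finite ?B"
    using finite_square_divisors[of ?n] finite_square_divisors[of v] p0 v by auto
  have "ideal_count m ?n =
    (\<Sum>k\<in>?A. root_count m (?n div k\<^sup>2)) + (\<Sum>k\<in>?B. root_count m (?n div k\<^sup>2))"
    unfolding ideal_count_def split by (rule sum.union_disjoint) (use fin disj in auto)
  also have "(\<Sum>k\<in>?A. root_count m (?n div k\<^sup>2)) = root_count m (p ^ e) * ideal_count m v"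
    unfolding ideal_count_def sum_distrib_left
  proof (rule sum.cong)
    fix k assume "k \<in> ?A"
    then obtain w where w: "v = k\<^sup>2 * w" by auto
    then have kw: "0 < w" "0 < k" using v by auto
    have "coprime (p ^ e) w" using cop w by simp
    then have "root_count m (p ^ e * w) = root_count m (p ^ e) * root_count m w"
      using kw p0 by (intro root_count_mult) auto
    moreover have "?n div k\<^sup>2 = p ^ e * w" "v div k\<^sup>2 = w" using kw w by simp_all
    ultimately show "root_count m (?n div k\<^sup>2) = root_count m (p ^ e) * root_count m (v div k\<^sup>2)"
      by simp
  qed simp
  also have "(\<Sum>k\<in>?B. root_count m (?n div k\<^sup>2)) = (if 2 \<le> e then ideal_count m (p ^ (e - 2) * v) else 0)"
  proof (cases "2 \<le> e")
    case True
    have pe: "p ^ e = p\<^sup>2 * p ^ (e - 2)" using True by (metis le_add_diff_inverse power_add)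
    have "?B = (\<lambda>k. p * k) ` {k. k\<^sup>2 dvd p ^ (e - 2) * v}"
      using p0 by (auto simp: pe power_mult_distrib mult.assoc dvd_def)
    moreover have "inj_on (\<lambda>k. p * k) {k. k\<^sup>2 dvd p ^ (e - 2) * v}"
      using p0 by (auto simp: inj_on_def)
    ultimately have "(\<Sum>k\<in>?B. root_count m (?n div k\<^sup>2)) =
      (\<Sum>k | k\<^sup>2 dvd p ^ (e - 2) * v. root_count m (?n div (p * k)\<^sup>2))"
      by (simp add: sum.reindex)
    also have "\<dots> = ideal_count m (p ^ (e - 2) * v)"
      unfolding ideal_count_def using p0 by (intro sum.cong) (auto simp: pe power_mult_distrib mult.assoc)
    finally show ?thesis using True by simp
  next
    case False
    have "\<not> p\<^sup>2 dvd ?n"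
    proof
      assume "p\<^sup>2 dvd ?n"
      moreover have "coprime (p\<^sup>2) v" using p by (simp add: prime_imp_coprime)
      ultimately have "p\<^sup>2 dvd p ^ e" by (simp add: coprime_dvd_mult_left_iff)
      then show False using False p by (simp add: dvd_power_iff_le prime_ge_2_nat)
    qed
    then have B: "?B = {}" using dvd_trans[OF dvd_power_same] by blast
    show ?thesis unfolding B using False by simp
  qed
  finally show ?thesis .
qed

text \<open>
  The divisors of $p^{e+1} v$ are the divisors of $v$ and $p$ times the divisors of $p^e v$.
\<close>
lemma divisor_sum_prime_power_mult:
  assumes f: "\<And>x y. f (x * y) = f x * f y" and p: "prime p" "\<not> p dvd v" and v: "0 < v"
  shows "divisor_sum f (p ^ e * v) = (\<Sum>i\<le>e. f p ^ i) * divisor_sum f v"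
proof (induction e)
  case (Suc e)
  have p0: "0 < p" using p by (simp add: prime_gt_0_nat)
  let ?A = "{d. d dvd v}" and ?B = "(\<lambda>d. p * d) ` {d. d dvd p ^ e * v}"
  have "{d. d dvd p ^ Suc e * v} = ?A \<union> ?B"
  proof
    show "{d. d dvd p ^ Suc e * v} \<subseteq> ?A \<union> ?B"
    proof
      fix d assume d: "d \<in> {d. d dvd p ^ Suc e * v}"
      show "d \<in> ?A \<union> ?B"
      proof (cases "p dvd d")
        case True
        then show ?thesis using d p0 by (auto simp: mult.assoc elim!: dvdE)
      next
        case False
        then have "coprime p d" using p by (simp add: prime_imp_coprime)
        then have "coprime d (p ^ Suc e)" by (simp add: coprime_commute)
        then show ?thesis using d by (simp only: coprime_dvd_mult_right_iff mem_Collect_eq UnI1)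
      qed
    qed
  qed (use p0 in \<open>auto simp: mult.assoc\<close>)
  moreover have "?A \<inter> ?B = {}" using p(2) by (auto dest: dvd_mult_left)
  moreover have "finite ?A" "finite ?B" using v p0 by auto
  ultimately have "divisor_sum f (p ^ Suc e * v) = divisor_sum f v + (\<Sum>d\<in>?B. f d)"
    unfolding divisor_sum_def by (simp add: sum.union_disjoint)
  also have "(\<Sum>d\<in>?B. f d) = f p * divisor_sum f (p ^ e * v)"
    unfolding divisor_sum_def sum_distrib_left
    by (subst sum.reindex) (use p0 in \<open>auto simp: inj_on_def f\<close>)
  also have "divisor_sum f v + f p * divisor_sum f (p ^ e * v) =
    (1 + f p * (\<Sum>i\<le>e. f p ^ i)) * divisor_sum f v"
    unfolding Suc by (simp add: algebra_simps)
  also have "1 + f p * (\<Sum>i\<le>e. f p ^ i) = (\<Sum>i\<le>Suc e. f p ^ i)"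
    by (subst sum.atMost_Suc_shift) (simp add: sum_distrib_left)
  finally show ?case .
qed simp

text \<open>
  The discriminant $1 - 4m$ is negative and squarefree; the bound on $m$ leaves out $-3$, where there
  are six units.
\<close>
locale odd_discriminant =
  fixes m :: int
  assumes m_ge_2: "2 \<le> m" and squarefree_disc: "squarefree (1 - 4 * m)"
begin

definition N :: int where "N = 4 * m - 1"

definition disc_char :: "int \<Rightarrow> int" where "disc_char x = Jacobi x N"

lemma N_props: "7 \<le> N" "odd N" "0 < N" "N mod 4 = 3" "1 - 4 * m = - N"
  using m_ge_2 unfolding N_def by presburger+

lemma squarefree_N: "squarefree N"
proof -
  have "x\<^sup>2 dvd N \<longleftrightarrow> x\<^sup>2 dvd 1 - 4 * m" for x unfolding N_props(5) by simp
  then show ?thesis using squarefree_disc by (simp add: squarefree_def)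
qed

lemma disc_char_mult: "disc_char (x * y) = disc_char x * disc_char y"
  unfolding disc_char_def using N_props by (intro Jacobi_mult)

lemma disc_char_cong: "[x = y] (mod N) \<Longrightarrow> disc_char x = disc_char y"
  unfolding disc_char_def using N_props by (intro Jacobi_cong)

lemma disc_char_eq_0_iff: "disc_char x = 0 \<longleftrightarrow> \<not> coprime x N"
  unfolding disc_char_def using N_props by (intro Jacobi_eq_0_iff)

lemma disc_char_range: "disc_char x \<in> {-1, 0, 1}"
  unfolding disc_char_def using N_props by (intro Jacobi_range)

lemma disc_char_minus: "disc_char (- x) = - disc_char x"
proof -
  have "disc_char (-1) = -1"
    unfolding disc_char_def Jacobi_minus_1[OF N_props(3,2)] using N_props by (simp add: chi4_def)
  then show ?thesis using disc_char_mult[of "-1" x] by simp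
qed

lemma disc_char_1: "disc_char 1 = 1"
  using disc_char_mult[of 1 1] disc_char_eq_0_iff[of 1] by simp

text \<open>
  For odd $p$, completing the square shows that there is a root exactly if $1 - 4m$ is a square modulo
  $p$, and the reciprocity law rewrites the Legendre symbol as the value of the character. For $p = 2$
  the polynomial is constantly $m$ modulo $2$, and $m$ is even exactly if $N \equiv 7 \pmod 8$.
\<close>
lemma root_count_prime:
  assumes p: "prime p"
  shows "int (root_count m p) = 1 + disc_char p"
proof (cases "p = 2")
  case True
  have "\<not> 2 dvd 1 - 4 * m" by presburger
  moreover have "minpoly_at m t mod 2 = m mod 2" for t
  proof -
    have "minpoly_at m t = t * (t + 1) + m" by (simp add: minpoly_at_def power2_eq_square algebra_simps)
    moreover have "even (t * (t + 1))" by simp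
    ultimately show ?thesis by (simp add: mod_add_left_eq[of _ 2 m, symmetric] even_iff_mod_2_eq_zero)
  qed
  then have "2 dvd minpoly_at m t \<longleftrightarrow> even m" for t by (metis dvd_eq_mod_eq_0)
  ultimately have rc: "root_count m p = (if even m then 2 else 0)"
    using root_count_prime_root[OF p, of m 0] root_count_eq_0[of p m] True by simp
  have "disc_char 2 = chi8 N" unfolding disc_char_def using N_props by (intro Jacobi_2)
  moreover have "(N mod 8 = 1 \<or> N mod 8 = 7) \<longleftrightarrow> even m"
    unfolding N_def by presburger
  ultimately show ?thesis using rc True by (simp add: chi8_def)
next
  case False
  then have p2: "2 < p" using p prime_ge_2_nat[of p] by simp
  then have odd: "odd p" using p prime_odd_nat by blast
  have disc_char: "disc_char p = Legendre (1 - 4 * m) p"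
    unfolding disc_char_def N_props(5) using N_props p p2 by (intro Jacobi_eq_Legendre_discriminant)
  have cop4: "coprime (int p) 4"
  proof -
    have "coprime (int p) 2" using odd by (simp add: coprime_right_2_iff_odd)
    then have "coprime (int p) (2 * 2)" by (simp only: coprime_mult_right_iff)
    then show ?thesis by simp
  qed
  have root_iff: "int p dvd minpoly_at m t \<longleftrightarrow> int p dvd (2 * t + 1)\<^sup>2 - (1 - 4 * m)" for t
    unfolding minpoly_at_discriminant[symmetric] using cop4 by (simp add: coprime_dvd_mult_right_iff)
  show ?thesis
  proof (cases "QuadRes p (1 - 4 * m)")
    case True
    then obtain y where y: "int p dvd y\<^sup>2 - (1 - 4 * m)"
      by (auto simp: QuadRes_def cong_iff_dvd_diff)
    (* The square root is made odd so that it has the form 2 t + 1. *)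
    define z where "z = (if odd y then y else y + int p)"
    have "odd z" using odd by (simp add: z_def)
    then have z: "2 * ((z - 1) div 2) + 1 = z" by presburger
    have "[z = y] (mod int p)" by (simp add: z_def cong_iff_mod)
    then have "[z\<^sup>2 - (1 - 4 * m) = y\<^sup>2 - (1 - 4 * m)] (mod int p)"
      by (intro cong_diff cong_pow) auto
    then have "int p dvd z\<^sup>2 - (1 - 4 * m)" using y by (simp add: cong_dvd_iff)
    then have "int p dvd minpoly_at m ((z - 1) div 2)" unfolding root_iff z .
    from root_count_prime_root[OF p this] show ?thesis
      using True by (simp add: disc_char Legendre_def cong_0_iff)
  next
    case False
    then have "\<not> int p dvd 1 - 4 * m"
      unfolding QuadRes_def by (metis cong_0_iff cong_sym zero_power2)
    moreover have "root_count m p = 0"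
      using False by (intro root_count_eq_0) (auto simp: root_iff QuadRes_def cong_iff_dvd_diff)
    ultimately show ?thesis using False by (simp add: disc_char Legendre_def cong_0_iff)
  qed
qed

lemma root_count_prime_power:
  assumes p: "prime p" and e: "1 \<le> e"
  shows "int (root_count m (p ^ e)) = disc_char p ^ e + disc_char p ^ (e - 1)"
proof (cases "int p dvd 1 - 4 * m")
  case True
  then have "int p dvd N" unfolding N_props(5) by simp
  then have "disc_char p = 0" using p
    by (metis disc_char_eq_0_iff coprime_absorb_left not_prime_unit prime_nat_int_transfer)
  then show ?thesis
    using root_count_prime[OF p] root_count_ramified[OF p True squarefree_disc, of e] e
    by (cases "e = 1") (auto simp: power_0_left)
next
  case False
  have "root_count m (p ^ e) = root_count m p"
    using e by (induction e rule: dec_induct) (use root_count_prime_Suc[OF p False] in auto)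
  then have "int (root_count m (p ^ e)) = 1 + disc_char p" using root_count_prime[OF p] by simp
  moreover have "disc_char p \<noteq> 0"
  proof -
    have "\<not> int p dvd N" using False unfolding N_props(5) by simp
    then show ?thesis using p by (simp add: disc_char_eq_0_iff prime_imp_coprime)
  qed
  then have "disc_char p = 1 \<or> disc_char p = -1" using disc_char_range by auto
  then have "1 + disc_char p = disc_char p ^ e + disc_char p ^ (e - 1)"
    using e by (cases e) auto
  ultimately show ?thesis by simp
qed

text \<open>
  With $\chi(p) \in \{-1, 0, 1\}$ the local sums satisfy
  $\sum_{i \le e} \chi(p)^i - \sum_{i \le e-2} \chi(p)^i = \chi(p)^e + \chi(p)^{e-1}$, which is the number of
  roots modulo $p^e$. So both sides obey the same recursion when a prime power is split off.
\<close>
theorem ideal_count_eq_divisor_sum: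
  assumes "0 < n"
  shows "int (ideal_count m n) = divisor_sum (\<lambda>d. disc_char (int d)) n"
  using assms
proof (induction n rule: less_induct)
  case (less n)
  show ?case
  proof (cases "n = 1")
    case True
    then show ?thesis using disc_char_1 root_count_1 by (simp add: ideal_count_def divisor_sum_def)
  next
    case False
    then obtain p where p: "prime p" "p dvd n" using prime_factor_nat by blast
    obtain v where v: "n = p ^ multiplicity p n * v" "\<not> p dvd v"
      using multiplicity_decompose'[of n p] p less.prems not_prime_unit[of p] by (metis less_numeral_extra(3))
    have v0: "0 < v" using v less.prems by (cases v) auto
    have "multiplicity p n > 0" using p less.prems by (simp add: prime_multiplicity_gt_zero_iff)
    then have "1 < p ^ multiplicity p n" using p prime_gt_1_nat one_less_power by blast
    then have "v < n" using v0 by (subst v(1)) simp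
    then have IH: "int (ideal_count m v) = divisor_sum (\<lambda>d. disc_char (int d)) v"
      using less.IH v0 by blast
    have ds: "divisor_sum (\<lambda>d. disc_char (int d)) (p ^ e * v) =
        (\<Sum>i\<le>e. disc_char p ^ i) * divisor_sum (\<lambda>d. disc_char (int d)) v" for e
      by (rule divisor_sum_prime_power_mult) (use p v v0 disc_char_mult in auto)
    have "int (ideal_count m (p ^ e * v)) = divisor_sum (\<lambda>d. disc_char (int d)) (p ^ e * v)"
      for e
    proof (induction e rule: less_induct)
      case (less e)
      consider "e = 0" | "e = 1" | j where "e = j + 2" 
        by (metis One_nat_def Suc_1 add_2_eq_Suc' not0_implies_Suc)
      then show ?case
      proof cases
        case 3
        then have e1: "1 \<le> e" and je: "j < e" by simp_all
        have "int (ideal_count m (p ^ e * v)) = int (root_count m (p ^ e)) * int (ideal_count m v) +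
            int (ideal_count m (p ^ j * v))"
          using ideal_count_prime_power_mult[OF p(1) v(2) v0, of m e] 3 by simp
        also have "\<dots> = (disc_char p ^ e + disc_char p ^ (e - 1) + (\<Sum>i\<le>j. disc_char p ^ i)) * divisor_sum (\<lambda>d. disc_char (int d)) v"
          unfolding root_count_prime_power[OF p(1) e1] IH less[OF je] ds by (simp only: distrib_right)
        also have "disc_char p ^ e + disc_char p ^ (e - 1) + (\<Sum>i\<le>j. disc_char p ^ i) = (\<Sum>i\<le>e. disc_char p ^ i)"
          using 3 by simp
        finally show ?thesis by (simp add: ds)
      qed (use IH ideal_count_prime_power_mult[OF p(1) v(2) v0, of m 1] root_count_prime[OF p(1)] ds[of 1] in auto)
    qed
    then show ?thesis using v(1) by metis
  qed
qed

end

section \<open>Abel summation and the mean value of divisor sums\<close>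

definition bounded_block_sums :: "(nat \<Rightarrow> real) \<Rightarrow> real \<Rightarrow> bool" where
  "bounded_block_sums f B \<longleftrightarrow> (\<forall>u v. \<bar>\<Sum>i=u..<v. f i\<bar> \<le> B)"

text \<open>
  Summation by parts.
\<close>
lemma abel_summation_bound:
  fixes c :: "nat \<Rightarrow> real"
  assumes f: "bounded_block_sums f B"
    and dec: "\<And>i. u \<le> i \<Longrightarrow> c (Suc i) \<le> c i"
      and nn: "\<And>i. u \<le> i \<Longrightarrow> 0 \<le> c i"
  shows "\<bar>\<Sum>i=u..<v. f i * c i\<bar> \<le> B * c u"
proof (cases "u \<le> v")
  case False
  have "0 \<le> B" using f[unfolded bounded_block_sums_def, rule_format, of 0 0] by simp
  then show ?thesis using False nn[of u] by simp
next
  case True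
  define F where "F = (\<lambda>k. \<Sum>i=u..<k. f i)"
  have B: "\<bar>F k\<bar> \<le> B" for k using f by (auto simp: F_def bounded_block_sums_def)
  have "(\<Sum>i=u..<v. f i * c i) = F v * c v + (\<Sum>i=u..<v. F (Suc i) * (c i - c (Suc i)))"
    using True by (induction v rule: dec_induct) (auto simp: F_def algebra_simps)
  also have "\<bar>\<dots>\<bar> \<le> \<bar>F v * c v\<bar> + \<bar>\<Sum>i=u..<v. F (Suc i) * (c i - c (Suc i))\<bar>" by (rule abs_triangle_ineq)
  also have "\<dots> \<le> B * c v + (\<Sum>i=u..<v. B * (c i - c (Suc i)))"
  proof (rule add_mono)
    show "\<bar>F v * c v\<bar> \<le> B * c v"
      using B nn[OF True] by (simp add: abs_mult mult_right_mono)
    have "\<bar>\<Sum>i=u..<v. F (Suc i) * (c i - c (Suc i))\<bar> \<le> (\<Sum>i=u..<v. \<bar>F (Suc i) * (c i - c (Suc i))\<bar>)"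
      by (rule sum_abs)
    also have "\<dots> \<le> (\<Sum>i=u..<v. B * (c i - c (Suc i)))"
      using B dec by (intro sum_mono) (auto simp: abs_mult intro: mult_right_mono)
    finally show "\<bar>\<Sum>i=u..<v. F (Suc i) * (c i - c (Suc i))\<bar> \<le> (\<Sum>i=u..<v. B * (c i - c (Suc i)))" .
  qed
  also have "(\<Sum>i=u..<v. B * (c i - c (Suc i))) = B * (c u - c v)"
    using sum_Suc_diff'[OF True, of "\<lambda>i. - c i"] by (simp flip: sum_distrib_left)
  finally show ?thesis by (simp add: algebra_simps)
qed

lemma power_over_index_decreasing:
  fixes r :: real
  assumes "0 \<le> r" "r \<le> 1" "1 \<le> i"
  shows "r ^ Suc i / real (Suc i) \<le> r ^ i / real i"
  using assms by (intro frac_le) (auto simp: mult_left_le_one_le)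

text \<open>
  The bound does not depend on $r \in [0,1]$. It gives both the convergence of the series at $r = 1$ and
  the uniform convergence that is behind Abel's limit theorem.
\<close>
lemma power_block_sum_bound:
  fixes r :: real
  assumes f: "bounded_block_sums f B" and r: "0 \<le> r" "r \<le> 1" and u: "1 \<le> u"
  shows "\<bar>\<Sum>i=u..<v. f i / real i * r ^ i\<bar> \<le> B / real u"
proof -
  have B: "0 \<le> B" using f[unfolded bounded_block_sums_def, rule_format, of 0 0] by simp
  have "\<bar>\<Sum>i=u..<v. f i * (r ^ i / real i)\<bar> \<le> B * (r ^ u / real u)"
    using r u power_over_index_decreasing[OF r] by (intro abel_summation_bound[OF f]) auto
  also have "\<dots> \<le> B * (1 / real u)"
    using r B by (intro mult_left_mono divide_right_mono) (auto simp: power_le_one)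
  finally show ?thesis by simp
qed

lemma power_series_summable_and_tail:
  fixes r :: real
  assumes f: "bounded_block_sums f B" and r: "0 \<le> r" "r \<le> 1"
  shows "summable (\<lambda>i. f i / real i * r ^ i)"
    and "1 \<le> u \<Longrightarrow> \<bar>(\<Sum>i. f i / real i * r ^ i) - (\<Sum>i<u. f i / real i * r ^ i)\<bar> \<le> B / real u"
proof -
  let ?g = "\<lambda>i. f i / real i * r ^ i"
  have B: "0 \<le> B" using f[unfolded bounded_block_sums_def, rule_format, of 0 0] by simp
  show sm: "summable ?g"
  proof (rule summable_Cauchy[THEN iffD2], intro allI impI)
    fix e :: real assume e: "0 < e"
    obtain K where K: "B / e < real K" using reals_Archimedean2 by blast
    show "\<exists>M. \<forall>u\<ge>M. \<forall>v. norm (sum ?g {u..<v}) < e"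
    proof (intro exI allI impI)
      fix u v assume u: "Suc K \<le> u"
      have "\<bar>sum ?g {u..<v}\<bar> \<le> B / real u"
        using power_block_sum_bound[OF f r, of u v] u by simp
      also have "\<dots> < e"
      proof -
        have "B < e * real K" using K e by (simp add: field_simps)
        also have "\<dots> \<le> e * real u" using u e by simp
        finally show ?thesis using u by (simp add: field_simps)
      qed
      finally show "norm (sum ?g {u..<v}) < e" by simp
    qed
  qed
  show "\<bar>(\<Sum>i. ?g i) - (\<Sum>i<u. ?g i)\<bar> \<le> B / real u" if u: "1 \<le> u"
  proof (rule LIMSEQ_le_const2)
    show "(\<lambda>v. \<bar>(\<Sum>i<v. ?g i) - (\<Sum>i<u. ?g i)\<bar>) \<longlonglongrightarrow> \<bar>(\<Sum>i. ?g i) - (\<Sum>i<u. ?g i)\<bar>"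
      using summable_LIMSEQ[OF sm] by (intro tendsto_intros)
    have "\<bar>(\<Sum>i<v. ?g i) - (\<Sum>i<u. ?g i)\<bar> \<le> B / real u" if "u \<le> v" for v
    proof -
      have "(\<Sum>i<v. ?g i) - (\<Sum>i<u. ?g i) = (\<Sum>i=u..<v. ?g i)"
        using sum_diff_nat_ivl[of 0 u v ?g] that by (simp add: atLeast0LessThan)
      then show ?thesis using power_block_sum_bound[OF f r u] by simp
    qed
    then show "\<exists>N. \<forall>v\<ge>N. \<bar>(\<Sum>i<v. ?g i) - (\<Sum>i<u. ?g i)\<bar> \<le> B / real u" by blast
  qed
qed

text \<open>
  The tails are bounded by $B/u$ uniformly on $[0,1]$, so the sum of the series is continuous at $1$.
\<close>
lemma abel_limit:
  assumes f: "bounded_block_sums f B"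
  shows "((\<lambda>r. \<Sum>i. f i / real i * r ^ i) \<longlongrightarrow> (\<Sum>i. f i / real i)) (at_left (1 :: real))"
proof -
  have "continuous_on {0..1} (\<lambda>r :: real. \<Sum>i. f i / real i * r ^ i)"
  proof (rule uniform_limit_theorem)
    show "\<forall>\<^sub>F u in sequentially. continuous_on {0..1} (\<lambda>r. \<Sum>i<u. f i / real i * r ^ i)"
      by (intro always_eventually allI continuous_intros)
    show "uniform_limit {0..1} (\<lambda>u r :: real. \<Sum>i<u. f i / real i * r ^ i) (\<lambda>r. \<Sum>i. f i / real i * r ^ i) sequentially"
      unfolding uniform_limit_iff
    proof (intro allI impI)
      fix e :: real assume "0 < e"
      have "(\<lambda>u. B / real u) \<longlonglongrightarrow> 0" by real_asymp
      then have "\<forall>\<^sub>F u in sequentially. B / real u < e"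
        using \<open>0 < e\<close> order_tendstoD(2) by blast
      then show "\<forall>\<^sub>F u in sequentially. \<forall>r\<in>{0..1}. dist (\<Sum>i<u. f i / real i * r ^ i) (\<Sum>i. f i / real i * r ^ i) < e"
        using eventually_ge_at_top[of 1]
      proof eventually_elim
        case (elim u)
        show ?case
        proof
          fix r :: real assume "r \<in> {0..1}"
          then have "\<bar>(\<Sum>i. f i / real i * r ^ i) - (\<Sum>i<u. f i / real i * r ^ i)\<bar> \<le> B / real u"
            using power_series_summable_and_tail(2)[OF f] elim(2) by simp
          then show "dist (\<Sum>i<u. f i / real i * r ^ i) (\<Sum>i. f i / real i * r ^ i) < e"
            using elim(1) by (simp add: dist_real_def abs_minus_commute)
        qed
      qed
    qed
  qed simp
  then have "((\<lambda>r :: real. \<Sum>i. f i / real i * r ^ i) \<longlongrightarrow> (\<Sum>i. f i / real i * 1 ^ i)) (at 1 within {0..1})"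
    unfolding continuous_on_def by (rule bspec) simp
  moreover have "at 1 within {0..1} = at_left (1 :: real)"
    by (rule at_within_Icc_at_left) simp
  ultimately show ?thesis by simp
qed

lemma sum_divisor_sums:
  fixes f :: "nat \<Rightarrow> real"
  shows "(\<Sum>n=1..X. \<Sum>d | d dvd n. f d) = (\<Sum>d=1..X. f d * real (X div d))"
proof -
  have "(\<Sum>n=1..X. \<Sum>d | d dvd n. f d) = (\<Sum>n=1..X. \<Sum>d | d \<in> {1..X} \<and> d dvd n. f d)"
    by (intro sum.cong) (auto dest: dvd_imp_le intro: dvd_pos_nat simp: Suc_le_eq intro!: sum.cong)
  also have "\<dots> = (\<Sum>d=1..X. \<Sum>n | n \<in> {1..X} \<and> d dvd n. f d)"
    by (rule sum.swap_restrict) auto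
  also have "\<dots> = (\<Sum>d=1..X. f d * real (X div d))"
  proof (rule sum.cong)
    fix d assume d: "d \<in> {1..X}"
    have "{n. n \<in> {1..X} \<and> d dvd n} = (\<lambda>k. d * k) ` {1..X div d}"
    proof
      show "{n. n \<in> {1..X} \<and> d dvd n} \<subseteq> (\<lambda>k. d * k) ` {1..X div d}"
      proof
        fix n assume n: "n \<in> {n. n \<in> {1..X} \<and> d dvd n}"
        then obtain k where k: "n = d * k" by auto
        then have "1 \<le> k" "k \<le> X div d"
          using n d div_le_mono[of n X d] by (auto simp: Suc_le_eq)
        then show "n \<in> (\<lambda>k. d * k) ` {1..X div d}" using k by auto
      qed
      show "(\<lambda>k. d * k) ` {1..X div d} \<subseteq> {n. n \<in> {1..X} \<and> d dvd n}"
        using d by (auto simp: Suc_le_eq intro: order_trans[OF mult_le_mono2 times_div_less_eq_dividend])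
    qed
    moreover have "card ((\<lambda>k. d * k) ` {1..X div d}) = X div d"
      using d by (subst card_image) (auto simp: inj_on_def)
    ultimately show "(\<Sum>n | n \<in> {1..X} \<and> d dvd n. f d) = f d * real (X div d)" by simp
  qed simp
  finally show ?thesis .
qed

text \<open>
  Dirichlet's hyperbola argument in a crude form. The mean is $\frac1X \sum_d f(d) \lfloor X/d \rfloor$. For
  $d < K \approx \sqrt X$ removing the floor costs $O(K/X)$, and the terms with $d \ge K$ are small by
  summation by parts, because $\lfloor X/d \rfloor$ decreases in $d$.
\<close>
lemma mean_of_divisor_sums:
  fixes f :: "nat \<Rightarrow> real"
  assumes f: "bounded_block_sums f B"
  shows "(\<lambda>X. (\<Sum>n=1..X. \<Sum>d | d dvd n. f d) / real X) \<longlonglongrightarrow> (\<Sum>d. f d / real d)"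
proof -
  let ?L = "\<Sum>d. f d / real d" and ?S = "\<lambda>X. \<Sum>d=1..X. f d * real (X div d)"
  have B: "0 \<le> B" using f[unfolded bounded_block_sums_def, rule_format, of 0 0] by simp
  have fB: "\<bar>f d\<bar> \<le> B"
    for d using f[unfolded bounded_block_sums_def, rule_format, of d "Suc d"] by simp
  have div_bounds: "real (X div d) \<le> real X / real d" "real X / real d \<le> real (X div d) + 1"
    for X d
  proof -
    have "\<lfloor>real X / real d\<rfloor> = int (X div d)" by (rule floor_divide_of_nat_eq)
    then show "real (X div d) \<le> real X / real d" "real X / real d \<le> real (X div d) + 1"
      by linarith+
  qed
  have bd: "\<bar>?S X / real X - ?L\<bar> \<le> B * (sqrt X + 1) / real X + 2 * B / sqrt X"
    if X: "1 \<le> X" for X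
  proof -
    (* The cut at the square root balances the errors K / X and 1 / K. *)
    define K where "K = Suc (nat \<lfloor>sqrt X\<rfloor>)"
    have K: "sqrt X \<le> real K" "real K \<le> sqrt X + 1" "1 \<le> K" by (auto simp: K_def) linarith+
    have sX: "0 < sqrt X" using X by simp
    have "\<bar>?S X / real X - ?L\<bar> = \<bar>(?S X - (\<Sum>d=1..<K. f d * real (X div d))) / real X
      + ((\<Sum>d=1..<K. f d * real (X div d)) / real X - (\<Sum>d=1..<K. f d / real d))
      + ((\<Sum>d=1..<K. f d / real d) - ?L)\<bar>" by (simp add: diff_divide_distrib)
    also have "\<dots> \<le> B / sqrt X + B * (sqrt X + 1) / real X + B / sqrt X"
    proof (intro order_trans[OF abs_triangle_ineq] add_mono)
      have "?S X - (\<Sum>d=1..<K. f d * real (X div d)) = (\<Sum>d=K..<max K (Suc X). f d * real (X div d))"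
      proof -
        have "?S X = (\<Sum>d=1..<max K (Suc X). f d * real (X div d))"
          by (rule sum.mono_neutral_left) auto
        also have "\<dots> = (\<Sum>d=1..<K. f d * real (X div d)) + (\<Sum>d=K..<max K (Suc X). f d * real (X div d))"
          using K by (intro sum.atLeastLessThan_concat[symmetric]) auto
        finally show ?thesis by simp
      qed
      also have "\<bar>\<dots>\<bar> \<le> B * real (X div K)"
        using K by (intro abel_summation_bound[OF f]) (auto intro: div_le_mono2)
      also have "\<dots> \<le> B * (real X / real K)"
        using B by (intro mult_left_mono) (auto intro: div_bounds)
      also have "\<dots> \<le> B * (real X / sqrt X)"
        using B K sX by (intro mult_left_mono divide_left_mono mult_pos_pos) linarith+
      finally have "\<bar>?S X - (\<Sum>d=1..<K. f d * real (X div d))\<bar> \<le> B * (real X / sqrt X)" .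
      then show "\<bar>(?S X - (\<Sum>d=1..<K. f d * real (X div d))) / real X\<bar> \<le> B / sqrt X"
        using X by (simp add: field_simps abs_mult)
      have "(\<Sum>d=1..<K. f d * real (X div d)) / real X - (\<Sum>d=1..<K. f d / real d) =
        (\<Sum>d=1..<K. f d * (real (X div d) - real X / real d)) / real X"
        using X by (simp add: sum_subtractf right_diff_distrib sum_divide_distrib diff_divide_distrib)
      also have "\<bar>\<dots>\<bar> \<le> (\<Sum>d=1..<K. B) / real X"
      proof -
        have "\<bar>f d * (real (X div d) - real X / real d)\<bar> \<le> B * 1" for d
          unfolding abs_mult
        proof (intro mult_mono fB)
          show "\<bar>real (X div d) - real X / real d\<bar> \<le> 1"
            using div_bounds[of X d] by linarith
        qed (use B in auto)
        then have "\<bar>\<Sum>d=1..<K. f d * (real (X div d) - real X / real d)\<bar> \<le> (\<Sum>d=1..<K. B)"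
          by (intro order_trans[OF sum_abs] sum_mono) simp
        then show ?thesis using X by (simp add: divide_right_mono)
      qed
      also have "\<dots> \<le> B * (sqrt X + 1) / real X"
        using K B by (intro divide_right_mono) (auto simp: mult.commute[of _ B] intro!: mult_left_mono)
      finally show "\<bar>(\<Sum>d=1..<K. f d * real (X div d)) / real X - (\<Sum>d=1..<K. f d / real d)\<bar>
        \<le> B * (sqrt X + 1) / real X" .
      have "(\<Sum>d<K. f d / real d) = (\<Sum>d=1..<K. f d / real d)"
        by (rule sum.mono_neutral_right) auto
      then have "\<bar>?L - (\<Sum>d=1..<K. f d / real d)\<bar> \<le> B / real K"
        using power_series_summable_and_tail(2)[OF f, of 1 K] K by simp
      also have "\<dots> \<le> B / sqrt X"
        using B K sX by (intro divide_left_mono mult_pos_pos) linarith+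
      finally show "\<bar>(\<Sum>d=1..<K. f d / real d) - ?L\<bar> \<le> B / sqrt X"
        by (simp add: abs_minus_commute)
    qed
    finally show ?thesis by simp
  qed
  have "(\<lambda>X. ?S X / real X - ?L) \<longlonglongrightarrow> 0"
  proof (rule Lim_null_comparison)
    show "\<forall>\<^sub>F X in sequentially. norm (?S X / real X - ?L) \<le> B * (sqrt X + 1) / real X + 2 * B / sqrt X"
      using eventually_ge_at_top[of 1] by eventually_elim (use bd in simp)
    show "(\<lambda>X :: nat. B * (sqrt X + 1) / real X + 2 * B / sqrt X) \<longlonglongrightarrow> 0"
      by real_asymp
  qed
  then show ?thesis unfolding sum_divisor_sums by (simp add: LIM_zero_iff)
qed

section \<open>Sine series and Gauss sums\<close>

text \<open>
  Multiplication by a number prime to $P$ permutes the residues modulo $P$.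
\<close>
lemma sum_residues_mult:
  fixes g :: "int \<Rightarrow> 'a :: comm_monoid_add"
  assumes P: "0 < P" and c: "coprime c P" and per: "\<And>x. g (x mod P) = g x"
  shows "(\<Sum>x\<in>{0..<P}. g (c * x)) = (\<Sum>x\<in>{0..<P}. g x)"
proof -
  let ?h = "\<lambda>x. c * x mod P"
  have inj: "inj_on ?h {0..<P}"
  proof (rule inj_onI)
    fix x y assume xy: "x \<in> {0..<P}" "y \<in> {0..<P}" "?h x = ?h y"
    then have "[c * x = c * y] (mod P)" by (simp add: cong_iff_mod)
    then have "[x = y] (mod P)" using c by (simp add: cong_mult_lcancel)
    then show "x = y" using xy by (auto simp: cong_less_imp_eq_int)
  qed
  moreover have "?h ` {0..<P} \<subseteq> {0..<P}" using P by auto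
  ultimately have "?h ` {0..<P} = {0..<P}" by (intro endo_inj_surj) auto
  then have "(\<Sum>x\<in>{0..<P}. g x) = (\<Sum>x\<in>?h ` {0..<P}. g x)" by simp
  also have "\<dots> = (\<Sum>x\<in>{0..<P}. g (c * x))" by (simp only: sum.reindex[OF inj] o_def per)
  finally show ?thesis by simp
qed

lemma sum_residues_odd:
  fixes g :: "int \<Rightarrow> real"
  assumes "0 < P" "\<And>x. g (x mod P) = g x" "\<And>x. g (- x) = - g x"
  shows "(\<Sum>x\<in>{0..<P}. g x) = 0"
  using sum_residues_mult[of P "-1" g] assms by (simp add: sum_negf)

text \<open>
  An odd periodic function sums to zero over a period, so its partial sums are periodic and hence
  bounded.
\<close>
lemma periodic_odd_bounded_block_sums:
  fixes g :: "int \<Rightarrow> real"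
  assumes P: "0 < P" and per: "\<And>x. g (x mod P) = g x" and odd: "\<And>x. g (- x) = - g x"
  shows "\<exists>B. bounded_block_sums (\<lambda>n. g (int n)) B"
proof -
  define F where "F = (\<lambda>k. \<Sum>i<k. g (int i))"
  define Q where "Q = nat P"
  have Q: "int Q = P" "0 < Q" using P by (auto simp: Q_def)
  have perQ: "g (int (i + Q)) = g (int i)" for i
    using per[of "int i + P"] per[of "int i"] Q by simp
  have "(\<Sum>i<Q. g (int i)) = (\<Sum>x\<in>int ` {..<Q}. g x)" by (simp add: sum.reindex)
  also have "int ` {..<Q} = {0..<P}" using Q by (auto simp: image_int_atLeastLessThan lessThan_atLeast0)
  also have "(\<Sum>x\<in>{0..<P}. g x) = 0" by (rule sum_residues_odd[OF assms])
  finally have F0: "F Q = 0" by (simp add: F_def)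
  have "F (k + Q) = F k" for k
    by (induction k) (use F0 perQ in \<open>auto simp: F_def\<close>)
  then have "F (j + q * Q) = F j" for j q
  proof (induction q)
    case (Suc q)
    have "F (j + Suc q * Q) = F ((j + q * Q) + Q)" by (simp add: algebra_simps)
    then show ?case using Suc by simp
  qed simp
  from this[of "k mod Q" "k div Q" for k] have Fmod: "F k = F (k mod Q)" for k by simp
  define M where "M = (\<Sum>i<Q. \<bar>g (int i)\<bar>)"
  have FM: "\<bar>F k\<bar> \<le> M" for k
  proof -
    have "\<bar>F (k mod Q)\<bar> \<le> (\<Sum>i<k mod Q. \<bar>g (int i)\<bar>)"
      unfolding F_def by (rule sum_abs)
    also have "\<dots> \<le> M" unfolding M_def using Q(2) by (intro sum_mono2) (auto intro: less_trans)
    finally show ?thesis using Fmod[of k] by simp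
  qed
  have "bounded_block_sums (\<lambda>n. g (int n)) (2 * M)"
    unfolding bounded_block_sums_def
  proof (intro allI)
    fix u v
    show "\<bar>\<Sum>i=u..<v. g (int i)\<bar> \<le> 2 * M"
    proof (cases "u \<le> v")
      case True
      then have "(\<Sum>i=u..<v. g (int i)) = F v - F u"
        using sum_diff_nat_ivl[of 0 u v "\<lambda>i. g (int i)"] by (simp add: F_def atLeast0LessThan)
      then show ?thesis using FM[of u] FM[of v] by linarith
    next
      case False
      then show ?thesis using FM[of 0] by simp
    qed
  qed
  then show ?thesis by blast
qed

text \<open>
  The imaginary part of $-\log(1 - z) = \sum_n z^n/n$ at $z = r e^{i\theta}$.
\<close>
lemma sin_power_series_sums:
  fixes r \<theta> :: real
  assumes "0 \<le> r" "r < 1"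
  shows "(\<lambda>n. sin (real n * \<theta>) / real n * r ^ n) sums (- Im (Ln (1 - of_real r * cis \<theta>)))"
proof -
  let ?z = "- (of_real r * cis \<theta>)"
  have "cmod ?z < 1" using assms by (simp add: norm_mult)
  from sums_minus[OF sums_Im[OF Ln_series'[OF this]]]
  have "(\<lambda>n. Im ((of_real r * cis \<theta>) ^ n / of_nat n)) sums (- Im (Ln (1 - of_real r * cis \<theta>)))"
    by simp
  moreover have "Im ((of_real r * cis \<theta>) ^ n / of_nat n) = sin (real n * \<theta>) / real n * r ^ n" for n
  proof -
    have "(of_real r * cis \<theta>) ^ n = of_real (r ^ n) * cis (real n * \<theta>)"
      by (simp only: power_mult_distrib Complex.DeMoivre of_real_power)
    then show ?thesis by (simp add: mult.commute)
  qed
  ultimately show ?thesis by (simp only:)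
qed

text \<open>
  In polar form, $1 - e^{i\theta} = 2 \sin(\theta/2)\, e^{i(\theta - \pi)/2}$ and
  $\sin(\theta/2) > 0$.
\<close>
lemma Im_Ln_one_minus_cis:
  assumes "0 < \<theta>" "\<theta> < 2 * pi"
  shows "Im (Ln (1 - cis \<theta>)) = (\<theta> - pi) / 2"
proof -
  let ?a = "(\<theta> - pi) / 2"
  have eq: "1 - cis \<theta> = of_real (2 * sin (\<theta> / 2)) * cis ?a"
  proof -
    have "cos \<theta> = 1 - 2 * (sin (\<theta> / 2))\<^sup>2" "sin \<theta> = 2 * sin (\<theta> / 2) * cos (\<theta> / 2)"
      using cos_double_sin[of "\<theta> / 2"] sin_double[of "\<theta> / 2"] by simp_all
    moreover have "cos ?a = sin (\<theta> / 2)" "sin ?a = - cos (\<theta> / 2)"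
      by (simp_all add: diff_divide_distrib cos_diff sin_diff)
    ultimately show ?thesis by (simp only: complex_eq_iff) (simp add: power2_eq_square)
  qed
  have pos: "0 < sin (\<theta> / 2)" using assms by (intro sin_gt_zero) auto
  have "Arg (1 - cis \<theta>) = ?a"
  proof (rule Arg_unique)
    show "of_real (2 * sin (\<theta> / 2)) * exp (\<i> * of_real ?a) = 1 - cis \<theta>"
      by (simp only: eq cis_conv_exp[of ?a])
  qed (use assms pos in auto)
  moreover have "1 - cis \<theta> \<noteq> 0"
    unfolding eq using pos by simp
  ultimately show ?thesis by (simp add: Arg_eq_Im_Ln)
qed

text \<open>
  The sum of $\sum_n \sin(n\theta)/n$ for $0 < |\theta| < 2\pi$.
\<close>
definition sawtooth :: "real \<Rightarrow> real" where
  "sawtooth \<theta> = (if 0 < \<theta> then (pi - \<theta>) / 2 else (- pi - \<theta>) / 2)"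

lemma sin_power_series_limit:
  assumes "\<bar>\<theta>\<bar> < 2 * pi" "\<theta> \<noteq> 0"
  shows "((\<lambda>r. - Im (Ln (1 - of_real r * cis \<theta>))) \<longlongrightarrow> sawtooth \<theta>) (at_left 1)"
proof -
  have val: "- Im (Ln (1 - cis \<theta>)) = sawtooth \<theta>"
    and re: "1 - cis \<theta> \<notin> \<real>\<^sub>\<le>\<^sub>0"
  proof -
    have "cos \<theta> \<noteq> 1"
    proof
      assume "cos \<theta> = 1"
      then obtain k :: int where k: "\<theta> = of_int k * 2 * pi" using cos_one_2pi_int by blast
      then have "\<bar>real_of_int k\<bar> < 1" using assms(1) by (simp add: abs_mult)
      then have "k = 0" by linarith
      then show False using k assms(2) by simp
    qed
    then have "0 < 1 - cos \<theta>" using cos_le_one[of \<theta>] by linarith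
    then show re: "1 - cis \<theta> \<notin> \<real>\<^sub>\<le>\<^sub>0"
      by (auto simp: complex_nonpos_Reals_iff)
    show "- Im (Ln (1 - cis \<theta>)) = sawtooth \<theta>"
    proof (cases "0 < \<theta>")
      case True
      have "\<theta> < 2 * pi" using assms(1) by linarith
      from Im_Ln_one_minus_cis[OF True this] show ?thesis
        using True by (simp add: sawtooth_def diff_divide_distrib)
    next
      case False
      have "cnj (Ln (1 - cis (- \<theta>))) = Ln (cnj (1 - cis (- \<theta>)))"
        using \<open>0 < 1 - cos \<theta>\<close> by (intro cnj_Ln) (auto simp: complex_nonpos_Reals_iff)
      then have "Ln (1 - cis \<theta>) = cnj (Ln (1 - cis (- \<theta>)))" by (simp add: cis_cnj)
      moreover have "0 < - \<theta>" "- \<theta> < 2 * pi" using assms False by linarith+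
      then have "Im (Ln (1 - cis (- \<theta>))) = (- \<theta> - pi) / 2" by (rule Im_Ln_one_minus_cis)
      ultimately have "- Im (Ln (1 - cis \<theta>)) = (- \<theta> - pi) / 2" by simp
      then show ?thesis using False by (simp add: sawtooth_def diff_divide_distrib)
    qed
  qed
  have "((\<lambda>r. - Im (Ln (1 - of_real r * cis \<theta>))) \<longlongrightarrow> - Im (Ln (1 - of_real 1 * cis \<theta>))) (at_left 1)"
    using re by (intro tendsto_intros) auto
  then show ?thesis using val by simp
qed

text \<open>
  If every residue were a square, squaring would be a surjective and hence injective map of the
  residues modulo $p$, but $1$ and $-1$ have the same square.
\<close>
lemma exists_nonresidue:
  fixes p :: nat
  assumes "prime p" "2 < p"
  obtains a where "Legendre a p = -1"
proof (rule ccontr)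
  assume "\<not> thesis"
  with that have no: "Legendre a p \<noteq> -1" for a by blast
  let ?h = "\<lambda>y. y\<^sup>2 mod int p"
  have "{0..<int p} \<subseteq> ?h ` {0..<int p}"
  proof
    fix a assume a: "a \<in> {0..<int p}"
    have "\<exists>y. [y\<^sup>2 = a] (mod int p)"
    proof (cases "[a = 0] (mod int p)")
      case True
      then have "[0\<^sup>2 = a] (mod int p)" by (simp add: cong_sym)
      then show ?thesis by blast
    next
      case False
      then show ?thesis using no[of a] by (auto simp: Legendre_def QuadRes_def split: if_splits)
    qed
    then obtain y where "[y\<^sup>2 = a] (mod int p)" by blast
    then have "?h (y mod int p) = a" using a by (simp add: cong_iff_mod power_mod)
    moreover have "y mod int p \<in> {0..<int p}" using assms by simp
    ultimately show "a \<in> ?h ` {0..<int p}" by (metis imageI)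
  qed
  then have inj: "inj_on ?h {0..<int p}" by (intro finite_surj_inj) simp_all
  (* The residue p - 1 represents -1, and it differs from 1 as p > 2. *)
  have "?h 1 = ?h (int p - 1)"
  proof -
    have "(int p - 1)\<^sup>2 = 1 + int p * (int p - 2)" by (simp add: power2_eq_square algebra_simps)
    then show ?thesis by simp
  qed
  then have "1 = int p - 1" by (rule inj_onD[OF inj]) (use assms in simp_all)
  then show False using assms by simp
qed

lemma Jacobi_mult_bottom:
  assumes "a \<noteq> 0" "b \<noteq> 0"
  shows "Jacobi x (a * b) = Jacobi x a * Jacobi x b"
  using assms by (simp add: Jacobi_def prime_factorization_mult)

lemma Jacobi_prime: "prime p \<Longrightarrow> Jacobi x p = Legendre x p"
  by (simp add: Jacobi_def prime_factorization_prime)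

context odd_discriminant
begin

lemma disc_char_mod: "disc_char (x mod N) = disc_char x"
  by (rule disc_char_cong) simp

definition additive_char :: "int \<Rightarrow> complex" where
  "additive_char k = cis (2 * pi * of_int k / of_int N)"

lemma additive_char_add: "additive_char (j + k) = additive_char j * additive_char k"
  by (simp add: additive_char_def cis_mult add_divide_distrib distrib_left)

lemma additive_char_multiple: "additive_char (N * k) = 1"
proof -
  have "2 * pi * of_int (N * k) / of_int N = 2 * pi * of_int k" using N_props by simp
  then show ?thesis unfolding additive_char_def by (simp add: cis_multiple_2pi)
qed

lemma additive_char_cong:
  assumes "[j = k] (mod N)" shows "additive_char j = additive_char k"
proof -
  obtain l where "j = k + N * l" using assms by (metis cong_iff_lin cong_sym)
  then show ?thesis by (simp add: additive_char_add additive_char_multiple)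
qed

definition gauss_sum :: "int \<Rightarrow> complex" where
  "gauss_sum n = (\<Sum>x\<in>{0..<N}. of_int (disc_char x) * additive_char (n * x))"

lemma gauss_sum_cong: "[j = k] (mod N) \<Longrightarrow> gauss_sum j = gauss_sum k"
  unfolding gauss_sum_def by (intro sum.cong refl arg_cong2[where f = times] additive_char_cong cong_mult) auto

text \<open>
  Substitute $cx$ for $x$.
\<close>
lemma gauss_sum_scale:
  assumes "coprime c N"
  shows "gauss_sum n = of_int (disc_char c) * gauss_sum (c * n)"
proof -
  have "gauss_sum n = (\<Sum>x\<in>{0..<N}. of_int (disc_char (c * x)) * additive_char (n * (c * x)))"
    unfolding gauss_sum_def
  proof (rule sum_residues_mult[symmetric])
    show "of_int (disc_char (x mod N)) * additive_char (n * (x mod N)) = of_int (disc_char x) * additive_char (n * x)" for x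
      using additive_char_cong[of "n * (x mod N)" "n * x"] by (simp add: disc_char_mod cong_iff_mod mod_mult_right_eq)
  qed (use assms N_props in auto)
  also have "\<dots> = of_int (disc_char c) * gauss_sum (c * n)"
    unfolding gauss_sum_def sum_distrib_left by (intro sum.cong) (auto simp: disc_char_mult ac_simps)
  finally show ?thesis .
qed

text \<open>
  The character is primitive: if the prime $p$ divides $n$ and $N$, choose $c \equiv 1 \pmod{N/p}$ that is
  a nonresidue modulo $p$. Then $\chi(c) = -1$ and $cn \equiv n \pmod N$, and the substitution
  $x \mapsto cx$ gives $G(n) = -G(n)$. Squarefreeness of $N$ is what allows the choice of $c$.
\<close>
lemma gauss_sum_not_coprime:
  assumes "\<not> coprime n N"
  shows "gauss_sum n = 0"
proof -
  have "gcd n N \<noteq> 0" "\<not> is_unit (gcd n N)"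
    using assms N_props by (auto simp: coprime_iff_gcd_eq_1)
  then obtain q where q: "prime q" "q dvd n" "q dvd N"
    using prime_divisor_exists[of "gcd n N"] by auto
  then obtain p where p: "q = int p" "prime p" "2 < p"
    using prime_factor_odd[OF N_props(3,2), of q] N_props by (auto simp: in_prime_factors_iff)
  obtain M where M: "N = int p * M" using q p by auto
  then have M0: "0 < M" using N_props p by (simp add: zero_less_mult_iff)
  have oddM: "odd M" using M N_props by simp
  have cop: "coprime (int p) M"
  proof (rule ccontr)
    assume "\<not> coprime (int p) M"
    then have "int p dvd M" using q p by (metis prime_imp_coprime)
    then have "(int p)\<^sup>2 dvd N" unfolding M power2_eq_square by (rule mult_dvd_mono[OF dvd_refl])
    then have "is_unit (int p)" using squarefree_N unfolding squarefree_def by blast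
    then show False using q p not_prime_unit by blast
  qed
  obtain a where a: "Legendre a p = -1" using exists_nonresidue p by blast
  obtain c where c: "[c = a] (mod int p)" "[c = 1] (mod M)"
    using binary_chinese_remainder_int[OF cop] by blast
  have "Jacobi c M = 1"
  proof -
    have "Jacobi c M = Jacobi 1 M" using Jacobi_cong[OF M0 oddM c(2)] .
    also have "\<dots> = 1"
      using Jacobi_mult[OF M0 oddM, of 1 1] Jacobi_eq_0_iff[OF M0 oddM, of 1] by simp
    finally show ?thesis .
  qed
  then have cc: "disc_char c = -1"
    using Legendre_cong[OF c(1)] a M M0 p q by (simp add: disc_char_def Jacobi_mult_bottom Jacobi_prime)
  then have "coprime c N" using disc_char_eq_0_iff[of c] by simp
  then have "gauss_sum n = - gauss_sum (c * n)" using gauss_sum_scale[of c n] cc by simp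
  moreover have "N dvd c * n - n"
  proof -
    have "M dvd c - 1" using c(2) by (simp add: cong_iff_dvd_diff)
    then have "int p * M dvd n * (c - 1)" using q p by (intro mult_dvd_mono) auto
    then show ?thesis by (simp add: M algebra_simps)
  qed
  then have "gauss_sum (c * n) = gauss_sum n" by (intro gauss_sum_cong) (simp add: cong_iff_dvd_diff)
  ultimately show ?thesis by simp
qed

lemma gauss_sum_eq: "gauss_sum n = of_int (disc_char n) * gauss_sum 1"
proof (cases "coprime n N")
  case True
  have "disc_char n * disc_char n = 1" using disc_char_eq_0_iff[of n] disc_char_range[of n] True by auto
  then have sq: "of_int (disc_char n) * of_int (disc_char n) = (1 :: complex)"
    by (metis of_int_1 of_int_mult)
  have "of_int (disc_char n) * gauss_sum 1 = of_int (disc_char n) * of_int (disc_char n) * gauss_sum n"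
    using gauss_sum_scale[OF True, of 1] by simp
  then show ?thesis using sq by simp
next
  case False
  then show ?thesis using gauss_sum_not_coprime disc_char_eq_0_iff[of n] by simp
qed

lemma sum_additive_char: "(\<Sum>n\<in>{0..<N}. additive_char (n * k)) = (if N dvd k then of_int N else 0)"
proof (cases "N dvd k")
  case True
  then obtain j where "k = N * j" by auto
  then have "additive_char (n * k) = 1"
    for n using additive_char_multiple[of "n * j"] by (simp add: ac_simps)
  then show ?thesis using True N_props by simp
next
  case False
  have e0: "additive_char 0 = 1" by (simp add: additive_char_def)
  have ne: "additive_char k \<noteq> 1"
  proof
    assume "additive_char k = 1"
    then have "cos (2 * pi * of_int k / of_int N) = 1"
      by (metis additive_char_def cis.simps(1) one_complex.simps(1))
    then obtain j :: int where "2 * pi * of_int k / of_int N = of_int j * 2 * pi"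
      using cos_one_2pi_int by blast
    then have "real_of_int k = real_of_int (j * N)" using N_props by (simp add: field_simps)
    then have "k = j * N" by (simp only: of_int_eq_iff)
    then show False using False by simp
  qed
  (* Shifting n by 1 multiplies the sum by a root of unity other than 1 but does not change it. *)
  have "(\<Sum>n\<in>{0..<N}. additive_char ((n + 1) * k)) = (\<Sum>n\<in>{0..<N}. additive_char (n * k))"
  proof -
    have "(\<Sum>n\<in>{0..<N}. additive_char ((n + 1) * k)) = (\<Sum>n\<in>{1..<N + 1}. additive_char (n * k))"
      by (rule sum.reindex_bij_witness[of _ "\<lambda>n. n - 1" "\<lambda>n. n + 1"]) auto
    also have "{1..<N + 1} = insert N {1..<N}" using N_props by auto
    also have "(\<Sum>n\<in>insert N {1..<N}. additive_char (n * k)) = additive_char (0 * k) + (\<Sum>n\<in>{1..<N}. additive_char (n * k))"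
      using additive_char_multiple[of k] e0 by simp
    also have "\<dots> = (\<Sum>n\<in>insert 0 {1..<N}. additive_char (n * k))" by simp
    also have "insert 0 {1..<N} = {0..<N}" using N_props by auto
    finally show ?thesis .
  qed
  moreover have "(\<Sum>n\<in>{0..<N}. additive_char ((n + 1) * k)) = additive_char k * (\<Sum>n\<in>{0..<N}. additive_char (n * k))"
    unfolding sum_distrib_left by (intro sum.cong) (auto simp: distrib_right additive_char_add)
  ultimately have "(additive_char k - 1) * (\<Sum>n\<in>{0..<N}. additive_char (n * k)) = 0"
    by (simp add: algebra_simps)
  then show ?thesis using ne False by simp
qed

text \<open>
  Parseval's identity: $\sum_n |G(n)|^2$ over the residues modulo $N$ equals
  $N \sum_x \chi(x)^2$ by orthogonality and $|G(1)|^2 \sum_n \chi(n)^2$ because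
  $G(n) = \chi(n)\, G(1)$.
\<close>
lemma norm_gauss_sum: "(cmod (gauss_sum 1))\<^sup>2 = of_int N"
proof -
  define \<phi> where "\<phi> = (\<Sum>x\<in>{0..<N}. (of_int (disc_char x) :: complex)\<^sup>2)"
  have cnj_additive_char: "cnj (additive_char k) = additive_char (- k)"
    for k by (simp add: additive_char_def cis_cnj)
  let ?S = "\<Sum>n\<in>{0..<N}. gauss_sum n * cnj (gauss_sum n)"
  have "?S = (\<Sum>n\<in>{0..<N}. (of_int (disc_char n))\<^sup>2 * (gauss_sum 1 * cnj (gauss_sum 1)))"
  proof (rule sum.cong)
    fix n
    have "gauss_sum n * cnj (gauss_sum n) =
        (of_int (disc_char n) * gauss_sum 1) * cnj (of_int (disc_char n) * gauss_sum 1)"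
      by (simp only: gauss_sum_eq[of n])
    then show "gauss_sum n * cnj (gauss_sum n) = (of_int (disc_char n))\<^sup>2 * (gauss_sum 1 * cnj (gauss_sum 1))"
      by (simp add: power2_eq_square)
  qed simp
  also have "\<dots> = \<phi> * (gauss_sum 1 * cnj (gauss_sum 1))"
    by (simp add: \<phi>_def sum_distrib_right)
  finally have S1: "?S = \<phi> * (gauss_sum 1 * cnj (gauss_sum 1))" .
  have "?S = (\<Sum>n\<in>{0..<N}. \<Sum>x\<in>{0..<N}. \<Sum>y\<in>{0..<N}. of_int (disc_char x * disc_char y) * additive_char (n * (x - y)))"
  proof (rule sum.cong)
    fix n
    have "cnj (gauss_sum n) = (\<Sum>y\<in>{0..<N}. of_int (disc_char y) * additive_char (- (n * y)))"
      by (simp add: gauss_sum_def cnj_sum cnj_additive_char)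
    moreover have "additive_char (n * x) * additive_char (- (n * y)) = additive_char (n * (x - y))"
      for x y
      by (simp add: right_diff_distrib flip: additive_char_add)
    ultimately show "gauss_sum n * cnj (gauss_sum n) =
        (\<Sum>x\<in>{0..<N}. \<Sum>y\<in>{0..<N}. of_int (disc_char x * disc_char y) * additive_char (n * (x - y)))"
      by (simp add: gauss_sum_def[of n] sum_product mult.assoc mult.left_commute[of "additive_char _"])
  qed simp
  also have "\<dots> = (\<Sum>x\<in>{0..<N}. \<Sum>n\<in>{0..<N}. \<Sum>y\<in>{0..<N}. of_int (disc_char x * disc_char y) * additive_char (n * (x - y)))"
    by (rule sum.swap)
  also have "\<dots> = (\<Sum>x\<in>{0..<N}. \<Sum>y\<in>{0..<N}. \<Sum>n\<in>{0..<N}. of_int (disc_char x * disc_char y) * additive_char (n * (x - y)))"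
    by (rule sum.cong[OF refl], rule sum.swap)
  also have "\<dots> = (\<Sum>x\<in>{0..<N}. \<Sum>y\<in>{0..<N}. if x = y then of_int (disc_char x * disc_char y) * of_int N else 0)"
  proof (intro sum.cong refl)
    fix x y assume xy: "x \<in> {0..<N}" "y \<in> {0..<N}"
    then have "N dvd x - y \<longleftrightarrow> x = y"
      unfolding mod_eq_dvd_iff[symmetric] by simp
    then show "(\<Sum>n\<in>{0..<N}. of_int (disc_char x * disc_char y) * additive_char (n * (x - y))) =
        (if x = y then of_int (disc_char x * disc_char y) * of_int N else 0)"
      unfolding sum_distrib_left[symmetric] sum_additive_char by simp
  qed
  also have "\<dots> = (\<Sum>x\<in>{0..<N}. of_int (disc_char x * disc_char x) * of_int N)"
    by (intro sum.cong) (auto simp: sum.delta)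
  also have "\<dots> = \<phi> * of_int N" by (simp add: \<phi>_def sum_distrib_right power2_eq_square)
  finally have S2: "?S = \<phi> * of_int N" .
  have "\<phi> = of_real (\<Sum>x\<in>{0..<N}. (of_int (disc_char x))\<^sup>2)" by (simp add: \<phi>_def)
  moreover have "0 < (\<Sum>x\<in>{0..<N}. (real_of_int (disc_char x))\<^sup>2)"
    by (rule sum_pos2[of _ 1]) (use disc_char_1 N_props in auto)
  ultimately have "\<phi> \<noteq> 0" by (metis less_irrefl of_real_eq_0_iff)
  then have "gauss_sum 1 * cnj (gauss_sum 1) = of_int N" using S1 S2 by simp
  then have "of_real ((cmod (gauss_sum 1))\<^sup>2) = complex_of_real (of_int N)"
    by (simp only: complex_norm_square of_real_of_int_eq)
  then show ?thesis by (simp only: of_real_eq_iff)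
qed

definition \<tau> :: real where "\<tau> = Im (gauss_sum 1)"

lemma sum_disc_char_sin: "(\<Sum>x\<in>{0..<N}. of_int (disc_char x) * sin (2 * pi * of_int (n * x) / of_int N)) = of_int (disc_char n) * \<tau>"
proof -
  have "Im (gauss_sum n) = of_int (disc_char n) * \<tau>" unfolding gauss_sum_eq[of n] \<tau>_def by simp
  then show ?thesis by (simp add: gauss_sum_def Im_sum additive_char_def)
qed

text \<open>
  The character is odd, so the real part of the Gauss sum vanishes.
\<close>
lemma \<tau>_squared: "\<tau>\<^sup>2 = of_int N"
proof -
  have "Re (gauss_sum 1) = (\<Sum>x\<in>{0..<N}. of_int (disc_char x) * Re (additive_char x))"
    by (simp add: gauss_sum_def Re_sum)
  also have "\<dots> = 0"
  proof (rule sum_residues_odd)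
    show "of_int (disc_char (x mod N)) * Re (additive_char (x mod N)) = of_int (disc_char x) * Re (additive_char x)" for x
      using additive_char_cong[of "x mod N" x] by (simp add: disc_char_mod)
    show "of_int (disc_char (- x)) * Re (additive_char (- x)) = - (of_int (disc_char x) * Re (additive_char x))" for x
      by (simp add: disc_char_minus additive_char_def)
  qed (use N_props in simp)
  finally show ?thesis using norm_gauss_sum by (simp add: \<tau>_def cmod_power2)
qed

end

section \<open>The character sum up to a sixth of the conductor\<close>

lemma sin_cos_add_multiple_2pi:
  fixes a :: real
  shows "cos (a + real k * (2 * pi)) = cos a"
    and "cos (a + of_int l * (2 * pi)) = cos a"
    and "sin (a + of_int l * (2 * pi)) = sin a"
  using cos.plus_of_nat[of a k] cos.plus_of_int[of a l] sin.plus_of_int[of a l] by simp_all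

text \<open>
  The weights are chosen so that for $n$ prime to $6$ only the first one counts and for $6 \mid n$ all of
  them add up to $0$.
\<close>
lemma one_minus_cos_pi_third:
  "1 - cos (real n * pi / 3) =
    1 / 2 + (if 2 dvd n then 1 else 0) + (if 3 dvd n then 3 / 2 else 0) - (if 6 dvd n then 3 else (0 :: real))"
proof -
  define j where "j = n mod 6"
  have n: "n = j + 6 * (n div 6)" by (simp add: j_def)
  have "real n * pi / 3 = real j * pi / 3 + real (n div 6) * (2 * pi)"
    by (subst n) (simp add: field_simps)
  then have c: "cos (real n * pi / 3) = cos (real j * pi / 3)"
    by (simp only: sin_cos_add_multiple_2pi)
  have d: "2 dvd n \<longleftrightarrow> 2 dvd j" "3 dvd n \<longleftrightarrow> 3 dvd j" "6 dvd n \<longleftrightarrow> 6 dvd j"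
    unfolding j_def by (simp_all add: dvd_mod_iff)
  have c3: "cos (pi / 3) = 1 / 2" by (rule cos_60)
  have c2: "cos (2 * pi / 3) = - 1 / 2" by (rule cos_120)
  have c4: "cos (4 * pi / 3) = - 1 / 2"
  proof -
    have "4 * pi / 3 = pi / 3 + pi" by simp
    then show ?thesis using c3 by (simp only: cos_periodic_pi)
  qed
  have c5: "cos (5 * pi / 3) = 1 / 2"
  proof -
    have "5 * pi / 3 = 2 * pi - pi / 3" by simp
    then show ?thesis using c3 by (simp only: cos_2pi_minus)
  qed
  have "j < 6" by (simp add: j_def)
  then consider "j = 0" | "j = 1" | "j = 2" | "j = 3" | "j = 4" | "j = 5" by linarith
  then show ?thesis unfolding c d by cases (use c2 c3 c4 c5 in simp_all)
qed

context odd_discriminant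
begin

definition L_value :: real where
  "L_value = (\<Sum>n. of_int (disc_char (int n)) / real n)"

lemma disc_char_bounded_block_sums: "\<exists>B. bounded_block_sums (\<lambda>n. of_int (disc_char (int n))) B"
  by (rule periodic_odd_bounded_block_sums[where P = N])
    (use N_props in \<open>simp_all add: disc_char_mod disc_char_minus\<close>)

lemma L_series_sums: "(\<lambda>n. of_int (disc_char (int n)) / real n) sums L_value"
proof -
  obtain B where "bounded_block_sums (\<lambda>n. of_int (disc_char (int n))) B"
    using disc_char_bounded_block_sums by blast
  from power_series_summable_and_tail(1)[OF this, of 1] show ?thesis
    unfolding L_value_def by (simp add: summable_sums)
qed

text \<open>
  The term at the multiple $kn$ is $\chi(kn)/(kn) = \frac{\chi(k)}{k} \cdot \frac{\chi(n)}{n}$.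
\<close>
lemma L_series_multiples_sums:
  assumes "0 < k"
  shows "(\<lambda>n. if k dvd n then of_int (disc_char (int n)) / real n else 0) sums (of_int (disc_char (int k)) / real k * L_value)"
proof -
  let ?f = "\<lambda>n. if k dvd n then of_int (disc_char (int n)) / real n else 0"
  have "(\<lambda>n. of_int (disc_char (int k)) / real k * (of_int (disc_char (int n)) / real n)) sums (of_int (disc_char (int k)) / real k * L_value)"
    by (rule sums_mult[OF L_series_sums])
  also have "(\<lambda>n. of_int (disc_char (int k)) / real k * (of_int (disc_char (int n)) / real n)) = (\<lambda>n. ?f (k * n))"
    by (simp add: disc_char_mult)
  finally show ?thesis
    using assms by (subst (asm) sums_mono_reindex) (auto simp: strict_mono_def elim!: dvdE)
qed

text \<open>
  By one_minus_cos_pi_third the series is $\frac12 (1 + \chi(2) + \chi(3) - \chi(2)\chi(3))\,L$. For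
  $\chi(2), \chi(3) \in \{-1, 1\}$ the bracket is $2$ if either of them is $1$, and $-2$ otherwise.
\<close>
lemma weighted_L_series:
  assumes "\<not> 3 dvd N"
  shows "\<bar>\<Sum>n. of_int (disc_char (int n)) * (1 - cos (real n * pi / 3)) / real n\<bar> = \<bar>L_value\<bar>"
proof -
  let ?c = "\<lambda>k. real_of_int (disc_char k)"
  let ?g = "\<lambda>k n. if k dvd n then ?c (int n) / real n else 0"
  have s: "(\<lambda>n. 1 / 2 * (?c (int n) / real n) + ?g 2 n + 3 / 2 * ?g 3 n - 3 * ?g 6 n) sums
      (1 / 2 * L_value + ?c 2 / 2 * L_value + 3 / 2 * (?c 3 / 3 * L_value) - 3 * (?c 6 / 6 * L_value))"
    using L_series_multiples_sums[of 2] L_series_multiples_sums[of 3] L_series_multiples_sums[of 6]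
    by (intro sums_add sums_diff sums_mult L_series_sums) simp_all
  have eq: "(\<lambda>n. 1 / 2 * (?c (int n) / real n) + ?g 2 n + 3 / 2 * ?g 3 n - 3 * ?g 6 n) =
      (\<lambda>n. ?c (int n) * (1 - cos (real n * pi / 3)) / real n)"
  proof
    fix n
    have split: "1 / 2 * q + (if P2 then q else 0) + 3 / 2 * (if P3 then q else 0) - 3 * (if P6 then q else 0) =
        q * (1 / 2 + (if P2 then 1 else 0) + (if P3 then 3 / 2 else 0) - (if P6 then 3 else 0))"
      for q :: real and P2 P3 P6
      by (cases P2; cases P3; cases P6) (simp_all add: algebra_simps)
    have "?c (int n) * (1 - cos (real n * pi / 3)) / real n = ?c (int n) / real n * (1 - cos (real n * pi / 3))"
      by simp
    then show "1 / 2 * (?c (int n) / real n) + ?g 2 n + 3 / 2 * ?g 3 n - 3 * ?g 6 n =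
        ?c (int n) * (1 - cos (real n * pi / 3)) / real n"
      by (simp only: split one_minus_cos_pi_third)
  qed
  have "(\<Sum>n. ?c (int n) * (1 - cos (real n * pi / 3)) / real n) =
      L_value * ((1 + ?c 2 + ?c 3 - ?c 6) / 2)"
    using sums_unique[OF s[unfolded eq]] by (simp add: field_simps)
  moreover have one: "\<bar>(1 + ?c 2 + ?c 3 - ?c 6) / 2\<bar> = 1"
  proof -
    have c6: "disc_char 6 = disc_char 2 * disc_char 3" using disc_char_mult[of 2 3] by simp
    have "coprime 2 N" using N_props by (simp add: coprime_left_2_iff_odd)
    then have c2: "disc_char 2 = 1 \<or> disc_char 2 = -1"
      using disc_char_range[of 2] disc_char_eq_0_iff[of 2] by auto
    have "coprime 3 N" using assms by (simp add: prime_imp_coprime)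
    then have c3: "disc_char 3 = 1 \<or> disc_char 3 = -1"
      using disc_char_range[of 3] disc_char_eq_0_iff[of 3] by auto
    show ?thesis unfolding c6 using c2 c3 by auto
  qed
  ultimately show ?thesis by (simp only: abs_mult one mult_1_right)
qed

definition half_system :: "int set" where "half_system = {1..(N - 1) div 2}"

lemma sum_half_system:
  fixes k :: "int \<Rightarrow> real"
  assumes "k 0 = 0" "\<And>x. k (N - x) = k x"
  shows "(\<Sum>x\<in>{0..<N}. k x) = 2 * (\<Sum>x\<in>half_system. k x)"
proof -
  define h where "h = (N - 1) div 2"
  have Nh: "N = 2 * h + 1" "0 < h" using N_props unfolding h_def by presburger+
  have "{0..<N} = insert 0 ({1..h} \<union> {h + 1..2 * h})" using Nh by auto
  then have "(\<Sum>x\<in>{0..<N}. k x) = k 0 + ((\<Sum>x\<in>{1..h}. k x) + (\<Sum>x\<in>{h + 1..2 * h}. k x))"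
    by (simp add: sum.union_disjoint)
  also have "(\<Sum>x\<in>{h + 1..2 * h}. k x) = (\<Sum>x\<in>{1..h}. k x)"
    by (rule sum.reindex_bij_witness[of _ "\<lambda>x. N - x" "\<lambda>x. N - x"]) (auto simp: Nh assms(2)[unfolded Nh])
  finally show ?thesis using assms(1) by (simp add: half_system_def h_def)
qed

lemma disc_char_0: "disc_char 0 = 0"
  using N_props by (simp add: disc_char_eq_0_iff)

definition angle :: "int \<Rightarrow> real" where "angle x = 2 * pi * of_int x / of_int N"

lemma tau_disc_char_half: "of_int (disc_char n) * \<tau> = 2 * (\<Sum>x\<in>half_system. of_int (disc_char x) * sin (of_int n * angle x))"
proof -
  have "of_int (disc_char n) * \<tau> = (\<Sum>x\<in>{0..<N}. of_int (disc_char x) * sin (of_int n * angle x))"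
    unfolding sum_disc_char_sin[symmetric] by (intro sum.cong) (auto simp: angle_def ac_simps)
  also have "\<dots> = 2 * (\<Sum>x\<in>half_system. of_int (disc_char x) * sin (of_int n * angle x))"
  proof (rule sum_half_system)
    fix x
    have "disc_char (N - x) = - disc_char x"
      using disc_char_cong[of "N - x" "- x"] by (simp add: disc_char_minus cong_iff_dvd_diff)
    moreover have "of_int n * angle (N - x) = - (of_int n * angle x) + of_int n * (2 * pi)"
      using N_props by (simp add: angle_def field_simps)
    then have "sin (of_int n * angle (N - x)) = - sin (of_int n * angle x)"
      by (simp only: sin_cos_add_multiple_2pi sin_minus)
    ultimately show "of_int (disc_char (N - x)) * sin (of_int n * angle (N - x)) = of_int (disc_char x) * sin (of_int n * angle x)"
      by simp
  qed (simp add: disc_char_0)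
  finally show ?thesis .
qed

text \<open>
  Applied to the sawtooth this is, for $0 < \theta < \pi$, the step function that is $\pi$ below $\pi/3$
  and $0$ above. Its jump at $0$ has twice the size of the jumps at $\pm\pi/3$, whence the factor $2$.
\<close>
definition step_combination :: "(real \<Rightarrow> real) \<Rightarrow> real \<Rightarrow> real" where
  "step_combination f \<theta> = 2 * f \<theta> - f (\<theta> - pi / 3) - f (\<theta> + pi / 3)"

lemma tau_weighted_half:
  "\<tau> * of_int (disc_char (int n)) * (1 - cos (real n * pi / 3)) =
    (\<Sum>x\<in>half_system. of_int (disc_char x) * step_combination (\<lambda>\<theta>. sin (real n * \<theta>)) (angle x))"
proof -
  have "step_combination (\<lambda>\<theta>. sin (real n * \<theta>)) \<theta> = 2 * (sin (real n * \<theta>) * (1 - cos (real n * pi / 3)))" for \<theta>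
    by (simp add: step_combination_def right_diff_distrib distrib_left sin_diff sin_add)
  then have "(\<Sum>x\<in>half_system. of_int (disc_char x) * step_combination (\<lambda>\<theta>. sin (real n * \<theta>)) (angle x)) =
      (2 * (\<Sum>x\<in>half_system. of_int (disc_char x) * sin (real n * angle x))) * (1 - cos (real n * pi / 3))"
    by (simp add: sum_distrib_left sum_distrib_right ac_simps)
  also have "2 * (\<Sum>x\<in>half_system. of_int (disc_char x) * sin (real n * angle x)) = of_int (disc_char (int n)) * \<tau>"
    using tau_disc_char_half[of "int n"] by simp
  finally show ?thesis by simp
qed

lemma step_combination_sawtooth:
  assumes "x \<in> half_system"
  shows "step_combination sawtooth (angle x) = (if 6 * x < N then pi else 0)"
    and "0 < angle x" "angle x < pi" "angle x \<noteq> pi / 3"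
proof -
  have x: "1 \<le> x" "2 * x < N" using assms N_props unfolding half_system_def by auto
  show p: "0 < angle x" using x N_props by (simp add: angle_def)
  have "real_of_int (2 * x) < real_of_int N" using x by (simp only: of_int_less_iff)
  then show q: "angle x < pi" using N_props by (simp add: angle_def field_simps)
  have Npos: "0 < real_of_int N" using N_props(3) by simp
  have scaled: "angle x = pi / 3 * (6 * of_int x / of_int N)" by (simp add: angle_def)
  have less: "angle x < pi / 3 \<longleftrightarrow> 6 * x < N"
  proof -
    have "angle x < pi / 3 \<longleftrightarrow> pi / 3 * (6 * of_int x / of_int N) < pi / 3 * 1"
      by (simp only: scaled mult_1_right)
    also have "\<dots> \<longleftrightarrow> 6 * real_of_int x / of_int N < 1"
      by (rule mult_less_cancel_left_pos) simp
    also have "\<dots> \<longleftrightarrow> 6 * real_of_int x < real_of_int N"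
      using Npos by (simp only: divide_less_eq_1_pos)
    also have "\<dots> \<longleftrightarrow> real_of_int (6 * x) < real_of_int N" by simp
    finally show ?thesis by (simp only: of_int_less_iff)
  qed
  have "even (6 * x)" by simp
  then have "6 * x \<noteq> N" using N_props(2) by metis
  moreover have "angle x = pi / 3 \<longleftrightarrow> real_of_int (6 * x) = real_of_int N"
  proof -
    have "angle x = pi / 3 \<longleftrightarrow> pi / 3 * (6 * of_int x / of_int N) = pi / 3 * 1"
      by (simp only: scaled mult_1_right)
    also have "\<dots> \<longleftrightarrow> 6 * real_of_int x / of_int N = 1"
      unfolding mult_cancel_left by simp
    also have "\<dots> \<longleftrightarrow> 6 * real_of_int x = real_of_int N"
      using Npos by (auto simp: divide_eq_1_iff)
    finally show ?thesis by simp
  qed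
  ultimately show ne: "angle x \<noteq> pi / 3" by (metis of_int_eq_iff)
  have s1: "sawtooth (angle x) = (pi - angle x) / 2" using p by (simp add: sawtooth_def)
  have "0 < angle x + pi / 3" using p pi_gt_zero by linarith
  then have s2: "sawtooth (angle x + pi / 3) = (pi - (angle x + pi / 3)) / 2" by (simp add: sawtooth_def)
  have s3: "sawtooth (angle x - pi / 3) =
      (if angle x < pi / 3 then (- pi - (angle x - pi / 3)) / 2 else (pi - (angle x - pi / 3)) / 2)"
    using ne by (simp add: sawtooth_def)
  show "step_combination sawtooth (angle x) = (if 6 * x < N then pi else 0)"
    unfolding less[symmetric] step_combination_def s1 s2 s3 by (cases "angle x < pi / 3"; simp only: if_True if_False; argo)
qed

text \<open>
  Let $S(r) = \sum_n \tau \chi(n)(1 - \cos(n\pi/3)) r^n/n$. For $r < 1$ the finite sum over $x$ that defines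
  $\tau\chi(n)$ can be interchanged with the sum over $n$, and the inner series are logarithms. As
  $r \to 1$ these logarithms tend to values of the sawtooth, while $S(r)$ tends to $S(1)$ by Abel's limit
  theorem. The uniform bound behind that theorem needs bounded partial sums of the coefficients, which
  follow from their being odd and periodic modulo $6N$.
\<close>
lemma sum_sixth_L_value:
  assumes "\<not> 3 dvd N"
  shows "pi * \<bar>of_int (\<Sum>x\<in>{x \<in> half_system. 6 * x < N}. disc_char x)\<bar> = sqrt (of_int N) * \<bar>L_value\<bar>"
proof -
  let ?f = "\<lambda>n. \<tau> * of_int (disc_char (int n)) * (1 - cos (real n * pi / 3))"
  let ?A = "\<lambda>r \<theta>. - Im (Ln (1 - of_real r * cis \<theta>))"
  let ?g = "\<lambda>x. \<tau> * of_int (disc_char x) * (1 - cos (of_int x * pi / 3))"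
  have "\<exists>B. bounded_block_sums (\<lambda>n. ?g (int n)) B"
  proof (rule periodic_odd_bounded_block_sums[where P = "6 * N" and g = ?g])
    fix x
    have "[x mod (6 * N) = x] (mod N)"
      unfolding cong_iff_mod by (rule mod_mod_cancel) simp
    then have c: "disc_char (x mod (6 * N)) = disc_char x" by (rule disc_char_cong)
    define y q where "y = x mod (6 * N)" and "q = x div (6 * N)"
    have x: "x = y + 6 * N * q" by (simp add: y_def q_def)
    have "of_int x * pi / 3 = of_int y * pi / 3 + of_int (N * q) * (2 * pi)"
      unfolding x by (simp add: field_simps)
    then have "cos (of_int x * pi / 3) = cos (of_int (x mod (6 * N)) * pi / 3)"
      unfolding y_def by (simp only: sin_cos_add_multiple_2pi)
    then show "\<tau> * of_int (disc_char (x mod (6 * N))) * (1 - cos (of_int (x mod (6 * N)) * pi / 3)) =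
        \<tau> * of_int (disc_char x) * (1 - cos (of_int x * pi / 3))"
      unfolding c by simp
  qed (use N_props in \<open>simp_all add: disc_char_minus\<close>)
  then obtain B where "bounded_block_sums ?f B" by auto
  from abel_limit[OF this]
  have lim1: "((\<lambda>r. \<Sum>n. ?f n / real n * r ^ n) \<longlongrightarrow> (\<Sum>n. ?f n / real n)) (at_left 1)" .
  have ev: "\<forall>\<^sub>F r in at_left (1 :: real). 0 < r \<and> r < 1"
    by (rule eventually_at_leftI[of 0]) auto
  have series: "(\<Sum>n. ?f n / real n * r ^ n) = (\<Sum>x\<in>half_system. of_int (disc_char x) * step_combination (?A r) (angle x))"
    if r: "0 < r" "r < 1" for r :: real
  proof -
    have "(\<lambda>n. sin (real n * \<theta>) / real n * r ^ n) sums ?A r \<theta>" for \<theta>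
      using sin_power_series_sums[of r \<theta>] r by simp
    then have "(\<lambda>n. \<Sum>x\<in>half_system. of_int (disc_char x) * step_combination (\<lambda>\<theta>. sin (real n * \<theta>) / real n * r ^ n) (angle x))
      sums (\<Sum>x\<in>half_system. of_int (disc_char x) * step_combination (?A r) (angle x))"
      unfolding step_combination_def by (intro sums_sum sums_mult sums_diff)
    moreover have "(\<Sum>x\<in>half_system. of_int (disc_char x) * step_combination (\<lambda>\<theta>. sin (real n * \<theta>) / real n * r ^ n) (angle x)) =
        ?f n / real n * r ^ n" for n
    proof -
      have scale: "step_combination (\<lambda>\<theta>. sin (real n * \<theta>) / real n * r ^ n) \<phi> =
          step_combination (\<lambda>\<theta>. sin (real n * \<theta>)) \<phi> / real n * r ^ n" for \<phi>
        unfolding step_combination_def by (simp add: diff_divide_distrib left_diff_distrib)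
      show ?thesis
        unfolding tau_weighted_half sum_divide_distrib sum_distrib_right scale
        by (intro sum.cong refl) simp
    qed
    ultimately show ?thesis by (simp add: sums_iff)
  qed
  have "((\<lambda>r. \<Sum>x\<in>half_system. of_int (disc_char x) * step_combination (?A r) (angle x)) \<longlongrightarrow>
      (\<Sum>x\<in>half_system. of_int (disc_char x) * step_combination sawtooth (angle x))) (at_left 1)"
  proof (rule tendsto_sum, rule tendsto_mult_left)
    fix x assume x: "x \<in> half_system"
    note b = step_combination_sawtooth(2,3,4)[OF x]
    show "((\<lambda>r. step_combination (?A r) (angle x)) \<longlongrightarrow> step_combination sawtooth (angle x)) (at_left 1)"
      unfolding step_combination_def using b
      by (intro tendsto_diff tendsto_mult_left sin_power_series_limit) auto
  qed
  then have lim2: "((\<lambda>r. \<Sum>n. ?f n / real n * r ^ n) \<longlongrightarrow>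
      (\<Sum>x\<in>half_system. of_int (disc_char x) * step_combination sawtooth (angle x))) (at_left 1)"
    by (rule Lim_transform_eventually) (rule eventually_mono[OF ev], use series in simp)
  have "(\<Sum>n. ?f n / real n) = (\<Sum>x\<in>half_system. of_int (disc_char x) * step_combination sawtooth (angle x))"
    using lim1 lim2 by (rule tendsto_unique[rotated]) simp
  also have "\<dots> = (\<Sum>x\<in>half_system. if 6 * x < N then pi * of_int (disc_char x) else 0)"
    by (intro sum.cong) (auto simp: step_combination_sawtooth)
  also have "\<dots> = pi * of_int (\<Sum>x\<in>{x \<in> half_system. 6 * x < N}. disc_char x)"
  proof -
    have "{x \<in> half_system. 6 * x < N} = half_system \<inter> {x. 6 * x < N}" by auto
    then show ?thesis by (simp add: sum.inter_restrict half_system_def sum_distrib_left if_distrib cong: if_cong)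
  qed
  finally have "pi * of_int (\<Sum>x\<in>{x \<in> half_system. 6 * x < N}. disc_char x) = (\<Sum>n. ?f n / real n)" by simp
  also have "\<dots> = \<tau> * (\<Sum>n. of_int (disc_char (int n)) * (1 - cos (real n * pi / 3)) / real n)"
  proof -
    let ?h = "\<lambda>n. of_int (disc_char (int n)) * (1 - cos (real n * pi / 3)) / real n"
    have eq: "(\<lambda>n. ?f n / real n) = (\<lambda>n. \<tau> * ?h n)" by (simp add: mult.assoc)
    have "summable (\<lambda>n. ?f n / real n)"
      using power_series_summable_and_tail(1)[OF \<open>bounded_block_sums ?f B\<close>, of 1] by simp
    then have "summable (\<lambda>n. \<tau> * ?h n)" unfolding eq .
    moreover have "\<tau> \<noteq> 0" using \<tau>_squared N_props(3) by auto
    ultimately have "summable ?h" by (rule summable_mult_D)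
    then show ?thesis unfolding eq by (rule suminf_mult)
  qed
  finally have "\<bar>pi * of_int (\<Sum>x\<in>{x \<in> half_system. 6 * x < N}. disc_char x)\<bar> = \<bar>\<tau>\<bar> * \<bar>L_value\<bar>"
    using weighted_L_series[OF assms] by (simp only: abs_mult)
  moreover have "\<bar>\<tau>\<bar> = sqrt (of_int N)" using \<tau>_squared by (metis real_sqrt_abs)
  ultimately show ?thesis by (simp add: abs_mult)
qed

end

section \<open>Lattice points in an ellipse\<close>

text \<open>
  The function $G$ is a primitive of the decreasing function $\sqrt{Y^2 - y^2}$; apply the mean value
  theorem.
\<close>
lemma quarter_disc_primitive_bounds:
  fixes Y u v :: real
  defines "g \<equiv> \<lambda>y. sqrt (Y\<^sup>2 - y\<^sup>2)"
    and "G \<equiv> \<lambda>y. (y * sqrt (Y\<^sup>2 - y\<^sup>2) + Y\<^sup>2 * arcsin (y / Y)) / 2"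
  assumes "0 < Y" "0 \<le> u" "u \<le> v" "v \<le> Y"
  shows "(v - u) * g v \<le> G v - G u" "G v - G u \<le> (v - u) * g u"
proof -
  have "(v - u) * g v \<le> G v - G u \<and> G v - G u \<le> (v - u) * g u"
  proof (cases "u = v")
    case False
    then have uv: "u < v" using assms by simp
    have cont: "continuous_on {u..v} G"
      unfolding G_def using assms
      by (intro continuous_intros) (auto simp: divide_simps)
    have der: "(G has_real_derivative g y) (at y)" if y: "u < y" "y < v" for y
    proof -
      have yY: "0 < y" "y < Y" using y assms by auto
      have pos: "Y\<^sup>2 - y\<^sup>2 > 0" using yY by (simp add: power_strict_mono)
      define s where "s = sqrt (Y\<^sup>2 - y\<^sup>2)"
      have s: "s > 0" "s * s = Y\<^sup>2 - y\<^sup>2" using pos by (auto simp: s_def)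
      have r: "sqrt (1 - (y / Y)\<^sup>2) = s / Y"
      proof -
        have "1 - (y / Y)\<^sup>2 = (Y\<^sup>2 - y\<^sup>2) / Y\<^sup>2"
          using yY by (simp add: field_simps)
        then show ?thesis using yY by (simp add: s_def real_sqrt_divide)
      qed
      have "0 < y / Y" "y / Y < 1" using yY by simp_all
      then have one_gt: "-1 < y / Y" "y / Y < 1" by linarith+
      have "(G has_real_derivative
          ((1 * s + (0 - 2 * y) * (inverse s / 2) * y) + Y\<^sup>2 * (inverse (s / Y) * (1 / Y))) / 2) (at y)"
        unfolding G_def
        using pos yY unfolding s_def[symmetric] r[symmetric]
        using one_gt by (auto intro!: derivative_eq_intros simp: s_def)
      moreover have "((1 * s + (0 - 2 * y) * (inverse s / 2) * y) + Y\<^sup>2 * (inverse (s / Y) * (1 / Y))) / 2 = s"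
        using s yY by (simp add: field_simps power2_eq_square)
      ultimately have "(G has_real_derivative s) (at y)" by (simp only:)
      then show ?thesis by (simp add: g_def s_def)
    qed
    obtain z where z: "u < z" "z < v" "G v - G u = (v - u) * g z"
      using MVT2[OF uv, of G g] MVT[OF uv cont]
      by (metis DERIV_unique der real_differentiable_def)
    have "g v \<le> g z" "g z \<le> g u"
      unfolding g_def using z assms by (auto intro!: real_sqrt_le_mono power_mono)
    then show ?thesis using z uv by auto
  qed simp
  then show "(v - u) * g v \<le> G v - G u" "G v - G u \<le> (v - u) * g u" by auto
qed

text \<open>
  A Riemann sum for the area $\pi Y^2/4$ of the quarter disc.
\<close>
lemma sum_semicircle_bounds:
  fixes Y :: real
  assumes "0 \<le> Y"
  shows "(\<Sum>k=1..nat \<lfloor>Y\<rfloor>. sqrt (Y\<^sup>2 - (real k)\<^sup>2)) \<le> pi * Y\<^sup>2 / 4"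
    and "pi * Y\<^sup>2 / 4 - Y \<le> (\<Sum>k=1..nat \<lfloor>Y\<rfloor>. sqrt (Y\<^sup>2 - (real k)\<^sup>2))"
proof -
  define g where "g = (\<lambda>y. sqrt (Y\<^sup>2 - y\<^sup>2))"
  define G where "G = (\<lambda>y. (y * sqrt (Y\<^sup>2 - y\<^sup>2) + Y\<^sup>2 * arcsin (y / Y)) / 2)"
  have "(\<Sum>k=1..nat \<lfloor>Y\<rfloor>. g (real k)) \<le> pi * Y\<^sup>2 / 4 \<and>
    pi * Y\<^sup>2 / 4 - Y \<le> (\<Sum>k=1..nat \<lfloor>Y\<rfloor>. g (real k))"
  proof (cases "Y = 0")
    case False
    then have Y: "0 < Y" using assms by simp
    have B: "(v - u) * g v \<le> G v - G u" "G v - G u \<le> (v - u) * g u"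
      if "0 \<le> u" "u \<le> v" "v \<le> Y" for u v
      unfolding g_def G_def using quarter_disc_primitive_bounds[OF Y that] by auto
    define M where "M = nat \<lfloor>Y\<rfloor>"
    have M: "real M \<le> Y" "Y - real M \<le> 1" using Y by (auto simp: M_def) linarith+
    have G0: "G 0 = 0" and GY: "G Y = pi * Y\<^sup>2 / 4"
      using Y by (auto simp: G_def)
    have "(\<Sum>k=1..j. g (real k)) \<le> G (real j) \<and> G (real j) \<le> (\<Sum>k=1..j. g (real k)) + g 0 - g (real j)"
      if "j \<le> M" for j
      using that
    proof (induction j)
      case (Suc j)
      have "real (Suc j) \<le> Y" using Suc.prems M by linarith
      then show ?case using Suc B[of "real j" "real (Suc j)"] by auto
    qed (simp add: G0)
    from this[of M] have 1: "(\<Sum>k=1..M. g (real k)) \<le> G (real M)"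
      "G (real M) \<le> (\<Sum>k=1..M. g (real k)) + g 0 - g (real M)" by auto
    have g0: "g 0 = Y" using Y by (simp add: g_def)
    have gp: "g (real M) \<ge> 0" "g Y = 0" using M by (auto simp: g_def)
    have 2: "0 \<le> G Y - G (real M)" "G Y - G (real M) \<le> (Y - real M) * g (real M)"
      using B[of "real M" Y] M gp by auto
    have "(Y - real M) * g (real M) \<le> 1 * g (real M)" using M gp by (intro mult_right_mono) auto
    then show ?thesis using 1 2 g0 GY unfolding M_def by auto
  qed simp
  then show "(\<Sum>k=1..nat \<lfloor>Y\<rfloor>. sqrt (Y\<^sup>2 - (real k)\<^sup>2)) \<le> pi * Y\<^sup>2 / 4"
    "pi * Y\<^sup>2 / 4 - Y \<le> (\<Sum>k=1..nat \<lfloor>Y\<rfloor>. sqrt (Y\<^sup>2 - (real k)\<^sup>2))"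
    unfolding g_def by auto
qed

lemma card_int_progression_bounds:
  fixes a r :: int and s :: real
  assumes "0 < a" "0 \<le> s"
  shows "finite {x :: int. \<bar>real_of_int (2 * a * x + r)\<bar> \<le> s}"
    and "\<bar>real (card {x :: int. \<bar>real_of_int (2 * a * x + r)\<bar> \<le> s}) - s / a\<bar> \<le> 1"
proof -
  define l where "l = (- s - r) / (2 * a)"
  define h where "h = (s - r) / (2 * a)"
  have "{x :: int. \<bar>real_of_int (2 * a * x + r)\<bar> \<le> s} = {\<lceil>l\<rceil>..\<lfloor>h\<rfloor>}"
    using assms by (auto simp: l_def h_def ceiling_le_iff le_floor_iff field_simps abs_le_iff)
  moreover have "h - l = s / a" using assms by (simp add: l_def h_def field_simps)
  moreover have "s / a \<ge> 0" using assms by simp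
  ultimately show "finite {x :: int. \<bar>real_of_int (2 * a * x + r)\<bar> \<le> s}"
    "\<bar>real (card {x :: int. \<bar>real_of_int (2 * a * x + r)\<bar> \<le> s}) - s / a\<bar> \<le> 1"
    by simp_all linarith
qed

text \<open>
  Count by horizontal lines: on the line with ordinate $y$, the numbers $x$ fill an interval of length
  $\sqrt{4aX - n y^2}/a$, up to an error of $1$, and the sum of these lengths over $y$ is a Riemann sum for
  the area.
\<close>
lemma card_ellipse_lattice_points:
  fixes a b n :: int and X :: real
  defines "S \<equiv> {(x :: int, y :: int). real_of_int ((2 * a * x + b * y)\<^sup>2 + n * y\<^sup>2) \<le> 4 * a * X}"
  assumes "0 < a" "0 < n" "0 \<le> X"
  shows "finite S"
    and "\<bar>real (card S) - 2 * pi * X / sqrt n\<bar> \<le> (sqrt n / a + 2) * sqrt (4 * a / n) * sqrt X + 1"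
proof -
  define Y where "Y = sqrt (4 * a * X / n)"
  have Y0: "Y \<ge> 0" using assms by (simp add: Y_def)
  have Y2: "Y\<^sup>2 = 4 * a * X / n" using assms by (simp add: Y_def)
  define M where "M = nat \<lfloor>Y\<rfloor>"
  have M: "real M \<le> Y" using Y0 by (auto simp: M_def)
  define s where "s = (\<lambda>y :: int. sqrt n * sqrt (Y\<^sup>2 - (real_of_int y)\<^sup>2))"
  have in_range: "real_of_int (y\<^sup>2) \<le> Y\<^sup>2 \<longleftrightarrow> y \<in> {- int M..int M}"
    for y :: int
  proof -
    have "real_of_int (y\<^sup>2) \<le> Y\<^sup>2 \<longleftrightarrow> \<bar>real_of_int y\<bar> \<le> Y"
      using Y0 abs_le_square_iff[of "real_of_int y" Y] by simp
    also have "\<dots> \<longleftrightarrow> \<bar>y\<bar> \<le> \<lfloor>Y\<rfloor>"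
      by (simp add: le_floor_iff)
    also have "\<dots> \<longleftrightarrow> y \<in> {- int M..int M}" using Y0 by (auto simp: M_def)
    finally show ?thesis .
  qed
  have slice: "(x, y) \<in> S \<longleftrightarrow> y \<in> {- int M..int M} \<and> \<bar>real_of_int (2 * a * x + b * y)\<bar> \<le> s y" for x y
  proof -
    define z where "z = real_of_int (2 * a * x + b * y)"
    have "(x, y) \<in> S \<longleftrightarrow> z\<^sup>2 + n * (real_of_int y)\<^sup>2 \<le> n * Y\<^sup>2"
      using assms by (simp add: S_def Y2 z_def)
    also have "\<dots> \<longleftrightarrow> real_of_int (y\<^sup>2) \<le> Y\<^sup>2 \<and> z\<^sup>2 \<le> n * (Y\<^sup>2 - (real_of_int y)\<^sup>2)"
    proof -
      have "real_of_int (y\<^sup>2) \<le> Y\<^sup>2"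
        if "z\<^sup>2 \<le> n * (Y\<^sup>2 - (real_of_int y)\<^sup>2)"
      proof -
        have "0 \<le> n * (Y\<^sup>2 - (real_of_int y)\<^sup>2)"
          using that by (rule order_trans[rotated]) simp
        then show ?thesis using assms by (simp add: zero_le_mult_iff)
      qed
      then show ?thesis by (auto simp: algebra_simps)
    qed
    also have "\<dots> \<longleftrightarrow> y \<in> {- int M..int M} \<and> \<bar>z\<bar> \<le> s y"
    proof -
      have "z\<^sup>2 \<le> n * (Y\<^sup>2 - (real_of_int y)\<^sup>2) \<longleftrightarrow> \<bar>z\<bar> \<le> s y" if "real_of_int (y\<^sup>2) \<le> Y\<^sup>2"
      proof -
        have "(s y)\<^sup>2 = n * (Y\<^sup>2 - (real_of_int y)\<^sup>2)" "s y \<ge> 0" using that assms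
          by (auto simp: s_def power_mult_distrib)
        then show ?thesis using abs_le_square_iff[of z "s y"] by auto
      qed
      then show ?thesis using in_range by auto
    qed
    finally show ?thesis by (simp add: z_def)
  qed
  define T where "T = (\<lambda>y :: int. {x :: int. \<bar>real_of_int (2 * a * x + b * y)\<bar> \<le> s y})"
  have s0: "s y \<ge> 0" if "y \<in> {- int M..int M}" for y
    using that in_range[of y] assms by (auto simp: s_def)
  have finT: "finite (T y)" "\<bar>real (card (T y)) - s y / a\<bar> \<le> 1"
    if "y \<in> {- int M..int M}" for y
    unfolding T_def using card_int_progression_bounds[of a "s y" "b * y"] s0[OF that] assms by auto
  have Seq: "S = (\<lambda>(y, x). (x, y)) ` (SIGMA y:{- int M..int M}. T y)"
    using slice by (force simp: T_def image_iff)
  show "finite S" unfolding Seq using finT by (intro finite_imageI finite_SigmaI) auto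
  have "card S = card (SIGMA y:{- int M..int M}. T y)"
    unfolding Seq by (rule card_image) (auto simp: inj_on_def)
  then have cS: "real (card S) = (\<Sum>y\<in>{- int M..int M}. real (card (T y)))"
    using finT by (subst (asm) card_SigmaI) auto
  have "\<bar>real (card S) - (\<Sum>y\<in>{- int M..int M}. s y / a)\<bar> \<le> (\<Sum>y\<in>{- int M..int M}. 1)"
    unfolding cS sum_subtractf[symmetric] by (rule order_trans[OF sum_abs sum_mono]) (use finT in auto)
  then have e1: "\<bar>real (card S) - (\<Sum>y\<in>{- int M..int M}. s y / a)\<bar> \<le> 2 * Y + 1"
    using M by simp
  have fold: "(\<Sum>y\<in>{- int M..int M}. f y) = f 0 + (\<Sum>k=1..M. f (int k) + f (- int k))"
    for f :: "int \<Rightarrow> real" and M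
  proof (induction M)
    case (Suc M)
    have "{- int (Suc M)..int (Suc M)} = insert (- int (Suc M)) (insert (int (Suc M)) {- int M..int M})"
      by auto
    then show ?case using Suc by simp
  qed simp
  define Q where "Q = (\<Sum>k=1..M. sqrt (Y\<^sup>2 - (real k)\<^sup>2))"
  have "(\<Sum>y\<in>{- int M..int M}. s y / a) = sqrt n / a * (Y + 2 * Q)"
    unfolding fold using Y0 by (simp add: s_def Q_def sum.distrib sum_distrib_left sum_divide_distrib algebra_simps)
  moreover have "\<bar>(Y + 2 * Q) - pi * Y\<^sup>2 / 2\<bar> \<le> Y"
    using sum_semicircle_bounds[OF Y0] unfolding M_def[symmetric] Q_def[symmetric] by linarith
  ultimately have "\<bar>(\<Sum>y\<in>{- int M..int M}. s y / a) - sqrt n / a * (pi * Y\<^sup>2 / 2)\<bar> \<le> sqrt n / a * Y"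
  proof -
    assume 1: "(\<Sum>y\<in>{- int M..int M}. s y / a) = sqrt n / a * (Y + 2 * Q)"
      and 2: "\<bar>(Y + 2 * Q) - pi * Y\<^sup>2 / 2\<bar> \<le> Y"
    have r: "sqrt n / a \<ge> 0" using assms by simp
    have "\<bar>sqrt n / a * (Y + 2 * Q) - sqrt n / a * (pi * Y\<^sup>2 / 2)\<bar> =
      sqrt n / a * \<bar>(Y + 2 * Q) - pi * Y\<^sup>2 / 2\<bar>"
      by (simp only: right_diff_distrib[symmetric] abs_mult abs_of_nonneg[OF r])
    also have "\<dots> \<le> sqrt n / a * Y" by (rule mult_left_mono[OF 2 r])
    finally show ?thesis using 1 by simp
  qed
  moreover have "sqrt n / a * (pi * Y\<^sup>2 / 2) = 2 * pi * X / sqrt n"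
    using assms by (simp add: Y2 field_simps)
  ultimately have "\<bar>real (card S) - 2 * pi * X / sqrt n\<bar> \<le> (sqrt n / a + 2) * Y + 1"
    using e1 by (simp add: algebra_simps)
  moreover have "Y = sqrt (4 * a / n) * sqrt X" by (simp add: Y_def flip: real_sqrt_mult)
  ultimately show "\<bar>real (card S) - 2 * pi * X / sqrt n\<bar> \<le> (sqrt n / a + 2) * sqrt (4 * a / n) * sqrt X + 1"
    by (simp add: mult.assoc)
qed

lemma lattice_points_form_asymptotic:
  fixes a b c n :: int
  assumes "0 < a" "0 < n" "n = 4 * a * c - b\<^sup>2"
  shows "finite {(x, y). a * x\<^sup>2 + b * x * y + c * y\<^sup>2 \<le> int X}"
    and "(\<lambda>X :: nat. real (card {(x, y). a * x\<^sup>2 + b * x * y + c * y\<^sup>2 \<le> int X}) / real X)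
      \<longlonglongrightarrow> 2 * pi / sqrt n"
proof -
  have eq: "{(x, y). a * x\<^sup>2 + b * x * y + c * y\<^sup>2 \<le> int X} =
    {(x, y). real_of_int ((2 * a * x + b * y)\<^sup>2 + n * y\<^sup>2) \<le> 4 * a * real X}" for X
  proof -
    have "a * x\<^sup>2 + b * x * y + c * y\<^sup>2 \<le> int X \<longleftrightarrow>
      real_of_int ((2 * a * x + b * y)\<^sup>2 + n * y\<^sup>2) \<le> 4 * a * real X" for x y
    proof -
      have "(2 * a * x + b * y)\<^sup>2 + n * y\<^sup>2 = 4 * a * (a * x\<^sup>2 + b * x * y + c * y\<^sup>2)"
        unfolding assms(3) by (simp add: power2_eq_square algebra_simps)
      then have "real_of_int ((2 * a * x + b * y)\<^sup>2 + n * y\<^sup>2) \<le> 4 * a * real X \<longleftrightarrow>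
        real_of_int (4 * a * (a * x\<^sup>2 + b * x * y + c * y\<^sup>2)) \<le> real_of_int (4 * a * int X)"
        by simp
      also have "\<dots> \<longleftrightarrow> a * x\<^sup>2 + b * x * y + c * y\<^sup>2 \<le> int X"
        using assms(1) by (simp only: of_int_le_iff mult_le_cancel_left) auto
      finally show ?thesis by simp
    qed
    then show ?thesis by blast
  qed
  note E = card_ellipse_lattice_points[OF assms(1,2), of "real _" b, folded eq, simplified]
  show "finite {(x, y). a * x\<^sup>2 + b * x * y + c * y\<^sup>2 \<le> int X}" using E(1) by auto
  define C where "C = (sqrt n / a + 2) * sqrt (4 * a / n)"
  define f where "f = (\<lambda>X. real (card {(x, y). a * x\<^sup>2 + b * x * y + c * y\<^sup>2 \<le> int X}))"
  have bd: "\<bar>f X - 2 * pi * real X / sqrt n\<bar> \<le> C * sqrt X + 1" for X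
    using E(2)[of X] unfolding f_def C_def by simp
  have "(\<lambda>X. f X / real X - 2 * pi / sqrt n) \<longlonglongrightarrow> 0"
  proof (rule Lim_null_comparison)
    show "\<forall>\<^sub>F X in sequentially. norm (f X / real X - 2 * pi / sqrt n) \<le> (C * sqrt X + 1) / real X"
      using eventually_gt_at_top[of 0]
    proof eventually_elim
      case (elim X)
      have "f X / real X - 2 * pi / sqrt n = (f X - 2 * pi * real X / sqrt n) / real X"
        using elim by (simp add: field_simps)
      then show ?case using bd[of X] elim by (simp add: divide_right_mono)
    qed
    show "(\<lambda>X. (C * sqrt (real X) + 1) / real X) \<longlonglongrightarrow> 0"
      by real_asymp
  qed
  then show "(\<lambda>X :: nat. real (card {(x, y). a * x\<^sup>2 + b * x * y + c * y\<^sup>2 \<le> int X}) / real X)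
      \<longlonglongrightarrow> 2 * pi / sqrt n"
    unfolding f_def by (simp add: LIM_zero_iff)
qed

section \<open>The ring of integers\<close>

text \<open>
  A nonzero subgroup of $\mathbb{Z}$ is generated by its least positive element.
\<close>
lemma int_subgroup_multiples:
  fixes S :: "int set"
  assumes diff: "\<And>x y. x \<in> S \<Longrightarrow> y \<in> S \<Longrightarrow> x - y \<in> S"
    and ne: "x0 \<in> S" "x0 \<noteq> 0"
  obtains g where "0 < g" "\<And>x. x \<in> S \<longleftrightarrow> g dvd x"
proof -
  have zero: "0 \<in> S" using diff[OF ne(1) ne(1)] by simp
  have neg: "- x \<in> S" if "x \<in> S" for x using diff[OF zero that] by simp
  have mult_nat: "int n * x \<in> S" if "x \<in> S" for n x
  proof (induction n)
    case (Suc n)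
    show ?case using diff[OF Suc neg[OF that]] by (simp add: algebra_simps)
  qed (use zero in simp)
  have mult: "k * x \<in> S" if "x \<in> S" for k x
  proof (cases "k \<ge> 0")
    case True
    then show ?thesis using mult_nat[OF that, of "nat k"] by simp
  next
    case False
    then show ?thesis using neg[OF mult_nat[OF that, of "nat (- k)"]] by simp
  qed
  define P where "P = (\<lambda>n :: nat. 0 < n \<and> int n \<in> S)"
  have "P (nat \<bar>x0\<bar>)" using ne neg[OF ne(1)] by (auto simp: P_def abs_if)
  then have least: "P (LEAST n. P n)" by (rule LeastI)
  define g where "g = int (LEAST n. P n)"
  have g: "0 < g" "g \<in> S" using least by (auto simp: g_def P_def)
  have "g dvd x" if "x \<in> S" for x
  proof (rule ccontr)
    assume "\<not> g dvd x"
    then have "0 < x mod g" using g(1) by (simp add: dvd_eq_mod_eq_0 order_less_le)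
    moreover have "x mod g = x - (x div g) * g" by (simp add: minus_div_mult_eq_mod)
    then have "x mod g \<in> S" using diff[OF that mult[OF g(2)]] by metis
    ultimately have "P (nat (x mod g))" by (simp add: P_def)
    then have "(LEAST n. P n) \<le> nat (x mod g)" by (rule Least_le)
    then show False using g(1) pos_mod_bound[of g x] unfolding g_def by linarith
  qed
  moreover have "x \<in> S" if "g dvd x" for x using that mult[OF g(2)] by (metis dvdE mult.commute)
  ultimately show ?thesis using that g(1) by blast
qed

text \<open>
  If $x = p/q$ in lowest terms then $q^k$ divides $d$ for all $k$, which forces $q = 1$.
\<close>
lemma rat_int_if_bounded_denominators:
  fixes x :: rat and d :: int
  assumes d: "d \<noteq> 0" and int: "\<And>k. of_int d * x ^ k \<in> \<int>"
  shows "x \<in> \<int>"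
proof -
  obtain p q where pq: "quotient_of x = (p, q)" by (cases "quotient_of x")
  have q: "0 < q" "coprime p q" and x: "x = of_int p / of_int q"
    using pq quotient_of_denom_pos quotient_of_coprime quotient_of_div by auto
  have dv: "q ^ k dvd d" for k
  proof -
    obtain j where "of_int d * x ^ k = of_int j" using int Ints_cases by metis
    then have "rat_of_int (d * p ^ k) = of_int (j * q ^ k)"
      using q by (simp add: x field_simps)
    then have "d * p ^ k = j * q ^ k" by (simp only: of_int_eq_iff)
    then have "q ^ k dvd d * p ^ k" by simp
    moreover have "coprime (q ^ k) (p ^ k)" using q by (simp add: coprime_commute)
    ultimately show ?thesis by (simp add: coprime_dvd_mult_left_iff)
  qed
  have "q = 1"
  proof (rule ccontr)
    assume "q \<noteq> 1"
    then have "2 \<le> q" using q by simp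
    then have "2 ^ nat \<bar>d\<bar> \<le> q ^ nat \<bar>d\<bar>" by (intro power_mono) auto
    also have "\<dots> \<le> \<bar>d\<bar>"
      using dvd_imp_le_int[OF d dv, of "nat \<bar>d\<bar>"] q by simp
    finally have "2 ^ nat \<bar>d\<bar> \<le> \<bar>d\<bar>" .
    moreover have "int (nat \<bar>d\<bar>) < 2 ^ nat \<bar>d\<bar>"
      by (metis less_exp of_nat_less_iff of_nat_numeral of_nat_power)
    ultimately show False by simp
  qed
  then show ?thesis using x by simp
qed

lemma cnj_of_rat [simp]: "cnj (of_rat r) = of_rat r"
  by (cases r) (simp add: of_rat_rat)

lemma root_of_monic_quadratic_algebraic_int:
  fixes z :: complex
  assumes "z\<^sup>2 + of_int b * z + of_int c = 0"
  shows "algebraic_int z"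
proof -
  let ?p = "[:of_int c, of_int b, 1 :: complex:]"
  have "poly ?p z = 0" using assms by (simp add: power2_eq_square algebra_simps)
  moreover have "Polynomial.coeff ?p i \<in> \<int>" for i
    by (auto simp: Polynomial.coeff_pCons split: nat.split)
  moreover have "lead_coeff ?p = 1" by simp
  ultimately show ?thesis by (intro algebraic_int.intros[of ?p]) auto
qed

context odd_discriminant
begin

definition sqrt_disc :: complex where "sqrt_disc = csqrt (of_int (1 - 4 * m))"

definition \<omega> :: complex where "\<omega> = (1 + sqrt_disc) / 2"

definition el :: "int \<Rightarrow> int \<Rightarrow> complex"
  where "el x y = of_int x + of_int y * \<omega>"

definition maxorder :: "complex set" where "maxorder = {el x y | x y. True}"

abbreviation K :: "complex set" where "K \<equiv> carrier (quadratic_field (1 - 4 * m))"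

lemma sqrt_disc_eq: "sqrt_disc = \<i> * of_real (sqrt (of_int N))"
proof -
  have "complex_of_int (1 - 4 * m) = of_real (- of_int N)" unfolding N_props(5) by simp
  then have "sqrt_disc = csqrt (of_real (- of_int N))" unfolding sqrt_disc_def by (rule arg_cong)
  also have "\<dots> = \<i> * of_real (sqrt \<bar>- of_int N\<bar>)"
    using N_props(3) by (subst csqrt_of_real_nonpos) simp_all
  finally show ?thesis using N_props by simp
qed

lemma sqrt_disc_sq: "sqrt_disc * sqrt_disc = of_int (1 - 4 * m)"
  unfolding sqrt_disc_def power2_eq_square[symmetric] by (rule power2_csqrt)

lemma cnj_sqrt_disc: "cnj sqrt_disc = - sqrt_disc"
  by (simp add: sqrt_disc_eq)

lemma Im_\<omega>: "Im \<omega> > 0"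
  using N_props by (simp add: \<omega>_def sqrt_disc_eq)

lemma \<omega>_sq: "\<omega> * \<omega> = \<omega> - of_int m"
proof -
  have "4 * (\<omega> * \<omega>) = 1 + 2 * sqrt_disc + sqrt_disc * sqrt_disc"
    by (simp add: \<omega>_def algebra_simps)
  also have "\<dots> = 4 * (\<omega> - of_int m)" unfolding sqrt_disc_sq by (simp add: \<omega>_def)
  finally show ?thesis by (metis mult_cancel_left zero_neq_numeral)
qed

lemma cnj_\<omega>: "cnj \<omega> = 1 - \<omega>"
  by (simp add: \<omega>_def cnj_sqrt_disc field_simps)

lemma el_eq_iff: "el x y = el x' y' \<longleftrightarrow> x = x' \<and> y = y'"
proof
  assume eq: "el x y = el x' y'"
  then have "Im (el x y) = Im (el x' y')" by simp
  then have "y = y'" using Im_\<omega> by (simp add: el_def)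
  then show "x = x' \<and> y = y'" using eq by (simp add: el_def)
qed simp

lemma el_add: "el x y + el x' y' = el (x + x') (y + y')"
  by (simp add: el_def algebra_simps)

lemma el_diff: "el x y - el x' y' = el (x - x') (y - y')"
  by (simp add: el_def algebra_simps)

lemma el_minus: "- el x y = el (- x) (- y)"
  by (simp add: el_def)

lemma el_mult: "el x y * el x' y' = el (x * x' - m * y * y') (x * y' + y * x' + y * y')"
proof -
  have "el x y * el x' y' = of_int (x * x') + of_int (x * y' + y * x') * \<omega> + of_int (y * y') * (\<omega> * \<omega>)"
    by (simp add: el_def algebra_simps)
  then show ?thesis unfolding \<omega>_sq by (simp add: el_def algebra_simps)
qed

lemma el_int: "of_int x = el x 0"
  by (simp add: el_def)

lemma cnj_el: "cnj (el x y) = el (x + y) (- y)"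
  by (simp add: el_def cnj_\<omega> algebra_simps)

definition norm_form :: "int \<Rightarrow> int \<Rightarrow> int"
  where "norm_form x y = x\<^sup>2 + x * y + m * y\<^sup>2"

lemma el_mult_cnj: "el x y * cnj (el x y) = of_int (norm_form x y)"
  unfolding cnj_el el_mult el_int norm_form_def by (simp add: power2_eq_square algebra_simps)

lemma norm_form_bound: "4 * norm_form x y = (2 * x + y)\<^sup>2 + N * y\<^sup>2"
  by (simp add: norm_form_def N_def power2_eq_square algebra_simps)

lemma norm_form_nonneg: "0 \<le> norm_form x y"
proof -
  have "0 \<le> (2 * x + y)\<^sup>2 + N * y\<^sup>2" using N_props by simp
  then show ?thesis unfolding norm_form_bound[symmetric] by simp
qed

lemma mem_maxorder: "el x y \<in> maxorder"
  by (auto simp: maxorder_def)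

lemma maxorderE:
  assumes "z \<in> maxorder" obtains x y where "z = el x y"
  using assms by (auto simp: maxorder_def)

lemma maxorder_closed:
  shows "z \<in> maxorder \<Longrightarrow> w \<in> maxorder \<Longrightarrow> z + w \<in> maxorder"
    and "z \<in> maxorder \<Longrightarrow> w \<in> maxorder \<Longrightarrow> z - w \<in> maxorder"
    and "z \<in> maxorder \<Longrightarrow> w \<in> maxorder \<Longrightarrow> z * w \<in> maxorder"
    and "z \<in> maxorder \<Longrightarrow> - z \<in> maxorder"
    and "z \<in> maxorder \<Longrightarrow> cnj z \<in> maxorder"
    and "of_int j \<in> maxorder" and "0 \<in> maxorder" and "1 \<in> maxorder"
proof -
  show "of_int j \<in> maxorder" for j unfolding el_int by (rule mem_maxorder)
  from this[of 0] this[of 1] show "0 \<in> maxorder" "1 \<in> maxorder" by simp_all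
qed (auto elim!: maxorderE simp: el_add el_diff el_mult el_minus cnj_el mem_maxorder)

text \<open>
  The field is the set of fractions with numerator in $\mathbb{Z}[\omega]$ and denominator a positive
  integer. This form makes its closure under products and inverses immediate.
\<close>
lemma K_iff: "z \<in> K \<longleftrightarrow> (\<exists>d :: int. 0 < d \<and> of_int d * z \<in> maxorder)"
proof
  assume "z \<in> K"
  then obtain a b where z: "z = of_rat a + of_rat b * sqrt_disc"
    by (auto simp: quadratic_field_def sqrt_disc_def)
  obtain p q where pq: "quotient_of a = (p, q)" by (cases "quotient_of a")
  obtain r t where rt: "quotient_of b = (r, t)" by (cases "quotient_of b")
  have q: "0 < q" "a = of_int p / of_int q" using pq quotient_of_denom_pos quotient_of_div by auto
  have t: "0 < t" "b = of_int r / of_int t" using rt quotient_of_denom_pos quotient_of_div by auto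
  have s: "sqrt_disc = 2 * \<omega> - 1" by (simp add: \<omega>_def field_simps)
  have "of_int (q * t) * z = el (p * t - q * r) (2 * q * r)"
    using q(1) t(1) by (simp add: z q(2) t(2) s el_def of_rat_divide field_simps)
  then show "\<exists>d :: int. 0 < d \<and> of_int d * z \<in> maxorder"
    using q t mem_maxorder by (metis mult_pos_pos)
next
  assume "\<exists>d :: int. 0 < d \<and> of_int d * z \<in> maxorder"
  then obtain d x y where d: "0 < d" "of_int d * z = el x y" by (auto elim!: maxorderE)
  have "z = of_rat ((of_int x + of_int y / 2) / of_int d) + of_rat (of_int y / (2 * of_int d)) * sqrt_disc"
    using d by (simp add: el_def \<omega>_def of_rat_divide of_rat_add of_rat_mult field_simps)
  then show "z \<in> K" unfolding quadratic_field_def sqrt_disc_def by auto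
qed

lemma maxorder_subset_K: "maxorder \<subseteq> K"
  unfolding K_iff subset_iff by (intro allI impI exI[of _ 1]) auto

lemma K_mult: "z \<in> K \<Longrightarrow> w \<in> K \<Longrightarrow> z * w \<in> K"
proof -
  assume "z \<in> K" "w \<in> K"
  then obtain d e :: int where de: "0 < d" "of_int d * z \<in> maxorder" "0 < e" "of_int e * w \<in> maxorder"
    unfolding K_iff by blast
  have "of_int (d * e) * (z * w) = (of_int d * z) * (of_int e * w)" by simp
  then have "of_int (d * e) * (z * w) \<in> maxorder" using de maxorder_closed(3) by metis
  then show ?thesis unfolding K_iff using de by (metis mult_pos_pos)
qed

lemma K_inverse: "z \<in> K \<Longrightarrow> z \<noteq> 0 \<Longrightarrow> inverse z \<in> K"
proof -
  assume "z \<in> K" "z \<noteq> 0"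
  then obtain d :: int and x y where d: "0 < d" "of_int d * z = el x y"
    unfolding K_iff by (auto elim!: maxorderE)
  have "el x y \<noteq> 0" using d \<open>z \<noteq> 0\<close> by auto
  then have "norm_form x y \<noteq> 0" using el_mult_cnj[of x y] by auto
  then have n: "0 < norm_form x y" using norm_form_nonneg[of x y] by simp
  have "of_int (norm_form x y) * inverse z = of_int d * cnj (el x y)"
    unfolding el_mult_cnj[symmetric] d(2)[symmetric] using \<open>z \<noteq> 0\<close> by (simp add: field_simps)
  also have "\<dots> \<in> maxorder" by (intro maxorder_closed mem_maxorder)
  finally show ?thesis unfolding K_iff using n by blast
qed

text \<open>
  Put $A = 2a$. Integrality of $A$ and of the norm makes $N (2b)^2$ an integer, so $2b$ is an integer,
  as $N$ is squarefree. Then $A^2 + N(2b)^2$ is divisible by $4$, and $N \equiv 3 \pmod 4$ gives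
  $A \equiv 2b \pmod 2$.
\<close>
lemma rational_trace_norm_in_maxorder:
  assumes z: "z = of_rat a + of_rat b * sqrt_disc"
    and tr: "2 * a \<in> \<int>" and no: "a\<^sup>2 + of_int N * b\<^sup>2 \<in> \<int>"
  shows "z \<in> maxorder"
proof -
  obtain A where A: "2 * a = of_int A" using tr Ints_cases by metis
  obtain \<nu> where \<nu>: "a\<^sup>2 + of_int N * b\<^sup>2 = of_int \<nu>"
    using no Ints_cases by metis
  obtain p q where pq: "quotient_of (2 * b) = (p, q)" by (cases "quotient_of (2 * b)")
  have q: "0 < q" "coprime p q" "2 * b = of_int p / of_int q"
    using pq quotient_of_denom_pos quotient_of_coprime quotient_of_div by auto
  have "of_int N * (2 * b)\<^sup>2 = 4 * of_int \<nu> - (2 * a)\<^sup>2"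
    unfolding \<nu>[symmetric] by (simp add: power2_eq_square algebra_simps)
  then have "rat_of_int N * (2 * b)\<^sup>2 = of_int (4 * \<nu> - A\<^sup>2)" unfolding A by simp
  then have "rat_of_int (N * p\<^sup>2) = of_int ((4 * \<nu> - A\<^sup>2) * q\<^sup>2)"
    using q(1) unfolding q(3) by (simp add: field_simps)
  then have eq: "N * p\<^sup>2 = (4 * \<nu> - A\<^sup>2) * q\<^sup>2" by (simp only: of_int_eq_iff)
  then have "q\<^sup>2 dvd N * p\<^sup>2" by simp
  moreover have "coprime (q\<^sup>2) (p\<^sup>2)" using q by (simp add: coprime_commute)
  ultimately have "q\<^sup>2 dvd N" by (simp add: coprime_dvd_mult_left_iff)
  then have "q = 1" using squarefree_N q(1) unfolding squarefree_def by auto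
  then have b: "2 * b = of_int p" and eq1: "N * p\<^sup>2 + A\<^sup>2 = 4 * \<nu>" using q eq by auto
  have "even (A - p)"
  proof (rule ccontr)
    assume "odd (A - p)"
    moreover have "even (A\<^sup>2 - p\<^sup>2)"
    proof -
      have "A\<^sup>2 - p\<^sup>2 = 4 * \<nu> - (N + 1) * p\<^sup>2"
        using eq1 by (simp add: algebra_simps)
      then show ?thesis using N_props by simp
    qed
    ultimately show False by simp
  qed
  then obtain x where x: "A = p + 2 * x" by (metis dvdE diff_add_cancel add.commute)
  have a': "a = of_int (p + 2 * x) / 2" and b': "b = of_int p / 2" using A b x by simp_all
  have "z = el x p"
    unfolding z a' b' by (simp add: el_def \<omega>_def of_rat_divide of_rat_add of_rat_mult field_simps)
  then show ?thesis using mem_maxorder by simp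
qed

text \<open>
  The norm is an integer since its powers have bounded denominators. The same holds for the norm of
  $z + 1$, whose powers have the same common denominator as those of $z$ by the binomial theorem. The
  difference of the two norms is $1$ plus the trace.
\<close>
lemma bounded_denominators_in_maxorder:
  assumes z: "z \<in> K" and d: "0 < d" "\<And>k. of_int d * z ^ k \<in> maxorder"
  shows "z \<in> maxorder"
proof -
  obtain a b where ab: "z = of_rat a + of_rat b * sqrt_disc"
    using z by (auto simp: quadratic_field_def sqrt_disc_def)
  have norm: "w * cnj w = of_rat (r\<^sup>2 + of_int N * b\<^sup>2)"
    if "w = of_rat r + of_rat b * sqrt_disc" for w r
  proof -
    have "w * cnj w = of_rat (r\<^sup>2) - of_rat (b\<^sup>2) * (sqrt_disc * sqrt_disc)"
      unfolding that by (simp add: cnj_sqrt_disc of_rat_power power2_eq_square of_rat_mult algebra_simps)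
    then show ?thesis unfolding sqrt_disc_sq N_props(5) by (simp add: of_rat_add of_rat_mult)
  qed
  have integral: "r\<^sup>2 + of_int N * b\<^sup>2 \<in> \<int>"
    if w: "w = of_rat r + of_rat b * sqrt_disc" and p: "\<And>k. of_int d * w ^ k \<in> maxorder" for w r
  proof (rule rat_int_if_bounded_denominators[of "d\<^sup>2"])
    fix k
    obtain x y where xy: "of_int d * w ^ k = el x y" using p maxorderE by metis
    have "complex_of_rat (of_int (d\<^sup>2) * (r\<^sup>2 + of_int N * b\<^sup>2) ^ k) = of_int (d\<^sup>2) * (w * cnj w) ^ k"
      by (simp only: of_rat_mult[of "of_int (d\<^sup>2)"] of_rat_power[of "r\<^sup>2 + of_int N * b\<^sup>2"] of_rat_of_int_eq norm[OF w])
    also have "\<dots> = (of_int d * w ^ k) * cnj (of_int d * w ^ k)"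
      by (simp add: power_mult_distrib power2_eq_square)
    also have "\<dots> = of_rat (of_int (norm_form x y))" unfolding xy el_mult_cnj by simp
    finally show "of_int (d\<^sup>2) * (r\<^sup>2 + of_int N * b\<^sup>2) ^ k \<in> \<int>"
      by (simp only: of_rat_eq_iff Ints_of_int)
  qed (use d in simp)
  have i0: "a\<^sup>2 + of_int N * b\<^sup>2 \<in> \<int>" by (rule integral[OF ab d(2)])
  have i1: "(a + 1)\<^sup>2 + of_int N * b\<^sup>2 \<in> \<int>"
  proof (rule integral[of "z + 1"])
    show "z + 1 = of_rat (a + 1) + of_rat b * sqrt_disc" by (simp add: ab of_rat_add)
    have sum: "sum f A \<in> maxorder" if "\<And>i. f i \<in> maxorder"
      for f :: "nat \<Rightarrow> complex" and A
      by (induction A rule: infinite_finite_induct) (auto intro: maxorder_closed that)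
    fix k
    have "of_int d * (z + 1) ^ k = (\<Sum>i\<le>k. of_int (int (k choose i)) * (of_int d * z ^ i))"
    proof -
      have "(z + 1) ^ k = (\<Sum>i\<le>k. of_nat (k choose i) * z ^ i)"
        using binomial_ring[of z 1 k] by simp
      then show ?thesis by (simp add: sum_distrib_left ac_simps)
    qed
    also have "\<dots> \<in> maxorder" by (intro sum maxorder_closed d)
    finally show "of_int d * (z + 1) ^ k \<in> maxorder" .
  qed
  have "2 * a = ((a + 1)\<^sup>2 + of_int N * b\<^sup>2) - (a\<^sup>2 + of_int N * b\<^sup>2) - 1"
    by (simp add: power2_eq_square algebra_simps)
  then have "2 * a \<in> \<int>" using i0 i1 by (metis Ints_1 Ints_diff)
  then show ?thesis using rational_trace_norm_in_maxorder[OF ab _ i0] by simp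
qed

text \<open>
  If $z$ is a root of a monic integral polynomial of degree $n$ and $cz \in \mathbb{Z}[\omega]$, then $c^n$
  is a common denominator of all powers of $z$: the powers from $z^n$ on are integral combinations of
  lower ones.
\<close>
lemma algebraic_int_in_maxorder:
  assumes z: "z \<in> K" "algebraic_int z"
  shows "z \<in> maxorder"
proof -
  obtain p where p: "\<And>i. Polynomial.coeff p i \<in> \<int>" "lead_coeff p = 1" "poly p z = 0"
    using z(2) by (auto simp: algebraic_int.simps)
  define n where "n = degree p"
  obtain c :: int where c: "0 < c" "of_int c * z \<in> maxorder" using z(1) unfolding K_iff by blast
  have pow: "w ^ k \<in> maxorder" if "w \<in> maxorder" for w k
    by (induction k) (auto intro: maxorder_closed that)
  have "of_int (c ^ n) * z ^ k \<in> maxorder" for k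
  proof (induction k rule: less_induct)
    case (less k)
    show ?case
    proof (cases "k < n")
      case True
      then have "c ^ n = c ^ (n - k) * c ^ k" by (simp flip: power_add)
      then have "of_int (c ^ n) * z ^ k = of_int (c ^ (n - k)) * (of_int c * z) ^ k"
        by (simp add: power_mult_distrib)
      also have "\<dots> \<in> maxorder" by (intro maxorder_closed pow c)
      finally show ?thesis .
    next
      case False
      then obtain j where j: "k = n + j" using le_iff_add[of n k] by auto
      have "0 = (\<Sum>i\<le>n. Polynomial.coeff p i * z ^ i)"
        using p(3) by (simp add: poly_altdef n_def)
      also have "\<dots> = z ^ n + (\<Sum>i<n. Polynomial.coeff p i * z ^ i)"
        using p(2) by (simp add: lessThan_Suc_atMost[symmetric] n_def)
      finally have "z ^ n = - (\<Sum>i<n. Polynomial.coeff p i * z ^ i)"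
        by (simp add: eq_neg_iff_add_eq_0)
      then have "of_int (c ^ n) * z ^ k = of_int (c ^ n) * (- (\<Sum>i<n. Polynomial.coeff p i * z ^ i) * z ^ j)"
        unfolding j power_add by (simp only:)
      also have "\<dots> = - (\<Sum>i<n. Polynomial.coeff p i * (of_int (c ^ n) * z ^ (i + j)))"
        by (simp add: sum_distrib_left sum_distrib_right power_add ac_simps)
      also have "\<dots> \<in> maxorder"
      proof -
        have tm: "Polynomial.coeff p i * (of_int (c ^ n) * z ^ (i + j)) \<in> maxorder" if "i < n" for i
        proof -
          obtain l where "Polynomial.coeff p i = of_int l" using p(1) Ints_cases by metis
          then show ?thesis using less[of "i + j"] that j maxorder_closed(3,6) by simp
        qed
        have "(\<Sum>i<l. Polynomial.coeff p i * (of_int (c ^ n) * z ^ (i + j))) \<in> maxorder"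
          if "l \<le> n" for l
          using that
        proof (induction l)
          case (Suc l)
          show ?case unfolding sum.lessThan_Suc by (intro maxorder_closed tm Suc.IH) (use Suc.prems in simp_all)
        qed (simp add: maxorder_closed)
        then show ?thesis by (simp add: maxorder_closed)
      qed
      finally show ?thesis .
    qed
  qed
  then show ?thesis using bounded_denominators_in_maxorder[OF z(1), of "c ^ n"] c by simp
qed

lemma integer_ring_eq: "integer_ring (1 - 4 * m) = maxorder"
proof
  show "integer_ring (1 - 4 * m) \<subseteq> maxorder"
    using algebraic_int_in_maxorder by (auto simp: integer_ring_def)
  show "maxorder \<subseteq> integer_ring (1 - 4 * m)"
  proof
    fix z assume z: "z \<in> maxorder"
    then obtain x y where xy: "z = el x y" by (rule maxorderE)
    have "z\<^sup>2 + of_int (- (2 * x + y)) * z + of_int (norm_form x y) = 0"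
      unfolding xy el_int power2_eq_square el_mult el_add
      by (simp add: norm_form_def power2_eq_square algebra_simps flip: el_int)
    then have "algebraic_int z" by (rule root_of_monic_quadratic_algebraic_int)
    then show "z \<in> integer_ring (1 - 4 * m)"
      using z maxorder_subset_K by (auto simp: integer_ring_def)
  qed
qed

end

section \<open>Ideals as lattices\<close>

context odd_discriminant
begin

definition nonzero_ideal :: "complex set \<Rightarrow> bool" where
  "nonzero_ideal I \<longleftrightarrow> I \<subseteq> maxorder \<and> (\<forall>x\<in>I. \<forall>y\<in>I. x - y \<in> I) \<and>
    (\<forall>a\<in>maxorder. \<forall>x\<in>I. a * x \<in> I) \<and> (\<exists>x\<in>I. x \<noteq> 0)"

text \<open>
  The lattice $k(\mathbb{Z} a + \mathbb{Z}(t + \omega))$.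
\<close>
definition ideal_lattice :: "int \<Rightarrow> int \<Rightarrow> int \<Rightarrow> complex set" where
  "ideal_lattice k a t = {el (k * (a * x + t * y)) (k * y) | x y. True}"

lemma mem_ideal_lattice_iff:
  assumes "k \<noteq> 0"
  shows "el u v \<in> ideal_lattice k a t \<longleftrightarrow> k dvd v \<and> k * a dvd u - t * v"
proof
  assume "el u v \<in> ideal_lattice k a t"
  then obtain x y where "u = k * (a * x + t * y)" "v = k * y" by (auto simp: ideal_lattice_def el_eq_iff)
  then have "v = k * y" "u - t * v = k * a * x" by (auto simp: algebra_simps)
  then show "k dvd v \<and> k * a dvd u - t * v" by simp
next
  assume "k dvd v \<and> k * a dvd u - t * v"
  then obtain x y where "v = k * y" "u - t * v = k * a * x" by (auto elim!: dvdE)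
  then have "v = k * y" "u = k * (a * x + t * y)" by (auto simp: algebra_simps)
  then show "el u v \<in> ideal_lattice k a t" by (auto simp: ideal_lattice_def)
qed

lemma ideal_lattice_subset: "ideal_lattice k a t \<subseteq> maxorder"
  by (auto simp: ideal_lattice_def mem_maxorder)

lemma nonzero_ideal_lattice:
  assumes k: "0 < k" and a: "0 < a" and f: "a dvd minpoly_at m t"
  shows "nonzero_ideal (ideal_lattice k a t)"
  unfolding nonzero_ideal_def
proof (intro conjI ballI)
  have k0: "k \<noteq> 0" using k by simp
  show "ideal_lattice k a t \<subseteq> maxorder" by (rule ideal_lattice_subset)
  fix x y assume xy: "x \<in> ideal_lattice k a t" "y \<in> ideal_lattice k a t"
  then obtain u v u' v' where e: "x = el u v" "y = el u' v'"
    using ideal_lattice_subset maxorderE by (metis subsetD)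
  have "k dvd v - v'" "k * a dvd (u - t * v) - (u' - t * v')"
    using xy unfolding e mem_ideal_lattice_iff[OF k0] by auto
  then show "x - y \<in> ideal_lattice k a t"
    unfolding e el_diff mem_ideal_lattice_iff[OF k0] by (simp add: algebra_simps)
next
  have k0: "k \<noteq> 0" using k by simp
  fix b x assume b: "b \<in> maxorder" and x: "x \<in> ideal_lattice k a t"
  obtain p q where pq: "b = el p q" using b by (rule maxorderE)
  obtain u v where e: "x = el u v" using x ideal_lattice_subset maxorderE by (metis subsetD)
  have kv: "k dvd v" and ka: "k * a dvd u - t * v"
    using x unfolding e mem_ideal_lattice_iff[OF k0] by auto
  then have "k dvd u - t * v" by (auto elim: dvd_mult_left)
  then have "k dvd (u - t * v) + t * v" using kv by (intro dvd_add) auto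
  then have ku: "k dvd u" by simp
  have "k * a dvd v * minpoly_at m t" using kv f by (rule mult_dvd_mono)
  then have "k * a dvd (p - q * t) * (u - t * v) - q * (v * minpoly_at m t)"
    using ka by (intro dvd_diff) auto
  also have "(p - q * t) * (u - t * v) - q * (v * minpoly_at m t) =
      (p * u - m * q * v) - t * (p * v + q * u + q * v)"
    by (simp add: minpoly_at_def power2_eq_square algebra_simps)
  finally show "b * x \<in> ideal_lattice k a t"
    unfolding pq e el_mult mem_ideal_lattice_iff[OF k0] using kv ku by simp
next
  have "el (k * (a * 1 + t * 0)) (k * 0) \<in> ideal_lattice k a t" unfolding ideal_lattice_def by blast
  moreover have "el (k * (a * 1 + t * 0)) (k * 0) \<noteq> 0"
    using k a el_eq_iff[of _ _ 0 0] by (simp add: el_def)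
  ultimately show "\<exists>x\<in>ideal_lattice k a t. x \<noteq> 0" by blast
qed

lemma el_eq_0_iff: "el x y = 0 \<longleftrightarrow> x = 0 \<and> y = 0"
  using el_eq_iff[of x y 0 0] by (simp add: el_def)

lemma norm_form_eq_0: "norm_form x y = 0 \<longleftrightarrow> x = 0 \<and> y = 0"
  using el_mult_cnj[of x y] el_eq_0_iff[of x y] by (metis complex_cnj_zero_iff mult_eq_0_iff of_int_eq_0_iff)

text \<open>
  The Hermite normal form of the lattice: $k$ generates the group of all coefficients of $\omega$ that
  occur in $I$, and $ka$ generates $I \cap \mathbb{Z}$. Closure under multiplication by $\omega$ makes $k$ a
  common divisor, and multiplying $k(t + \omega)$ by the conjugate of $t + \omega$ gives
  $a \mid t^2 + t + m$.
\<close>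
lemma nonzero_ideal_eq_lattice:
  assumes I: "nonzero_ideal I"
  obtains k a t where "0 < k" "0 < a" "0 \<le> t" "t < a" "a dvd minpoly_at m t" "I = ideal_lattice k a t"
proof -
  have sub: "I \<subseteq> maxorder"
    and diff: "\<And>x y. x \<in> I \<Longrightarrow> y \<in> I \<Longrightarrow> x - y \<in> I"
    and mult: "\<And>a x. a \<in> maxorder \<Longrightarrow> x \<in> I \<Longrightarrow> a * x \<in> I"
    using I by (auto simp: nonzero_ideal_def)
  obtain p q where pq: "el p q \<in> I" "el p q \<noteq> 0"
    using I unfolding nonzero_ideal_def by (metis maxorderE subsetD)
  have n: "el (norm_form p q) 0 \<in> I" "norm_form p q \<noteq> 0"
  proof -
    have "cnj (el p q) * el p q \<in> I" using pq(1) by (intro mult maxorder_closed mem_maxorder)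
    then show "el (norm_form p q) 0 \<in> I"
      using el_mult_cnj[of p q] by (simp add: mult.commute flip: el_int)
    show "norm_form p q \<noteq> 0" using pq(2) by (simp add: norm_form_eq_0 el_eq_0_iff)
  qed
  have om: "el (- m * v) (u + v) \<in> I" if "el u v \<in> I" for u v
    using mult[OF mem_maxorder that, of 0 1] by (simp add: el_mult)
  obtain \<alpha> where \<alpha>: "0 < \<alpha>" "\<And>x. el x 0 \<in> I \<longleftrightarrow> \<alpha> dvd x"
    using int_subgroup_multiples[of "{x. el x 0 \<in> I}" "norm_form p q"] n diff by (metis (mono_tags, lifting) diff_0_right el_diff mem_Collect_eq)
  have "el 0 (norm_form p q) \<in> I" using om[OF n(1)] by simp
  then have mem: "norm_form p q \<in> {v. \<exists>u. el u v \<in> I}" by blast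
  have "x - y \<in> {v. \<exists>u. el u v \<in> I}"
    if "x \<in> {v. \<exists>u. el u v \<in> I}" "y \<in> {v. \<exists>u. el u v \<in> I}" for x y
  proof -
    obtain u u' where "el u x \<in> I" "el u' y \<in> I"
      using \<open>x \<in> _\<close> \<open>y \<in> _\<close> by blast
    from diff[OF this] show ?thesis unfolding el_diff by blast
  qed
  then obtain k where "0 < k" "\<And>v. v \<in> {v. \<exists>u. el u v \<in> I} \<longleftrightarrow> k dvd v"
    using int_subgroup_multiples mem n(2) by blast
  then have k: "0 < k" "\<And>v. (\<exists>u. el u v \<in> I) \<longleftrightarrow> k dvd v" by simp_all
  obtain b where b: "el b k \<in> I" using k(2)[of k] by auto
  have "k dvd \<alpha>" using om[of \<alpha> 0] \<alpha>(2)[of \<alpha>] k(2)[of \<alpha>] by auto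
  then obtain a where a: "\<alpha> = k * a" by auto
  have a0: "0 < a" using \<alpha>(1) k(1) a by (simp add: zero_less_mult_iff)
  have "k dvd b + k" using om[OF b] k(2)[of "b + k"] by auto
  then obtain s where s: "b = k * s" by (auto simp: dvd_add_left_iff)
  define t where "t = s mod a"
  (* The first factor is the conjugate of s + \<omega>, and b + k \<omega> = k (s + \<omega>). *)
  have "el (s + 1) (- 1) * el b k \<in> I" by (intro mult mem_maxorder b)
  also have "el (s + 1) (- 1) * el b k = el (k * minpoly_at m s) 0"
    unfolding el_mult s by (simp add: minpoly_at_def power2_eq_square algebra_simps)
  finally have "k * a dvd k * minpoly_at m s" using \<alpha>(2) a by simp
  then have "a dvd minpoly_at m s" using k by simp
  moreover have st: "a dvd s - t" unfolding t_def by (simp add: minus_mod_eq_mult_div)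
  ultimately have f: "a dvd minpoly_at m t"
    using dvd_minpoly_at_cong[of s t a m] by (simp add: cong_iff_dvd_diff)
  have "el u v \<in> I \<longleftrightarrow> el u v \<in> ideal_lattice k a t" for u v
  proof (cases "k dvd v")
    case False
    then show ?thesis using k by (auto simp: mem_ideal_lattice_iff)
  next
    case True
    then obtain y where y: "v = k * y" by auto
    have by_: "el (y * b) v \<in> I"
      using mult[OF mem_maxorder b, of y 0] by (simp add: el_mult y mult.commute)
    have "el u v \<in> I \<longleftrightarrow> el (u - y * b) 0 \<in> I"
    proof
      assume "el u v \<in> I"
      from diff[OF this by_] show "el (u - y * b) 0 \<in> I" by (simp add: el_diff)
    next
      assume z: "el (u - y * b) 0 \<in> I"
      have "0 \<in> I" using diff[OF b b] by simp
      from diff[OF this by_] have "- el (y * b) v \<in> I" by simp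
      from diff[OF z this] have "el (u - y * b) 0 + el (y * b) v \<in> I" by simp
      then show "el u v \<in> I" unfolding el_add by simp
    qed
    also have "\<dots> \<longleftrightarrow> k * a dvd u - s * v"
      by (simp add: \<alpha>(2) a s y ac_simps)
    also have "\<dots> \<longleftrightarrow> k * a dvd u - t * v"
    proof -
      have "k * a dvd v * (s - t)" using True st by (rule mult_dvd_mono)
      moreover have "u - t * v = (u - s * v) + v * (s - t)" by (simp add: algebra_simps)
      ultimately show ?thesis by (simp only: dvd_add_left_iff)
    qed
    also have "\<dots> \<longleftrightarrow> el u v \<in> ideal_lattice k a t"
      using k True by (simp add: mem_ideal_lattice_iff)
    finally show ?thesis .
  qed
  then have "I = ideal_lattice k a t"
    using sub ideal_lattice_subset[of k a t] by (metis maxorderE subsetD subsetI subset_antisym)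
  moreover have "0 \<le> t" "t < a" using a0 by (simp_all add: t_def)
  ultimately show ?thesis using that[of k a t] k(1) a0 f by blast
qed

lemma ideal_lattice_inject:
  assumes "0 < k" "0 < k'" "0 < a" "0 < a'" "0 \<le> t" "t < a" "0 \<le> t'" "t' < a'"
    and eq: "ideal_lattice k a t = ideal_lattice k' a' t'"
  shows "k = k' \<and> a = a' \<and> t = t'"
proof -
  have gen: "k2 dvd k1 \<and> (k1 = k2 \<longrightarrow> a2 dvd a1 \<and> a2 dvd t1 - t2)"
    if "0 < k1" "0 < k2" "ideal_lattice k1 a1 t1 = ideal_lattice k2 a2 t2" for k1 k2 a1 a2 t1 t2
  proof -
    have "el (k1 * t1) k1 \<in> ideal_lattice k1 a1 t1" "el (k1 * a1) 0 \<in> ideal_lattice k1 a1 t1"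
      using that(1) by (simp_all add: mem_ideal_lattice_iff mult.commute)
    then have "el (k1 * t1) k1 \<in> ideal_lattice k2 a2 t2" "el (k1 * a1) 0 \<in> ideal_lattice k2 a2 t2" using that by auto
    then have h: "k2 dvd k1" "k2 * a2 dvd k1 * t1 - t2 * k1" "k2 * a2 dvd k1 * a1"
      using that(2) by (simp_all add: mem_ideal_lattice_iff)
    have "k1 * t1 - t2 * k1 = k1 * (t1 - t2)" by (simp add: algebra_simps)
    then show ?thesis using h that(1) by auto
  qed
  have "k = k'"
    using gen[OF assms(1,2) eq] gen[OF assms(2,1) eq[symmetric]] assms zdvd_antisym_nonneg by auto
  moreover have "a = a'"
    using gen[OF assms(1,2) eq] gen[OF assms(2,1) eq[symmetric]] assms zdvd_antisym_nonneg[of a a'] \<open>k = k'\<close> by auto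
  moreover have "t = t'"
  proof -
    have "a dvd t - t'" using gen[OF assms(1,2) eq] \<open>k = k'\<close> \<open>a = a'\<close> by auto
    then have "t mod a = t' mod a" by (simp add: mod_eq_dvd_iff)
    then show ?thesis using assms \<open>a = a'\<close> by simp
  qed
  ultimately show ?thesis by simp
qed

definition elem_norm :: "complex \<Rightarrow> int"
  where "elem_norm z = \<lfloor>(cmod z)\<^sup>2\<rfloor>"

lemma cmod_el: "(cmod (el x y))\<^sup>2 = of_int (norm_form x y)"
proof -
  have "complex_of_real ((cmod (el x y))\<^sup>2) = of_real (of_int (norm_form x y))"
    unfolding complex_norm_square el_mult_cnj by simp
  then show ?thesis by (simp only: of_real_eq_iff)
qed

lemma elem_norm_el: "elem_norm (el x y) = norm_form x y"
  by (simp add: elem_norm_def cmod_el)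

lemma elem_norm_mult:
  assumes "z \<in> maxorder" "w \<in> maxorder" shows "elem_norm (z * w) = elem_norm z * elem_norm w"
proof -
  obtain x y x' y' where e: "z = el x y" "w = el x' y'" using assms maxorderE by metis
  have "(cmod (z * w))\<^sup>2 = of_int (norm_form x y * norm_form x' y')"
    unfolding e norm_mult power_mult_distrib cmod_el by simp
  then have "elem_norm (z * w) = norm_form x y * norm_form x' y'"
    unfolding elem_norm_def by (simp only: floor_of_int)
  then show ?thesis by (simp add: e elem_norm_el)
qed

text \<open>
  For nonzero ideals this is the usual norm, the index in the ring of integers. Taking it as the
  greatest common divisor of the norms of elements makes its behaviour under scaling immediate.
\<close>
definition ideal_norm :: "complex set \<Rightarrow> int" where "ideal_norm I = Gcd (elem_norm ` I)"

lemma ideal_norm_scale: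
  assumes "\<gamma> \<in> maxorder" "I \<subseteq> maxorder"
  shows "ideal_norm ((*) \<gamma> ` I) = \<bar>elem_norm \<gamma>\<bar> * ideal_norm I"
proof -
  have "elem_norm ` (*) \<gamma> ` I = (*) (elem_norm \<gamma>) ` elem_norm ` I"
    unfolding image_image using assms by (intro image_cong) (auto simp: elem_norm_mult)
  then show ?thesis by (simp add: ideal_norm_def Gcd_mult abs_mult)
qed

text \<open>
  The norm form of $\mathbb{Z} a + \mathbb{Z}(t + \omega)$ divided by $a$; its discriminant is
  $(2t+1)^2 - 4(t^2 + t + m) = 1 - 4m$.
\<close>
definition lattice_form :: "int \<Rightarrow> int \<Rightarrow> int \<Rightarrow> int \<Rightarrow> int"
  where
  "lattice_form a t x y = a * x\<^sup>2 + (2 * t + 1) * x * y + (minpoly_at m t div a) * y\<^sup>2"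

lemma norm_form_lattice_form:
  assumes "a dvd minpoly_at m t"
  shows "norm_form (a * x + t * y) y = a * lattice_form a t x y"
proof -
  obtain c where c: "minpoly_at m t = a * c" using assms by auto
  have "norm_form (a * x + t * y) y = a * (a * x\<^sup>2 + (2 * t + 1) * x * y) + minpoly_at m t * y\<^sup>2"
    by (simp add: norm_form_def minpoly_at_def power2_eq_square algebra_simps)
  also have "minpoly_at m t * y\<^sup>2 = a * ((minpoly_at m t div a) * y\<^sup>2)"
    using assms by simp
  finally show ?thesis by (simp add: lattice_form_def distrib_left)
qed

text \<open>
  The square of a common divisor of the coefficients divides the discriminant, which is squarefree.
\<close>
lemma lattice_form_primitive:
  assumes a: "0 < a" "a dvd minpoly_at m t"
  shows "gcd a (gcd (minpoly_at m t div a) (2 * t + 1)) = 1"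
proof (rule ccontr)
  let ?g = "gcd a (gcd (minpoly_at m t div a) (2 * t + 1))"
  obtain c where c: "minpoly_at m t = a * c" using a by auto
  then have ca: "minpoly_at m t div a = c" using a by simp
  assume "?g \<noteq> 1"
  moreover have "?g \<noteq> 0" using a by simp
  moreover have "?g\<^sup>2 dvd 1 - 4 * m"
  proof -
    have "?g\<^sup>2 dvd (2 * t + 1)\<^sup>2" by (intro dvd_power_same) (meson dvd_trans gcd_dvd2)
    moreover have "?g\<^sup>2 dvd a * c" unfolding power2_eq_square ca
      by (intro mult_dvd_mono) (auto intro: dvd_trans[OF gcd_dvd2])
    then have "?g\<^sup>2 dvd 4 * minpoly_at m t" unfolding c by (rule dvd_mult)
    moreover have "1 - 4 * m = (2 * t + 1)\<^sup>2 - 4 * minpoly_at m t"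
      unfolding minpoly_at_discriminant by simp
    ultimately show ?thesis by simp
  qed
  then have "is_unit ?g" using squarefree_disc unfolding squarefree_def by blast
  ultimately show False by simp
qed

text \<open>
  The norms of the elements are $k^2 a$ times the values of a primitive form. The values at $(1,0)$, $(0,1)$
  and $(1,1)$ suffice to recover the coefficients.
\<close>
lemma ideal_norm_lattice:
  assumes k: "0 < k" and a: "0 < a" "a dvd minpoly_at m t"
  shows "ideal_norm (ideal_lattice k a t) = k\<^sup>2 * a"
proof -
  have val: "elem_norm (el (k * (a * x + t * y)) (k * y)) = k\<^sup>2 * a * lattice_form a t x y" for x y
  proof -
    have "norm_form (k * (a * x + t * y)) (k * y) = k\<^sup>2 * norm_form (a * x + t * y) y"
      by (simp add: norm_form_def power2_eq_square algebra_simps)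
    then show ?thesis using a by (simp add: elem_norm_el norm_form_lattice_form)
  qed
  let ?S = "elem_norm ` ideal_lattice k a t" and ?c = "minpoly_at m t div a"
  have S: "?S = {k\<^sup>2 * a * lattice_form a t x y | x y. True}"
    by (force simp: ideal_lattice_def val image_iff)
  have "Gcd ?S = k\<^sup>2 * a"
  proof (rule Gcd_eqI)
    show "normalize (k\<^sup>2 * a) = k\<^sup>2 * a" using k a by simp
    show "\<And>b. b \<in> ?S \<Longrightarrow> k\<^sup>2 * a dvd b" unfolding S by auto
    fix d assume d: "\<And>b. b \<in> ?S \<Longrightarrow> d dvd b"
    have h: "d dvd k\<^sup>2 * a * lattice_form a t x y" for x y by (rule d) (auto simp: S)
    have 1: "d dvd (k\<^sup>2 * a) * a" using h[of 1 0] by (simp add: lattice_form_def)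
    have 2: "d dvd (k\<^sup>2 * a) * ?c" using h[of 0 1] by (simp add: lattice_form_def)
    have "d dvd k\<^sup>2 * a * lattice_form a t 1 1 - (k\<^sup>2 * a) * a - (k\<^sup>2 * a) * ?c"
      using 1 2 h by (intro dvd_diff)
    also have "k\<^sup>2 * a * lattice_form a t 1 1 - (k\<^sup>2 * a) * a - (k\<^sup>2 * a) * ?c = (k\<^sup>2 * a) * (2 * t + 1)"
      by (simp add: lattice_form_def algebra_simps)
    finally have 3: "d dvd (k\<^sup>2 * a) * (2 * t + 1)" .
    have "d dvd gcd ((k\<^sup>2 * a) * a) (gcd ((k\<^sup>2 * a) * ?c) ((k\<^sup>2 * a) * (2 * t + 1)))"
      using 1 2 3 by simp
    also have "\<dots> = normalize (k\<^sup>2 * a)"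
      using lattice_form_primitive[OF a] by (simp add: gcd_mult_left)
    finally show "d dvd k\<^sup>2 * a" by simp
  qed
  then show ?thesis by (simp add: ideal_norm_def)
qed

text \<open>
  If $x^2 + xy + m y^2 = 1$ then $(2x+y)^2 + N y^2 = 4$, and $N \ge 7$ forces $y = 0$.
\<close>
lemma norm_one_unit:
  assumes "\<epsilon> \<in> maxorder" "elem_norm \<epsilon> = 1"
    shows "\<epsilon> = 1 \<or> \<epsilon> = - 1"
proof -
  obtain x y where e: "\<epsilon> = el x y" using assms(1) by (rule maxorderE)
  have "(2 * x + y)\<^sup>2 + N * y\<^sup>2 = 4"
    using assms(2) norm_form_bound[of x y] by (simp add: e elem_norm_el)
  have "y = 0"
  proof (rule ccontr)
    assume "y \<noteq> 0"
    then have "1 \<le> y\<^sup>2" using zero_less_power2[of y] by linarith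
    then have "7 * 1 \<le> N * y\<^sup>2" using N_props(1) by (intro mult_mono) auto
    then show False using \<open>(2 * x + y)\<^sup>2 + N * y\<^sup>2 = 4\<close> zero_le_power2[of "2 * x + y"] by linarith
  qed
  then have "x\<^sup>2 = 1" using assms(2) by (simp add: e elem_norm_el norm_form_def)
  then have "x = 1 \<or> x = -1" by (simp add: power2_eq_1_iff)
  then show ?thesis using \<open>y = 0\<close> by (auto simp: e el_def)
qed

text \<open>
  A multiplier of a lattice is a root of the characteristic polynomial of the integral matrix by which it
  acts on a basis.
\<close>
lemma ideal_lattice_multiplier_in_maxorder:
  assumes a: "0 < a" and \<epsilon>: "\<epsilon> \<in> K"
    and stable: "(*) \<epsilon> ` ideal_lattice 1 a t \<subseteq> ideal_lattice 1 a t"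
  shows "\<epsilon> \<in> maxorder"
proof -
  have "el (1 * (a * 1 + t * 0)) (1 * 0) \<in> ideal_lattice 1 a t" "el (1 * (a * 0 + t * 1)) (1 * 1) \<in> ideal_lattice 1 a t"
    unfolding ideal_lattice_def by blast+
  then have "\<epsilon> * el a 0 \<in> ideal_lattice 1 a t" "\<epsilon> * el t 1 \<in> ideal_lattice 1 a t" using stable by auto
  then obtain p q r s where "\<epsilon> * el a 0 = el (a * p + t * q) q" "\<epsilon> * el t 1 = el (a * r + t * s) s"
    unfolding ideal_lattice_def by auto
  then have 1: "\<epsilon> * el a 0 = of_int p * el a 0 + of_int q * el t 1"
    and 2: "\<epsilon> * el t 1 = of_int r * el a 0 + of_int s * el t 1"
    by (simp_all add: el_def algebra_simps)
  have "(\<epsilon> - of_int s) * ((\<epsilon> - of_int p) * el a 0) = (\<epsilon> - of_int s) * (of_int q * el t 1)"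
    using 1 by (simp add: algebra_simps)
  also have "\<dots> = of_int q * (of_int r * el a 0)" using 2 by (simp add: algebra_simps)
  finally have "((\<epsilon> - of_int s) * (\<epsilon> - of_int p) - of_int q * of_int r) * el a 0 = 0"
    by (simp add: algebra_simps)
  moreover have "el a 0 \<noteq> 0" using a by (simp add: el_eq_0_iff)
  ultimately have "(\<epsilon> - of_int s) * (\<epsilon> - of_int p) - of_int q * of_int r = 0" by simp
  then have "\<epsilon>\<^sup>2 + of_int (- (p + s)) * \<epsilon> + of_int (p * s - q * r) = 0"
    by (simp add: power2_eq_square algebra_simps)
  then show ?thesis using \<epsilon> root_of_monic_quadratic_algebraic_int algebraic_int_in_maxorder by blast
qed

end

section \<open>Counting the ideals of one class\<close>

context odd_discriminant
begin

text \<open>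
  These classes are the cosets of the group of principal fractional ideals; see class_number_eq.
\<close>
definition homothety_class :: "complex set \<Rightarrow> complex set set" where
  "homothety_class I = {(*) c ` I | c. c \<in> K \<and> c \<noteq> 0}"

lemma nonzero_ideal_scale:
  assumes A: "nonzero_ideal A" and c: "c \<noteq> 0" "(*) c ` A \<subseteq> maxorder"
  shows "nonzero_ideal ((*) c ` A)"
  unfolding nonzero_ideal_def
proof (intro conjI ballI)
  show "(*) c ` A \<subseteq> maxorder" by (rule c)
  show "x - y \<in> (*) c ` A" if "x \<in> (*) c ` A" "y \<in> (*) c ` A" for x y
    using that A unfolding nonzero_ideal_def by (auto simp: right_diff_distrib[symmetric])
  show "b * x \<in> (*) c ` A" if "b \<in> maxorder" "x \<in> (*) c ` A" for b x
    using that A unfolding nonzero_ideal_def by (auto simp: mult.left_commute)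
  show "\<exists>x\<in>(*) c ` A. x \<noteq> 0" using A c unfolding nonzero_ideal_def by auto
qed

text \<open>
  The element of the conjugate of $A = \mathbb{Z} a + \mathbb{Z}(t + \omega)$ with coordinates $x$ and $y$;
  see cofactor_eq_cnj.
\<close>
definition cofactor :: "int \<Rightarrow> int \<Rightarrow> int \<Rightarrow> int \<Rightarrow> complex"
  where
  "cofactor a t x y = el (a * x + t * y + y) (- y)"

definition class_ideal :: "int \<Rightarrow> int \<Rightarrow> int \<times> int \<Rightarrow> complex set" where
  "class_ideal a t = (\<lambda>(x, y). (*) (cofactor a t x y / of_int a) ` ideal_lattice 1 a t)"

context
  fixes a t :: int
  assumes a: "0 < a" and f: "a dvd minpoly_at m t"
begin

lemma cofactor_eq_cnj: "cofactor a t x y = cnj (el (a * x + t * y) y)"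
  by (simp add: cofactor_def cnj_el)

lemma cofactor_inject: "cofactor a t x y = cofactor a t x' y' \<longleftrightarrow> x = x' \<and> y = y'"
  unfolding cofactor_def el_eq_iff using a by auto

lemma cofactor_eq_0: "cofactor a t x y = 0 \<longleftrightarrow> x = 0 \<and> y = 0"
  unfolding cofactor_def el_eq_0_iff using a by auto

lemma cofactor_maxorder: "cofactor a t x y \<in> maxorder"
  by (simp add: cofactor_def mem_maxorder)

lemma elem_norm_cofactor: "elem_norm (cofactor a t x y) = a * lattice_form a t x y"
proof -
  have "(cmod (cofactor a t x y))\<^sup>2 = of_int (norm_form (a * x + t * y) y)"
    unfolding cofactor_eq_cnj complex_mod_cnj by (rule cmod_el)
  then show ?thesis unfolding norm_form_lattice_form[OF f] by (simp only: elem_norm_def floor_of_int)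
qed

lemma lattice_form_nonneg: "0 \<le> lattice_form a t x y"
  using norm_form_nonneg[of "a * x + t * y" y] a unfolding norm_form_lattice_form[OF f] by (simp add: zero_le_mult_iff)

lemma base_lattice_ideal: "nonzero_ideal (ideal_lattice 1 a t)"
  by (rule nonzero_ideal_lattice) (use a f in auto)

text \<open>
  This is $A \bar A \subseteq (a)$, because $(t + \omega)(t + \bar\omega) = t^2 + t + m$ is divisible by
  $a$.
\<close>
lemma cofactor_mult_in: "(*) (cofactor a t x y / of_int a) ` ideal_lattice 1 a t \<subseteq> maxorder"
proof
  fix w assume "w \<in> (*) (cofactor a t x y / of_int a) ` ideal_lattice 1 a t"
  then obtain p q where w: "w = cofactor a t x y / of_int a * el (a * p + t * q) q"
    by (auto simp: ideal_lattice_def)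
  obtain c where c: "minpoly_at m t = a * c" using f by auto
  have "cofactor a t x y * el (a * p + t * q) q =
      el (a * (a * x * p + x * t * q + (t + 1) * y * p) + minpoly_at m t * (y * q)) (a * (x * q - y * p))"
    unfolding cofactor_def el_mult by (simp add: minpoly_at_def power2_eq_square algebra_simps)
  also have "\<dots> = of_int a * el (a * x * p + x * t * q + (t + 1) * y * p + c * (y * q)) (x * q - y * p)"
    unfolding c by (simp add: el_def algebra_simps)
  finally have "w = el (a * x * p + x * t * q + (t + 1) * y * p + c * (y * q)) (x * q - y * p)"
    using a by (simp add: w)
  then show "w \<in> maxorder" by (simp add: mem_maxorder)
qed

text \<open>
  For $I = (\gamma/a) A$ the identity $aI = \gamma A$ gives
  $a^2\, \mathrm{N} I = \mathrm{N}\gamma \cdot \mathrm{N} A$, where $\mathrm{N} A = a$.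
\<close>
lemma class_ideal_props:
  assumes "(x, y) \<noteq> (0, 0)"
  shows "nonzero_ideal (class_ideal a t (x, y))"
    and "ideal_norm (class_ideal a t (x, y)) = lattice_form a t x y"
    and "class_ideal a t (x, y) \<in> homothety_class (ideal_lattice 1 a t)"
proof -
  let ?\<gamma> = "cofactor a t x y"
  have \<gamma>0: "?\<gamma> \<noteq> 0" using assms by (simp add: cofactor_eq_0)
  show o: "nonzero_ideal (class_ideal a t (x, y))"
    unfolding class_ideal_def prod.case using \<gamma>0 a by (intro nonzero_ideal_scale base_lattice_ideal cofactor_mult_in) auto
  have "(*) (of_int a) ` class_ideal a t (x, y) = (*) ?\<gamma> ` ideal_lattice 1 a t"
    unfolding class_ideal_def prod.case image_image using a by (intro image_cong) auto
  then have "ideal_norm ((*) (of_int a) ` class_ideal a t (x, y)) = ideal_norm ((*) ?\<gamma> ` ideal_lattice 1 a t)" by simp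
  moreover have "ideal_norm ((*) (of_int a) ` class_ideal a t (x, y)) = \<bar>elem_norm (of_int a)\<bar> * ideal_norm (class_ideal a t (x, y))"
    using o by (intro ideal_norm_scale maxorder_closed) (simp add: nonzero_ideal_def)
  moreover have "elem_norm (of_int a) = a\<^sup>2"
    unfolding el_int elem_norm_el by (simp add: norm_form_def)
  moreover have "ideal_norm ((*) ?\<gamma> ` ideal_lattice 1 a t) = \<bar>elem_norm ?\<gamma>\<bar> * ideal_norm (ideal_lattice 1 a t)"
    by (intro ideal_norm_scale cofactor_maxorder ideal_lattice_subset)
  moreover have "ideal_norm (ideal_lattice 1 a t) = a" using ideal_norm_lattice[of 1 a t] a f by simp
  ultimately have "a\<^sup>2 * ideal_norm (class_ideal a t (x, y)) = a\<^sup>2 * lattice_form a t x y"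
    using lattice_form_nonneg[of x y] a by (simp add: elem_norm_cofactor power2_eq_square abs_mult)
  then show "ideal_norm (class_ideal a t (x, y)) = lattice_form a t x y" using a by simp
  have "of_int d * (z / of_int d) \<in> maxorder" if "z \<in> maxorder" "0 < d" for z and d :: int
    using that by simp
  then have "?\<gamma> / of_int a \<in> K" unfolding K_iff using a cofactor_maxorder by blast
  moreover have "?\<gamma> / of_int a \<noteq> 0" using \<gamma>0 a by simp
  ultimately show "class_ideal a t (x, y) \<in> homothety_class (ideal_lattice 1 a t)"
    unfolding homothety_class_def class_ideal_def prod.case using \<open>?\<gamma> / of_int a \<noteq> 0\<close> by blast
qed

text \<open>
  If $cA$ is contained in $\mathbb{Z}[\omega]$ then so are $ca = u + v\omega$ and $c(t + \omega)$, and
  $ca\,(t + \omega) = a \cdot c(t + \omega)$ is divisible by $a$. Its coefficient of $\omega$ is $u + v(t+1)$,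
  and divisibility by $a$ of that number says that $ca \in \bar A$.
\<close>
lemma class_ideal_surj:
  assumes I: "nonzero_ideal I" "I \<in> homothety_class (ideal_lattice 1 a t)"
  obtains x y where "(x, y) \<noteq> (0, 0)" "I = class_ideal a t (x, y)"
proof -
  obtain c where c: "c \<noteq> 0" "I = (*) c ` ideal_lattice 1 a t"
    using I(2) by (auto simp: homothety_class_def)
  have "el (1 * (a * 1 + t * 0)) (1 * 0) \<in> ideal_lattice 1 a t" "el (1 * (a * 0 + t * 1)) (1 * 1) \<in> ideal_lattice 1 a t"
    unfolding ideal_lattice_def by blast+
  then have "c * el a 0 \<in> maxorder" "c * el t 1 \<in> maxorder"
    using I(1) c(2) by (auto simp: nonzero_ideal_def)
  then obtain u v p q where uv: "c * el a 0 = el u v" and pq: "c * el t 1 = el p q"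
    using maxorderE by metis
  have "el u v * el t 1 = el (a * p) (a * q)"
  proof -
    have "el u v * el t 1 = el a 0 * el p q" unfolding uv[symmetric] pq[symmetric] by simp
    then show ?thesis by (simp add: el_mult)
  qed
  then have "u + v * t + v = a * q" by (simp add: el_mult el_eq_iff)
  then have "cofactor a t q (- v) = el u v" unfolding cofactor_def el_eq_iff by (simp add: algebra_simps)
  then have "cofactor a t q (- v) = c * of_int a" using uv by (simp add: el_int)
  then have eq: "cofactor a t q (- v) / of_int a = c" using a by simp
  then have "I = class_ideal a t (q, - v)" by (simp only: c(2) class_ideal_def prod.case)
  moreover have "(q, - v) \<noteq> (0, 0)" using eq c(1) cofactor_eq_0[of q "- v"] by auto
  ultimately show ?thesis using that by blast
qed

text \<open>
  If $\gamma A = \gamma' A$ then $\gamma'/\gamma$ is a multiplier of $A$, hence integral, and it has norm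
  $1$.
\<close>
lemma class_ideal_eq_iff:
  assumes ne: "(x, y) \<noteq> (0, 0)" "(x', y') \<noteq> (0, 0)"
  shows "class_ideal a t (x, y) = class_ideal a t (x', y') \<longleftrightarrow> (x', y') = (x, y) \<or> (x', y') = (- x, - y)"
proof
  let ?A = "ideal_lattice 1 a t" and ?\<gamma> = "cofactor a t x y" and ?\<gamma>' = "cofactor a t x' y'"
  have \<gamma>0: "?\<gamma> \<noteq> 0" "?\<gamma>' \<noteq> 0"
    using ne by (simp_all add: cofactor_eq_0)
  assume eq: "class_ideal a t (x, y) = class_ideal a t (x', y')"
  define \<epsilon> where "\<epsilon> = ?\<gamma>' / ?\<gamma>"
  have \<epsilon>K: "\<epsilon> \<in> K" unfolding \<epsilon>_def divide_inverse
    using maxorder_subset_K cofactor_maxorder \<gamma>0 by (intro K_mult K_inverse) auto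
  have stable: "(*) \<epsilon> ` ?A = ?A"
  proof -
    have "(*) \<epsilon> ` ?A = (*) (of_int a / ?\<gamma>) ` class_ideal a t (x', y')"
      unfolding class_ideal_def prod.case image_image \<epsilon>_def using a by (intro image_cong) auto
    also have "\<dots> = (*) (of_int a / ?\<gamma>) ` class_ideal a t (x, y)" using eq by simp
    also have "\<dots> = (\<lambda>z. z) ` ?A"
      unfolding class_ideal_def prod.case image_image using a \<gamma>0 by (intro image_cong) auto
    finally show ?thesis by simp
  qed
  then have \<epsilon>O: "\<epsilon> \<in> maxorder"
    using ideal_lattice_multiplier_in_maxorder[OF a \<epsilon>K, of t] by simp
  have "ideal_norm ?A = \<bar>elem_norm \<epsilon>\<bar> * ideal_norm ?A"
    using ideal_norm_scale[OF \<epsilon>O ideal_lattice_subset, of 1 a t] stable by simp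
  moreover have "ideal_norm ?A = a" using ideal_norm_lattice[of 1 a t] a f by simp
  ultimately have "\<bar>elem_norm \<epsilon>\<bar> = 1" using a by simp
  moreover have "0 \<le> elem_norm \<epsilon>" by (simp add: elem_norm_def)
  ultimately have "\<epsilon> = 1 \<or> \<epsilon> = -1" using norm_one_unit[OF \<epsilon>O] by simp
  then have "?\<gamma>' = ?\<gamma> \<or> ?\<gamma>' = - ?\<gamma>"
    using \<gamma>0 by (auto simp: \<epsilon>_def field_simps)
  moreover have "- ?\<gamma> = cofactor a t (- x) (- y)" by (simp add: cofactor_def el_minus)
  ultimately show "(x', y') = (x, y) \<or> (x', y') = (- x, - y)" by (auto simp: cofactor_inject)
next
  have neg: "(*) (- c) ` ideal_lattice 1 a t = (*) c ` ideal_lattice 1 a t" for c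
  proof -
    have minus: "- z \<in> ideal_lattice 1 a t" if "z \<in> ideal_lattice 1 a t" for z
      using that base_lattice_ideal maxorder_closed(6)[of "-1"] unfolding nonzero_ideal_def by force
    have "(*) (- c) ` ideal_lattice 1 a t = (*) c ` uminus ` ideal_lattice 1 a t"
      by (simp add: image_image)
    also have "uminus ` ideal_lattice 1 a t = ideal_lattice 1 a t" using minus by (force simp: image_iff)
    finally show ?thesis .
  qed
  assume "(x', y') = (x, y) \<or> (x', y') = (- x, - y)"
  moreover have "cofactor a t (- x) (- y) = - cofactor a t x y" by (simp add: cofactor_def el_minus)
  then have "class_ideal a t (- x, - y) = class_ideal a t (x, y)"
    unfolding class_ideal_def prod.case by (simp only: neg divide_minus_left)
  ultimately show "class_ideal a t (x, y) = class_ideal a t (x', y')" by auto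
qed

lemma two_card_class_ideals:
  assumes fin: "finite {(x, y). lattice_form a t x y \<le> X}"
  shows "2 * card {I. nonzero_ideal I \<and> I \<in> homothety_class (ideal_lattice 1 a t) \<and> ideal_norm I \<le> X} =
      card ({(x, y). lattice_form a t x y \<le> X} - {(0, 0)})"
    and "finite {I. nonzero_ideal I \<and> I \<in> homothety_class (ideal_lattice 1 a t) \<and> ideal_norm I \<le> X}"
proof -
  let ?P = "{(x, y). lattice_form a t x y \<le> X} - {(0, 0)}"
    and ?S = "{I. nonzero_ideal I \<and> I \<in> homothety_class (ideal_lattice 1 a t) \<and> ideal_norm I \<le> X}"
  have S: "class_ideal a t ` ?P = ?S"
  proof
    show "class_ideal a t ` ?P \<subseteq> ?S" using class_ideal_props by fastforce
    show "?S \<subseteq> class_ideal a t ` ?P"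
    proof
      fix I assume I: "I \<in> ?S"
      then obtain x y where xy: "(x, y) \<noteq> (0, 0)" "I = class_ideal a t (x, y)"
        using class_ideal_surj by blast
      then have "lattice_form a t x y \<le> X" using I class_ideal_props(2)[OF xy(1)] by simp
      then show "I \<in> class_ideal a t ` ?P" using xy by auto
    qed
  qed
  have finP: "finite ?P" using fin by simp
  then show "finite ?S" unfolding S[symmetric] by (rule finite_imageI)
  have fiber: "card {q \<in> ?P. class_ideal a t q = I} = 2" if "I \<in> ?S" for I
  proof -
    have "I \<in> class_ideal a t ` ?P" using that by (simp only: S)
    then obtain q where "I = class_ideal a t q" "q \<in> ?P" by (rule imageE)
    moreover obtain x y where "q = (x, y)" by (cases q)
    ultimately have xy: "(x, y) \<in> ?P" "I = class_ideal a t (x, y)" by simp_all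
    have ne: "(x, y) \<noteq> (0, 0)" using xy by simp
    have "{q \<in> ?P. class_ideal a t q = I} = {(x, y), (- x, - y)}"
    proof
      show "{q \<in> ?P. class_ideal a t q = I} \<subseteq> {(x, y), (- x, - y)}"
      proof
        fix q assume q: "q \<in> {q \<in> ?P. class_ideal a t q = I}"
        obtain x' y' where q': "q = (x', y')" by (cases q)
        have "(x', y') \<noteq> (0, 0)" "class_ideal a t (x, y) = class_ideal a t (x', y')"
          using q unfolding q' xy(2) by simp_all
        then show "q \<in> {(x, y), (- x, - y)}" using class_ideal_eq_iff[OF ne] q' by simp
      qed
      have "lattice_form a t (- x) (- y) = lattice_form a t x y" by (simp add: lattice_form_def)
      moreover have "class_ideal a t (- x, - y) = I"
        using class_ideal_eq_iff[OF ne, of "- x" "- y"] ne xy(2) by auto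
      ultimately show "{(x, y), (- x, - y)} \<subseteq> {q \<in> ?P. class_ideal a t q = I}"
        using xy by auto
    qed
    moreover have "(x, y) \<noteq> (- x, - y)" using ne by auto
    ultimately show ?thesis by simp
  qed
  have "card ?P = (\<Sum>q\<in>?P. 1)" by simp
  also have "\<dots> = (\<Sum>I\<in>class_ideal a t ` ?P. \<Sum>q | q \<in> ?P \<and> class_ideal a t q = I. 1)"
    by (rule sum.image_gen[OF finP])
  also have "\<dots> = (\<Sum>I\<in>?S. 2)" unfolding S using fiber by (intro sum.cong) simp_all
  finally show "2 * card ?S = card ?P" by simp
qed

text \<open>
  Half of the nonzero lattice points in an ellipse of area $2\pi X/\sqrt N$.
\<close>
lemma class_ideal_density:
  "(\<lambda>X :: nat. real (card {I. nonzero_ideal I \<and> I \<in> homothety_class (ideal_lattice 1 a t) \<and> ideal_norm I \<le> int X}) / real X)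
    \<longlonglongrightarrow> pi / sqrt (of_int N)"
proof -
  let ?c = "minpoly_at m t div a"
  have ac: "a * ?c = minpoly_at m t" using f by simp
  have "N = 4 * a * ?c - (2 * t + 1)\<^sup>2"
    unfolding mult.assoc ac minpoly_at_discriminant N_props(5) by simp
  note asym = lattice_points_form_asymptotic[OF a N_props(3) this, folded lattice_form_def]
  define n where "n = (\<lambda>X :: nat. card {(x, y). lattice_form a t x y \<le> int X})"
  have lim: "(\<lambda>X. real (n X) / real X) \<longlonglongrightarrow> 2 * pi / sqrt (of_int N)"
    using asym(2) by (simp add: n_def)
  have cnt: "2 * card {I. nonzero_ideal I \<and> I \<in> homothety_class (ideal_lattice 1 a t) \<and> ideal_norm I \<le> int X} + 1 = n X" for X
  proof -
    (* The origin lies in the ellipse but belongs to no ideal; it accounts for the summand 1. *)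
    have "(0, 0) \<in> {(x, y). lattice_form a t x y \<le> int X}" by (simp add: lattice_form_def)
    from card_Suc_Diff1[OF asym(1) this] show ?thesis
      unfolding n_def two_card_class_ideals(1)[OF asym(1)] by simp
  qed
  have eq: "real (card {I. nonzero_ideal I \<and> I \<in> homothety_class (ideal_lattice 1 a t) \<and> ideal_norm I \<le> int X}) / real X =
      (real (n X) / real X - 1 / real X) / 2" for X
    unfolding cnt[of X, symmetric] by (simp add: add_divide_distrib)
  have "(\<lambda>X. (real (n X) / real X - 1 / real X) / 2) \<longlonglongrightarrow> (2 * pi / sqrt (of_int N) - 0) / 2"
    by (rule tendsto_divide[OF tendsto_diff[OF lim lim_1_over_n] tendsto_const]) simp
  then show ?thesis unfolding eq by simp
qed

end

end

section \<open>The class number formula\<close>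

context odd_discriminant
begin

lemma card_ideals_of_norm:
  assumes n: "0 < n"
  shows "card {I. nonzero_ideal I \<and> ideal_norm I = int n} = ideal_count m n"
    and "finite {I. nonzero_ideal I \<and> ideal_norm I = int n}"
proof -
  let ?S = "SIGMA k:{k. k\<^sup>2 dvd n}. minpoly_roots m (n div k\<^sup>2)"
  let ?f = "\<lambda>(k, t). ideal_lattice (int k) (int (n div k\<^sup>2)) t"
  have pos: "0 < int k" "0 < int (n div k\<^sup>2)" if "k\<^sup>2 dvd n" for k
    using that n by (auto elim!: dvdE intro!: gr0I)
  have "bij_betw ?f ?S {I. nonzero_ideal I \<and> ideal_norm I = int n}"
    unfolding bij_betw_def
  proof
    show "inj_on ?f ?S"
    proof (rule inj_onI)
      fix u v assume u: "u \<in> ?S" and v: "v \<in> ?S" and eq: "?f u = ?f v"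
      obtain k t where kt: "u = (k, t)" by (cases u)
      obtain k' t' where kt': "v = (k', t')" by (cases v)
      have h: "k\<^sup>2 dvd n" "0 \<le> t" "t < int (n div k\<^sup>2)" "k'\<^sup>2 dvd n" "0 \<le> t'" "t' < int (n div k'\<^sup>2)"
        using u v unfolding kt kt' by (auto simp: minpoly_roots_def)
      have "int k = int k' \<and> int (n div k\<^sup>2) = int (n div k'\<^sup>2) \<and> t = t'"
        by (rule ideal_lattice_inject[OF pos(1)[OF h(1)] pos(1)[OF h(4)] pos(2)[OF h(1)] pos(2)[OF h(4)] h(2,3,5,6)])
          (use eq kt kt' in simp)
      then show "u = v" by (simp add: kt kt')
    qed
    show "?f ` ?S = {I. nonzero_ideal I \<and> ideal_norm I = int n}"
    proof
      show "?f ` ?S \<subseteq> {I. nonzero_ideal I \<and> ideal_norm I = int n}"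
      proof
        fix I assume "I \<in> ?f ` ?S"
        then obtain k t where kt: "k\<^sup>2 dvd n" "t \<in> minpoly_roots m (n div k\<^sup>2)" "I = ideal_lattice (int k) (int (n div k\<^sup>2)) t"
          by auto
        have f: "int (n div k\<^sup>2) dvd minpoly_at m t" using kt by (simp add: minpoly_roots_def)
        have "(int k)\<^sup>2 * int (n div k\<^sup>2) = int n"
          using kt(1) by (metis dvd_mult_div_cancel of_nat_mult of_nat_power)
        then show "I \<in> {I. nonzero_ideal I \<and> ideal_norm I = int n}"
          using nonzero_ideal_lattice[OF pos[OF kt(1)] f] ideal_norm_lattice[OF pos[OF kt(1)] f] kt(3) by simp
      qed
      show "{I. nonzero_ideal I \<and> ideal_norm I = int n} \<subseteq> ?f ` ?S"
      proof
        fix I assume I: "I \<in> {I. nonzero_ideal I \<and> ideal_norm I = int n}"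
        then obtain k a t where kat: "0 < k" "0 < a" "0 \<le> t" "t < a" "a dvd minpoly_at m t" "I = ideal_lattice k a t"
          using nonzero_ideal_eq_lattice by blast
        obtain k' where k': "k = int k'" using kat(1) by (metis zero_less_imp_eq_int)
        obtain a' where a': "a = int a'" using kat(2) by (metis zero_less_imp_eq_int)
        have "k\<^sup>2 * a = int n" using I ideal_norm_lattice[OF kat(1,2,5)] kat(6) by simp
        then have "int (k'\<^sup>2 * a') = int n" unfolding k' a' by simp
        then have n': "n = k'\<^sup>2 * a'" by (simp only: of_nat_eq_iff)
        have "n div k'\<^sup>2 = a'" using kat(1) unfolding n' k' by simp
        moreover have "(k', t) \<in> ?S"
          using calculation n' kat(3,4,5) by (simp add: minpoly_roots_def a')
        ultimately show "I \<in> ?f ` ?S" using kat(6) k' a' by force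
      qed
    qed
  qed
  then have "card ?S = card {I. nonzero_ideal I \<and> ideal_norm I = int n}" "finite ?S \<longleftrightarrow> finite {I. nonzero_ideal I \<and> ideal_norm I = int n}"
    by (rule bij_betw_same_card, rule bij_betw_finite)
  moreover have "card ?S = ideal_count m n"
    unfolding ideal_count_def root_count_def
    by (rule card_SigmaI) (use finite_square_divisors[OF n] finite_minpoly_roots in auto)
  moreover have "finite ?S"
    using finite_square_divisors[OF n] finite_minpoly_roots by (intro finite_SigmaI) auto
  ultimately show "card {I. nonzero_ideal I \<and> ideal_norm I = int n} = ideal_count m n"
    "finite {I. nonzero_ideal I \<and> ideal_norm I = int n}" by simp_all
qed

lemma ideal_norm_pos: "nonzero_ideal I \<Longrightarrow> 0 < ideal_norm I"
  by (erule nonzero_ideal_eq_lattice) (simp add: ideal_norm_lattice)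

lemma card_ideals_norm_le:
  shows "card {I. nonzero_ideal I \<and> ideal_norm I \<le> int X} = (\<Sum>n=1..X. ideal_count m n)"
    and "finite {I. nonzero_ideal I \<and> ideal_norm I \<le> int X}"
proof -
  have U: "{I. nonzero_ideal I \<and> ideal_norm I \<le> int X} = (\<Union>n\<in>{1..X}. {I. nonzero_ideal I \<and> ideal_norm I = int n})"
  proof
    show "{I. nonzero_ideal I \<and> ideal_norm I \<le> int X} \<subseteq> (\<Union>n\<in>{1..X}. {I. nonzero_ideal I \<and> ideal_norm I = int n})"
    proof
      fix I assume I: "I \<in> {I. nonzero_ideal I \<and> ideal_norm I \<le> int X}"
      then have "0 < ideal_norm I" using ideal_norm_pos by simp
      then obtain n where "ideal_norm I = int n" "0 < n" by (metis zero_less_imp_eq_int)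
      then show "I \<in> (\<Union>n\<in>{1..X}. {I. nonzero_ideal I \<and> ideal_norm I = int n})"
        using I by (auto intro!: bexI[of _ n])
    qed
  qed auto
  have fin: "finite {I. nonzero_ideal I \<and> ideal_norm I = int n}" if "n \<in> {1..X}" for n
    using that by (intro card_ideals_of_norm(2)) simp
  show "finite {I. nonzero_ideal I \<and> ideal_norm I \<le> int X}" unfolding U using fin by blast
  have "card {I. nonzero_ideal I \<and> ideal_norm I \<le> int X} = (\<Sum>n=1..X. card {I. nonzero_ideal I \<and> ideal_norm I = int n})"
    unfolding U by (rule card_UN_disjoint) (use fin in auto)
  also have "\<dots> = (\<Sum>n=1..X. ideal_count m n)"
    by (intro sum.cong refl card_ideals_of_norm(1)) simp
  finally show "card {I. nonzero_ideal I \<and> ideal_norm I \<le> int X} = (\<Sum>n=1..X. ideal_count m n)" .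
qed

text \<open>
  Here the count by norms meets the mean value of the divisor sums of the character.
\<close>
lemma ideal_density:
  "(\<lambda>X :: nat. real (card {I. nonzero_ideal I \<and> ideal_norm I \<le> int X}) / real X) \<longlonglongrightarrow> L_value"
proof -
  obtain B where B: "bounded_block_sums (\<lambda>n. of_int (disc_char (int n))) B"
    using disc_char_bounded_block_sums by blast
  have "real (card {I. nonzero_ideal I \<and> ideal_norm I \<le> int X}) = (\<Sum>n=1..X. \<Sum>d | d dvd n. real_of_int (disc_char (int d)))" for X
  proof -
    have "real (card {I. nonzero_ideal I \<and> ideal_norm I \<le> int X}) = (\<Sum>n=1..X. real_of_int (int (ideal_count m n)))"
      by (simp add: card_ideals_norm_le(1))
    also have "\<dots> = (\<Sum>n=1..X. \<Sum>d | d dvd n. real_of_int (disc_char (int d)))"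
      by (intro sum.cong refl, subst ideal_count_eq_divisor_sum) (simp_all add: divisor_sum_def)
    finally show ?thesis .
  qed
  then show ?thesis using mean_of_divisor_sums[OF B] by (simp add: L_value_def)
qed

lemma homothety_class_scale:
  assumes d: "d \<in> K" "d \<noteq> 0"
  shows "homothety_class ((*) d ` I) = homothety_class I"
proof
  show "homothety_class ((*) d ` I) \<subseteq> homothety_class I"
  proof
    fix J assume "J \<in> homothety_class ((*) d ` I)"
    then obtain c where c: "c \<in> K" "c \<noteq> 0" "J = (*) c ` (*) d ` I"
      by (auto simp: homothety_class_def)
    have "J = (*) (c * d) ` I" unfolding c(3) image_image by (simp add: mult.assoc)
    moreover have "c * d \<in> K" "c * d \<noteq> 0" using c d K_mult by simp_all
    ultimately show "J \<in> homothety_class I" unfolding homothety_class_def by blast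
  qed
  show "homothety_class I \<subseteq> homothety_class ((*) d ` I)"
  proof
    fix J assume "J \<in> homothety_class I"
    then obtain c where c: "c \<in> K" "c \<noteq> 0" "J = (*) c ` I" by (auto simp: homothety_class_def)
    have "J = (*) (c * inverse d) ` (*) d ` I"
      unfolding c(3) image_image using d(2) by (intro image_cong) auto
    moreover have "c * inverse d \<in> K" "c * inverse d \<noteq> 0"
      using c d K_mult K_inverse by simp_all
    ultimately show "J \<in> homothety_class ((*) d ` I)" unfolding homothety_class_def by blast
  qed
qed

lemma homothety_class_eq:
  assumes "J \<in> homothety_class I" shows "homothety_class J = homothety_class I"
proof -
  obtain c where "c \<in> K" "c \<noteq> 0" "J = (*) c ` I"
    using assms unfolding homothety_class_def by blast
  then show ?thesis using homothety_class_scale by simp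
qed

lemma homothety_class_refl: "I \<in> homothety_class I"
proof -
  have "1 \<in> K" using maxorder_subset_K maxorder_closed(8) by blast
  moreover have "I = (*) 1 ` I" by simp
  ultimately show ?thesis unfolding homothety_class_def by (metis (mono_tags, lifting) CollectI one_neq_zero)
qed

lemma nonzero_ideal_fractional:
  assumes I: "nonzero_ideal I"
  shows "fractional_ideal (1 - 4 * m) I"
proof -
  let ?F = "quadratic_field (1 - 4 * m)"
  have sub: "I \<subseteq> maxorder"
    and diff: "\<And>x y. x \<in> I \<Longrightarrow> y \<in> I \<Longrightarrow> x - y \<in> I"
    and mult: "\<And>a x. a \<in> maxorder \<Longrightarrow> x \<in> I \<Longrightarrow> a * x \<in> I"
    using I by (auto simp: nonzero_ideal_def)
  obtain x0 where x0: "x0 \<in> I" "x0 \<noteq> 0" using I by (auto simp: nonzero_ideal_def)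
  have zero: "0 \<in> I" using diff[OF x0(1) x0(1)] by simp
  have neg: "- x \<in> I" if "x \<in> I" for x using diff[OF zero that] by simp
  have K_neg: "- x \<in> K" if "x \<in> K" for x
    using K_mult[OF _ that, of "of_int (-1)"] maxorder_subset_K maxorder_closed(6)[of "-1"] by auto
  have "subgroup I (add_monoid ?F)"
  proof (rule subgroup.intro)
    show "I \<subseteq> carrier (add_monoid ?F)" using sub maxorder_subset_K by auto
    show "x \<otimes>\<^bsub>add_monoid ?F\<^esub> y \<in> I" if "x \<in> I" "y \<in> I" for x y
      using diff[OF that(1) neg[OF that(2)]] by (simp add: quadratic_field_def)
    show "\<one>\<^bsub>add_monoid ?F\<^esub> \<in> I" using zero by (simp add: quadratic_field_def)
    show "inv\<^bsub>add_monoid ?F\<^esub> x \<in> I" if "x \<in> I" for x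
    proof -
      have "x \<in> K" using that sub maxorder_subset_K by blast
      have "inv\<^bsub>add_monoid ?F\<^esub> x = - x"
        unfolding m_inv_def
      proof (rule the_equality)
        show "- x \<in> carrier (add_monoid ?F) \<and> x \<otimes>\<^bsub>add_monoid ?F\<^esub> - x = \<one>\<^bsub>add_monoid ?F\<^esub> \<and>
            - x \<otimes>\<^bsub>add_monoid ?F\<^esub> x = \<one>\<^bsub>add_monoid ?F\<^esub>"
          using K_neg[OF \<open>x \<in> K\<close>] by (simp add: quadratic_field_def)
        show "y = - x"
          if "y \<in> carrier (add_monoid ?F) \<and> x \<otimes>\<^bsub>add_monoid ?F\<^esub> y = \<one>\<^bsub>add_monoid ?F\<^esub> \<and>
            y \<otimes>\<^bsub>add_monoid ?F\<^esub> x = \<one>\<^bsub>add_monoid ?F\<^esub>" for y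
          using that by (simp add: quadratic_field_def eq_neg_iff_add_eq_0)
      qed
      then show ?thesis using neg[OF that] by simp
    qed
  qed
  then have "additive_subgroup I ?F" by (rule additive_subgroup.intro)
  moreover have "\<exists>d\<in>maxorder. d \<noteq> 0 \<and> (\<forall>x\<in>I. d * x \<in> maxorder)"
    using sub maxorder_closed(8) by (intro bexI[of _ 1]) auto
  ultimately show ?thesis
    unfolding fractional_ideal_def integer_ring_eq using mult x0 by auto
qed

lemma fractional_ideal_homothety_class:
  assumes I: "fractional_ideal (1 - 4 * m) I"
  obtains J where "nonzero_ideal J" "homothety_class J = homothety_class I"
proof -
  interpret additive_subgroup I "quadratic_field (1 - 4 * m)"
    using I by (simp add: fractional_ideal_def)
  have zero: "0 \<in> I" using zero_closed by (simp add: quadratic_field_def)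
  have add: "x + y \<in> I" if "x \<in> I" "y \<in> I" for x y
    using a_closed[OF that] by (simp add: quadratic_field_def)
  have mult: "\<And>a x. a \<in> maxorder \<Longrightarrow> x \<in> I \<Longrightarrow> a * x \<in> I"
    and ne: "I \<noteq> {0}"
    using I by (auto simp: fractional_ideal_def integer_ring_eq)
  obtain d where d: "d \<in> maxorder" "d \<noteq> 0" "\<And>x. x \<in> I \<Longrightarrow> d * x \<in> maxorder"
    using I by (auto simp: fractional_ideal_def integer_ring_eq)
  have diff: "x - y \<in> I" if "x \<in> I" "y \<in> I" for x y
    using add[OF that(1) mult[OF maxorder_closed(6)[of "-1"] that(2)]] by simp
  (* Clearing denominators moves I to an integral ideal of the same class. *)
  have "nonzero_ideal ((*) d ` I)"
    unfolding nonzero_ideal_def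
  proof (intro conjI ballI)
    show "(*) d ` I \<subseteq> maxorder" using d by auto
    show "x - y \<in> (*) d ` I" if "x \<in> (*) d ` I" "y \<in> (*) d ` I" for x y
      using that diff by (auto simp: right_diff_distrib[symmetric])
    show "b * x \<in> (*) d ` I" if "b \<in> maxorder" "x \<in> (*) d ` I" for b x
      using that mult by (auto simp: mult.left_commute)
    show "\<exists>x\<in>(*) d ` I. x \<noteq> 0" using ne zero d by auto
  qed
  moreover have "homothety_class ((*) d ` I) = homothety_class I"
    using d maxorder_subset_K by (intro homothety_class_scale) auto
  ultimately show ?thesis using that by blast
qed

definition ideal_classes :: "complex set set set" where
  "ideal_classes = homothety_class ` {I. nonzero_ideal I}"

text \<open>
  Finite sums of products of elements of $c\,\mathbb{Z}[\omega]$ and $I$ are again in $cI$, as $I$ is a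
  module over $\mathbb{Z}[\omega]$.
\<close>
lemma principal_ideal_prod:
  assumes I: "fractional_ideal (1 - 4 * m) I"
  shows "ideal_prod (quadratic_field (1 - 4 * m)) ((*) c ` maxorder) I = (*) c ` I"
proof
  interpret additive_subgroup I "quadratic_field (1 - 4 * m)"
    using I by (simp add: fractional_ideal_def)
  have add: "x + y \<in> I" if "x \<in> I" "y \<in> I" for x y
    using a_closed[OF that] by (simp add: quadratic_field_def)
  have mult: "\<And>a x. a \<in> maxorder \<Longrightarrow> x \<in> I \<Longrightarrow> a * x \<in> I"
    using I by (auto simp: fractional_ideal_def integer_ring_eq)
  show "ideal_prod (quadratic_field (1 - 4 * m)) ((*) c ` maxorder) I \<subseteq> (*) c ` I"
  proof
    fix z assume "z \<in> ideal_prod (quadratic_field (1 - 4 * m)) ((*) c ` maxorder) I"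
    then show "z \<in> (*) c ` I"
    proof induction
      case (prod i j)
      then show ?case using mult by (auto simp: quadratic_field_def mult.assoc)
    next
      case (sum s1 s2)
      then show ?case using add by (auto simp: quadratic_field_def distrib_left[symmetric])
    qed
  qed
  show "(*) c ` I \<subseteq> ideal_prod (quadratic_field (1 - 4 * m)) ((*) c ` maxorder) I"
  proof
    fix z assume "z \<in> (*) c ` I"
    then obtain x where x: "x \<in> I" "z = c * x" by auto
    have "c \<in> (*) c ` maxorder"
      using maxorder_closed(8) by (auto simp: image_iff intro!: bexI[of _ 1])
    from ideal_prod.prod[OF this x(1), of "quadratic_field (1 - 4 * m)"]
    show "z \<in> ideal_prod (quadratic_field (1 - 4 * m)) ((*) c ` maxorder) I"
      by (simp add: quadratic_field_def x(2))
  qed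
qed

text \<open>
  The coset of $I$ modulo principal fractional ideals consists of the products $(c) I = cI$, and every
  class contains an integral ideal.
\<close>
lemma class_number_eq: "class_number (1 - 4 * m) = card ideal_classes"
proof -
  let ?G = "fractional_ideal_group (1 - 4 * m)" and ?P = "principal_fractional_ideals (1 - 4 * m)"
  have coset: "r_coset ?G ?P I = homothety_class I" if I: "fractional_ideal (1 - 4 * m) I" for I
  proof -
    have "r_coset ?G ?P I = {ideal_prod (quadratic_field (1 - 4 * m)) H I | H. H \<in> ?P}"
      by (auto simp: r_coset_def fractional_ideal_group_def)
    also have "\<dots> = {ideal_prod (quadratic_field (1 - 4 * m)) ((*) c ` maxorder) I | c. c \<in> K \<and> c \<noteq> 0}"
      unfolding principal_fractional_ideals_def integer_ring_eq by blast
    also have "\<dots> = homothety_class I" unfolding homothety_class_def principal_ideal_prod[OF I] ..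
    finally show ?thesis .
  qed
  have "carrier (ideal_class_group (1 - 4 * m)) = homothety_class ` {I. fractional_ideal (1 - 4 * m) I}"
    unfolding ideal_class_group_def FactGroup_def RCOSETS_def
    using coset by (auto simp: fractional_ideal_group_def image_iff)
  also have "\<dots> = ideal_classes"
  proof
    show "homothety_class ` {I. fractional_ideal (1 - 4 * m) I} \<subseteq> ideal_classes"
    proof
      fix Q assume "Q \<in> homothety_class ` {I. fractional_ideal (1 - 4 * m) I}"
      then obtain I where I: "fractional_ideal (1 - 4 * m) I" "Q = homothety_class I" by auto
      then obtain J where "nonzero_ideal J" "homothety_class J = homothety_class I"
        using fractional_ideal_homothety_class by blast
      then show "Q \<in> ideal_classes" using I(2) by (auto simp: ideal_classes_def)
    qed
    show "ideal_classes \<subseteq> homothety_class ` {I. fractional_ideal (1 - 4 * m) I}"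
      unfolding ideal_classes_def using nonzero_ideal_fractional by (intro image_mono) auto
  qed
  finally show ?thesis by (simp add: class_number_def order_def)
qed

definition class_count :: "complex set set \<Rightarrow> nat \<Rightarrow> nat" where
  "class_count Q X = card {I. nonzero_ideal I \<and> I \<in> Q \<and> ideal_norm I \<le> int X}"

lemma class_count_density:
  assumes "Q \<in> ideal_classes"
  shows "(\<lambda>X. real (class_count Q X) / real X) \<longlonglongrightarrow> pi / sqrt (of_int N)"
proof -
  obtain I where I: "nonzero_ideal I" "Q = homothety_class I"
    using assms by (auto simp: ideal_classes_def)
  then obtain k a t where kat: "0 < k" "0 < a" "0 \<le> t" "t < a" "a dvd minpoly_at m t" "I = ideal_lattice k a t"
    using nonzero_ideal_eq_lattice by blast
  have "I = (*) (of_int k) ` ideal_lattice 1 a t"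
  proof -
    have img: "(*) c ` {g x y | x y. True} = {c * g x y | x y. True}"
      for c :: complex and g :: "int \<Rightarrow> int \<Rightarrow> complex"
      by blast
    have scale: "el (k * (a * x + t * y)) (k * y) = of_int k * el (1 * (a * x + t * y)) (1 * y)" for x y
      by (simp add: el_def algebra_simps)
    show ?thesis unfolding kat(6) ideal_lattice_def img by (simp only: scale)
  qed
  moreover have "of_int k \<in> K" using maxorder_subset_K maxorder_closed(6) by blast
  ultimately have "Q = homothety_class (ideal_lattice 1 a t)"
    using homothety_class_scale[of "of_int k"] kat(1) I(2) by simp
  then show ?thesis using class_ideal_density[OF kat(2,5)] by (simp add: class_count_def)
qed

text \<open>
  Distinct classes are disjoint, and together they contain all ideals.
\<close>
lemma sum_class_counts:
  assumes F: "finite F" "F \<subseteq> ideal_classes"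
  shows "(\<Sum>Q\<in>F. class_count Q X) \<le> card {I. nonzero_ideal I \<and> ideal_norm I \<le> int X}"
    and "F = ideal_classes \<Longrightarrow> (\<Sum>Q\<in>F. class_count Q X) = card {I. nonzero_ideal I \<and> ideal_norm I \<le> int X}"
proof -
  let ?T = "{I. nonzero_ideal I \<and> ideal_norm I \<le> int X}"
    and ?C = "\<lambda>Q. {I. nonzero_ideal I \<and> I \<in> Q \<and> ideal_norm I \<le> int X}"
  have fin: "finite ?T" by (rule card_ideals_norm_le)
  have "(\<Sum>Q\<in>F. class_count Q X) = card (\<Union>Q\<in>F. ?C Q)"
    unfolding class_count_def
  proof (rule card_UN_disjoint[symmetric])
    show "\<forall>Q\<in>F. \<forall>Q'\<in>F. Q \<noteq> Q' \<longrightarrow> ?C Q \<inter> ?C Q' = {}"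
    proof (intro ballI impI)
      fix Q Q' assume "Q \<in> F" "Q' \<in> F" "Q \<noteq> Q'"
      then have "Q \<in> ideal_classes" "Q' \<in> ideal_classes" using F(2) by auto
      then obtain J J' where "Q = homothety_class J" "Q' = homothety_class J'"
        unfolding ideal_classes_def by blast
      then have "Q \<inter> Q' = {}" using homothety_class_eq \<open>Q \<noteq> Q'\<close> by blast
      then show "?C Q \<inter> ?C Q' = {}" by blast
    qed
    show "\<forall>Q\<in>F. finite (?C Q)" by (intro ballI finite_subset[OF _ fin] subsetI) simp
  qed (rule F)
  moreover have sub: "(\<Union>Q\<in>F. ?C Q) \<subseteq> ?T" by blast
  ultimately show "(\<Sum>Q\<in>F. class_count Q X) \<le> card ?T" using card_mono[OF fin] by simp
  assume all: "F = ideal_classes"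
  have "?T \<subseteq> (\<Union>Q\<in>F. ?C Q)"
  proof
    fix I assume I: "I \<in> ?T"
    then have "homothety_class I \<in> F" by (simp add: all ideal_classes_def)
    moreover have "I \<in> ?C (homothety_class I)" using I homothety_class_refl by simp
    ultimately show "I \<in> (\<Union>Q\<in>F. ?C Q)" by (rule UN_I)
  qed
  then show "(\<Sum>Q\<in>F. class_count Q X) = card ?T"
    using sub \<open>(\<Sum>Q\<in>F. class_count Q X) = card (\<Union>Q\<in>F. ?C Q)\<close> by (simp add: subset_antisym)
qed

lemma sum_class_counts_density:
  assumes F: "finite F" "F \<subseteq> ideal_classes"
  shows "(\<lambda>X. real (\<Sum>Q\<in>F. class_count Q X) / real X) \<longlonglongrightarrow> real (card F) * (pi / sqrt (of_int N))"
proof -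
  have "(\<lambda>X. \<Sum>Q\<in>F. real (class_count Q X) / real X) \<longlonglongrightarrow> (\<Sum>Q\<in>F. pi / sqrt (of_int N))"
    using F by (intro tendsto_sum class_count_density) auto
  then show ?thesis by (simp add: sum_divide_distrib)
qed

text \<open>
  Finitely many classes $F$ have joint density $|F| \pi/\sqrt N$, which is at most the density $L$ of all
  ideals. This bounds $|F|$, so the set of all classes is finite, and for it equality holds.
\<close>
theorem class_number_formula:
  "real (class_number (1 - 4 * m)) * pi = sqrt (of_int N) * L_value"
proof -
  have pos: "0 < pi / sqrt (of_int N)" using N_props(3) by simp
  have le: "real (card F) * (pi / sqrt (of_int N)) \<le> L_value"
    if "finite F" "F \<subseteq> ideal_classes" for F
  proof (rule LIMSEQ_le[OF sum_class_counts_density[OF that] ideal_density])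
    show "\<exists>M. \<forall>X\<ge>M. real (\<Sum>Q\<in>F. class_count Q X) / real X \<le> real (card {I. nonzero_ideal I \<and> ideal_norm I \<le> int X}) / real X"
      using sum_class_counts(1)[OF that] by (intro exI allI impI divide_right_mono) (simp_all only: of_nat_le_iff of_nat_0_le_iff)
  qed
  have fin: "finite ideal_classes"
  proof (rule ccontr)
    assume inf: "infinite ideal_classes"
    obtain k :: nat where k: "L_value / (pi / sqrt (of_int N)) < real k"
      using reals_Archimedean2 by blast
    obtain F where F: "finite F" "card F = k" "F \<subseteq> ideal_classes"
      using infinite_arbitrarily_large[OF inf] by blast
    have "L_value < real k * (pi / sqrt (of_int N))" using k pos by (simp only: pos_divide_less_eq)
    then show False using le[OF F(1,3)] F(2) by simp
  qed
  have "real (card ideal_classes) * (pi / sqrt (of_int N)) = L_value"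
    using sum_class_counts_density[OF fin order_refl] ideal_density
    unfolding sum_class_counts(2)[OF fin order_refl refl] by (rule LIMSEQ_unique)
  then show ?thesis unfolding class_number_eq using N_props(3) by (auto simp: field_simps)
qed

lemma class_number_sixth:
  assumes "\<not> 3 dvd N"
  shows "int (class_number (1 - 4 * m)) = \<bar>\<Sum>x\<in>{x \<in> half_system. 6 * x < N}. disc_char x\<bar>"
proof -
  let ?S = "\<Sum>x\<in>{x \<in> half_system. 6 * x < N}. disc_char x"
  have "0 \<le> sqrt (of_int N) * L_value" unfolding class_number_formula[symmetric] by simp
  then have "\<bar>sqrt (of_int N) * L_value\<bar> = sqrt (of_int N) * L_value" by simp
  moreover have "\<bar>sqrt (of_int N) * L_value\<bar> = sqrt (of_int N) * \<bar>L_value\<bar>"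
    using N_props(3) by (simp add: abs_mult)
  ultimately have "pi * \<bar>real_of_int ?S\<bar> = real (class_number (1 - 4 * m)) * pi"
    using sum_sixth_L_value[OF assms] class_number_formula by simp
  then have "\<bar>real_of_int ?S\<bar> = real (class_number (1 - 4 * m))" by simp
  then have "real_of_int \<bar>?S\<bar> = real_of_int (int (class_number (1 - 4 * m)))" by simp
  then show ?thesis by (simp only: of_int_eq_iff)
qed

end

theorem corollary4p3:
  fixes D N :: int
  assumes "squarefree D"
    and "D < -4"
    and "[D = 1] (mod 4)"
    and "\<not> 3 dvd D"
    and "N = \<bar>D\<bar>"
  shows "int (class_number D) =
    \<bar>\<Sum>x | 1 \<le> x \<and> real_of_int x < real_of_int N / 6. chi D x\<bar>"
proof -
  have "4 dvd D - 1" using assms(3) by (simp add: cong_iff_dvd_diff)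
  then obtain j where j: "D - 1 = 4 * j" by auto
  define m where "m = - j"
  have D: "D = 1 - 4 * m" using j by (simp add: m_def)
  have m2: "2 \<le> m" using assms(2) D by linarith
  interpret odd_discriminant m
    using m2 assms(1) D by unfold_locales auto
  have N: "odd_discriminant.N m = N" using assms(2,5) D by (simp add: N_def)
  have "\<not> 3 dvd odd_discriminant.N m" using assms(4,5) N by simp
  then have "int (class_number D) = \<bar>\<Sum>x\<in>{x \<in> half_system. 6 * x < odd_discriminant.N m}. disc_char x\<bar>"
    unfolding D by (rule class_number_sixth)
  also have "{x \<in> half_system. 6 * x < odd_discriminant.N m} = {x. 1 \<le> x \<and> real_of_int x < real_of_int N / 6}"
  proof -
    have "real_of_int x < real_of_int N / 6 \<longleftrightarrow> 6 * x < N" for x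
    proof -
      have "real_of_int x < real_of_int N / 6 \<longleftrightarrow> real_of_int (6 * x) < real_of_int N"
        by auto
      then show ?thesis by (simp only: of_int_less_iff)
    qed
    moreover have "x \<in> half_system \<longleftrightarrow> 1 \<le> x" if "6 * x < N" for x
      using that unfolding half_system_def N by auto
    ultimately show ?thesis unfolding N by auto
  qed
  also have "(\<Sum>x | 1 \<le> x \<and> real_of_int x < real_of_int N / 6. disc_char x) =
      (\<Sum>x | 1 \<le> x \<and> real_of_int x < real_of_int N / 6. chi D x)"
    by (simp add: disc_char_def chi_def N assms(5))
  finally show ?thesis .
qed

end
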